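(* In the setting of the context (projectively uniformly hyperbolic $\{A_i\}_{i\in X}$ w.r.t. $\Sigma$, construction carried out, $0<\rho<1$ with $f_r([-1,1])\subset[-\rho,\rho]$ for all $r\in C$), define \[ E_C=\frac{1}{1-\rho}\Big(\max_{r\in C}\frac{|f_r^\top(0)|}{1+\sqrt{1-|f_r^\top(0)|^2}}\Big)\Big(\sum_{r\in C}\pi_r\,d_{\mathrm{hyp}}(f_r(0),0)\Big),\qquad D=\max_{r\in C}|f_r^\top(0)|. \] Then $0\le D<1$, and for all $n,m\in\mathbb N$ with $m\ge2$, \[ \Big|\lambda_+(A,P)-\sum_{\ell=0}^{n-1}\big[\mathrm T_{m\times m}^\ell\widehat{\boldsymbol v}\big]_{\boldsymbol 0}\Big|\le \frac{E_C}{d}\rho^{n-1}+\frac2d\Big(\log\frac1{1-\rho D}\Big)\frac{(1+\rho_m)^{n-1}-1-(n-1)\rho_m}{\rho_m}+\frac{2(n-1)\rho^mD^m}{md(1-\rho D)}, \] where $\widehat{\boldsymbol v}=\frac1d\boldsymbol v$, $\rho_m=\rho^{m-1}K(\rho)$, $K(\rho)=\frac1{2\pi}\oint_{|z|=\rho}\frac{|dz|}{|1-z|}$, and \[ 0<K(\rho)\le\min\Big\{\frac{\rho}{\sqrt{1-\rho^2}},\ \frac{2\rho}{\pi(1+\rho)}\Big(\frac\pi2+\log\frac{1+\rho}{1-\rho}\Big)\Big\}. \]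
   Context: Markov setting. $X$ finite; $P$ row-stochastic irreducible on $X$; $\Sigma=\{x\in X^{\mathbb N_0}:P_{x_nx_{n+1}}>0\}$; $p$ stationary vector; $\mu$ Markov measure ($\mu([i_0,\dots,i_n])=p_{i_0}P_{i_0i_1}\cdots P_{i_{n-1}i_n}$); $\lambda_+(A,P)$ the $\mu$-a.e. value of $\lim\frac1n\log\|A_{x_{n-1}}\cdots A_{x_0}\|$. Projective uniform hyperbolicity: on $\widehat\Sigma=\{(x_n)_{n\in\mathbb Z}:P_{x_nx_{n+1}}>0\}$ with shift $\widehat\sigma$, a continuous splitting $\mathbb R^2=E^d(\hat x)\oplus E^w(\hat x)$ into lines with $A_{x_0}E^*(\hat x)=E^*(\widehat\sigma\hat x)$ and some $n$ with $\|A_{x_{n-1}}\cdots A_{x_0}|_{E^w}\|<\|A_{x_{n-1}}\cdots A_{x_0}|_{E^d}\|$ everywhere. Multicone: $\{M_i\}_{i\in X}$, non-empty proper subsets of $\mathbb{RP}^1$, finite unions of open intervals, $\overline{[A_j](M_i)}\subset M_j$ when $P_{ij}>0$; one is fixed. Components $M_i=\bigsqcup_aM_{i,a}$; $\beta(i,a,j)$ the unique $b$ with $[A_j](\overline{M_{i,a}})\subset M_{j,b}$; $R=\{((i,a),(j,b)):P_{ij}>0,\ b=\beta(i,a,j)\}$; $s(r)=(i,a)$, $t(r)=(j,b)$, $\tau(r)=j$; $Q_{r,r'}=P_{\tau(r)\tau(r')}$ if $t(r)=s(r')$ else $0$; fix a recurrent class $C$ ($Q|_C$ irreducible, closed). $L_{i,a}\in\mathrm{GL}_2(\mathbb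 R)$ with $[L_{i,a}](\mathcal V)=\overline{M_{i,a}}$, $\mathcal V$ the classes of non-zero non-negative vectors; $B_r=\pm L_{t(r)}^{-1}A_{\tau(r)}L_{s(r)}$ with sign making it entrywise positive. Aperiodic reduction: $d$ = period of $Q|_C$; if $d>1$ replace $C$ by $\{(c_0,\dots,c_{d-1}):c_u\in C_u,\ Q_{c_uc_{u+1}}>0\}$ ($C_u$ the cyclic classes relative to a fixed state), $Q_{c,c'}=Q_{c_{d-1}c'_0}Q_{c'_0c'_1}\cdots Q_{c'_{d-2}c'_{d-1}}$, $B_c=B_{c_{d-1}}\cdots B_{c_0}$, keeping names; $\pi$ = stationary vector of the resulting (irreducible, aperiodic) $Q|_C$; $d$ = period before replacement. Möbius data: $B_r=\begin{pmatrix}a_r&b_r\\c_r&d_r\end{pmatrix}$, $\alpha_r=\frac12(a_r-b_r-c_r+d_r)$, $\beta_r=\frac12(a_r+b_r-c_r-d_r)$, $\gamma_r=\frac12(a_r-b_r+c_r-d_r)$, $\delta_r=\frac12(a_r+b_r+c_r+d_r)$; $f_r(x)=\frac{\alpha_rx+\beta_r}{\gamma_rx+\delta_r}$, $f_r^\top(x)=\frac{\alpha_rx+\gamma_r}{\beta_rx+\delta_r}$; $\ell_r(x)=\mathrm{Log}(\gamma_rx+\delta_r)$. Hyperbolic distance on $(-1,1)$: $d_{\mathrm{hyp}}(x,y)=2|\mathrm{artanh}\,x-\mathrm{artanh}\,y|$. Operators: $b^{(r)}_{k,0}=0$, $b^{(r)}_{0,n}=(f_r^\top(0))^n$ ($n\ge1$),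 $b^{(r)}_{k,n}=\sum_{\ell=1}^{\min\{k,n\}}\binom n\ell\binom{k-1}{\ell-1}(f_r^\top(0))^{n-\ell}(-f_r(0))^{k-\ell}(f_r'(0))^\ell$ ($k,n\ge1$). $v(x;c)\in\ell^\infty(\mathbb N_0)$: entry $c$ at index $0$, $-(-x)^n/n$ at $n\ge1$. Seed $\boldsymbol v_s=\sum_r\frac{\pi_rQ_{r,s}}{\pi_s}v(f_r(0);\ell_r(0))$. $T_{r,m}$: the matrix $(b^{(r)}_{k,n})$ truncated to $0\le k,n\le m-1$ (zero elsewhere); $(\mathrm T_{m\times m}\boldsymbol u)_{r'}=\sum_r\frac{\pi_rQ_{r,r'}}{\pi_{r'}}T_{r,m}u_r$ on $\ell^\infty(\mathbb N_0)^C$; $[\boldsymbol w]_{\boldsymbol 0}=\sum_r\pi_r(w_r)_0$. *)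

theory Defs
  imports "HOL-Probability.Probability"
begin

section \<open>Matrix cocycle, Markov measure, Lyapunov exponent\<close>

(* A_{x_{n-1}} ... A_{x_0} *)
fun mprodf :: "('x \<Rightarrow> real^2^2) \<Rightarrow> (nat \<Rightarrow> 'x) \<Rightarrow> nat \<Rightarrow> real^2^2" where
  "mprodf A x 0 = mat 1"
| "mprodf A x (Suc n) = A (x n) ** mprodf A x n"

definition row_stochastic :: "('x::finite \<Rightarrow> 'x \<Rightarrow> real) \<Rightarrow> bool" where
  "row_stochastic P \<longleftrightarrow> (\<forall>i j. P i j \<ge> 0) \<and> (\<forall>i. (\<Sum>j\<in>UNIV. P i j) = 1)"

definition irreducible_mat :: "('x \<Rightarrow> 'x \<Rightarrow> real) \<Rightarrow> bool" where
  "irreducible_mat P \<longleftrightarrow> (\<forall>i j. (i, j) \<in> {(a, b). P a b > 0}\<^sup>*)"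

definition stationary_vec :: "('x::finite \<Rightarrow> 'x \<Rightarrow> real) \<Rightarrow> ('x \<Rightarrow> real) \<Rightarrow> bool" where
  "stationary_vec P p \<longleftrightarrow> (\<forall>i. p i \<ge> 0) \<and> (\<Sum>i\<in>UNIV. p i) = 1 \<and>
     (\<forall>j. (\<Sum>i\<in>UNIV. p i * P i j) = p j)"

text \<open>The Markov measure on one-sided sequences (streams): probability measure on the
  product sigma-algebra with the prescribed cylinder probabilities.\<close>
definition markov_measure ::
  "('x::finite \<Rightarrow> 'x \<Rightarrow> real) \<Rightarrow> ('x \<Rightarrow> real) \<Rightarrow> 'x stream measure \<Rightarrow> bool" where
  "markov_measure P p \<mu> \<longleftrightarrow> prob_space \<mu> \<and>
     sets \<mu> = sets (stream_space (count_space UNIV)) \<and>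
     (\<forall>w. w \<noteq> [] \<longrightarrow>
        measure \<mu> {\<omega> \<in> space \<mu>. stake (length w) \<omega> = w} =
          p (hd w) * (\<Prod>k<length w - 1. P (w ! k) (w ! Suc k)))"

text \<open>lam is the mu-a.e. value of lim (1/n) log ||A_{x_{n-1}}...A_{x_0}|| (operator norm).\<close>
definition lyapunov_value ::
  "('x \<Rightarrow> real^2^2) \<Rightarrow> 'x stream measure \<Rightarrow> real \<Rightarrow> bool" where
  "lyapunov_value A \<mu> lam \<longleftrightarrow>
     (AE \<omega> in \<mu>. (\<lambda>n. ln (onorm (\<lambda>v. mprodf A (snth \<omega>) n *v v)) / real n) \<longlonglongrightarrow> lam)"

section \<open>Projective uniform hyperbolicity\<close>

definition sigma_hat :: "('x \<Rightarrow> 'x \<Rightarrow> real) \<Rightarrow> (int \<Rightarrow> 'x) set" where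
  "sigma_hat P = {xh. \<forall>k. P (xh k) (xh (k + 1)) > 0}"

definition shift_hat :: "(int \<Rightarrow> 'x) \<Rightarrow> (int \<Rightarrow> 'x)" where
  "shift_hat xh = (\<lambda>k. xh (k + 1))"

text \<open>Orthogonal projector onto the line spanned by a nonzero vector; it depends only on the line.\<close>
definition lineproj :: "real^2 \<Rightarrow> real^2^2" where
  "lineproj v = (\<chi> i j. v $ i * v $ j / (v \<bullet> v))"

text \<open>Continuity of a line field on the two-sided shift space (product topology of discrete X).\<close>
definition continuous_line_field :: "(int \<Rightarrow> 'x) set \<Rightarrow> ((int \<Rightarrow> 'x) \<Rightarrow> real^2) \<Rightarrow> bool" where
  "continuous_line_field S e \<longleftrightarrow>
     (\<forall>x\<in>S. \<forall>\<epsilon>>0. \<exists>N::nat. \<forall>y\<in>S. (\<forall>k. \<bar>k\<bar> \<le> int N \<longrightarrow> y k = x k) \<longrightarrow>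
        norm (lineproj (e y) - lineproj (e x)) < \<epsilon>)"

definition proj_uniformly_hyperbolic :: "('x \<Rightarrow> real^2^2) \<Rightarrow> ('x \<Rightarrow> 'x \<Rightarrow> real) \<Rightarrow> bool" where
  "proj_uniformly_hyperbolic A P \<longleftrightarrow>
    (\<exists>ed ew :: (int \<Rightarrow> 'x) \<Rightarrow> real^2.
       (\<forall>xh\<in>sigma_hat P. ed xh \<noteq> 0 \<and> ew xh \<noteq> 0 \<and> ew xh \<notin> span {ed xh}) \<and>
       continuous_line_field (sigma_hat P) ed \<and> continuous_line_field (sigma_hat P) ew \<and>
       (\<forall>xh\<in>sigma_hat P. A (xh 0) *v ed xh \<in> span {ed (shift_hat xh)} \<and>
                          A (xh 0) *v ew xh \<in> span {ew (shift_hat xh)}) \<and>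
       (\<exists>n. \<forall>xh\<in>sigma_hat P.
          norm (mprodf A (\<lambda>k. xh (int k)) n *v ew xh) / norm (ew xh) <
          norm (mprodf A (\<lambda>k. xh (int k)) n *v ed xh) / norm (ed xh)))"

section \<open>Multicones\<close>

text \<open>Subsets of RP^1 are represented by the sets of nonzero vectors of R^2 lying on the lines.
  For invertible L, dcone L is the open arc [L](interior of V) and ccone L = [L](V).\<close>
definition vec2 :: "real \<Rightarrow> real \<Rightarrow> real^2" where
  "vec2 s t = (\<chi> i. if i = 1 then s else t)"

definition dcone :: "real^2^2 \<Rightarrow> (real^2) set" where
  "dcone L = {v. \<exists>s t. s > 0 \<and> t > 0 \<and> (v = L *v vec2 s t \<or> v = - (L *v vec2 s t))}"

definition ccone :: "real^2^2 \<Rightarrow> (real^2) set" where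
  "ccone L = {v. \<exists>s t. s \<ge> 0 \<and> t \<ge> 0 \<and> (s, t) \<noteq> (0, 0) \<and>
                      (v = L *v vec2 s t \<or> v = - (L *v vec2 s t))}"

text \<open>comps i: labels of the components of M_i; L i a: the matrix L_{i,a} with
  [L_{i,a}](V) = closure of M_{i,a}, so M_{i,a} = dcone (L i a) and M_i = union of them.\<close>
definition Mset :: "('x \<Rightarrow> nat set) \<Rightarrow> ('x \<Rightarrow> nat \<Rightarrow> real^2^2) \<Rightarrow> 'x \<Rightarrow> (real^2) set" where
  "Mset comps L i = (\<Union>a\<in>comps i. dcone (L i a))"

definition multicone_data ::
  "('x \<Rightarrow> real^2^2) \<Rightarrow> ('x \<Rightarrow> 'x \<Rightarrow> real) \<Rightarrow> ('x \<Rightarrow> nat set) \<Rightarrow> ('x \<Rightarrow> nat \<Rightarrow> real^2^2) \<Rightarrow> bool" where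
  "multicone_data A P comps L \<longleftrightarrow>
     (\<forall>i. finite (comps i) \<and> comps i \<noteq> {}) \<and>
     (\<forall>i. \<forall>a\<in>comps i. invertible (L i a)) \<and>
     (\<forall>i. \<forall>a\<in>comps i. \<forall>b\<in>comps i. a \<noteq> b \<longrightarrow> dcone (L i a) \<inter> dcone (L i b) = {}) \<and>
     (\<forall>i j. P i j > 0 \<longrightarrow> (\<forall>a\<in>comps i. (\<lambda>v. A j *v v) ` ccone (L i a) \<subseteq> Mset comps L j))"

definition beta_idx ::
  "('x \<Rightarrow> real^2^2) \<Rightarrow> ('x \<Rightarrow> nat set) \<Rightarrow> ('x \<Rightarrow> nat \<Rightarrow> real^2^2) \<Rightarrow> 'x \<Rightarrow> nat \<Rightarrow> 'x \<Rightarrow> nat" where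
  "beta_idx A comps L i a j =
     (THE b. b \<in> comps j \<and> (\<lambda>v. A j *v v) ` ccone (L i a) \<subseteq> dcone (L j b))"

type_synonym 'x arc = "('x \<times> nat) \<times> ('x \<times> nat)"

definition Rset ::
  "('x \<Rightarrow> real^2^2) \<Rightarrow> ('x \<Rightarrow> 'x \<Rightarrow> real) \<Rightarrow> ('x \<Rightarrow> nat set) \<Rightarrow> ('x \<Rightarrow> nat \<Rightarrow> real^2^2) \<Rightarrow> 'x arc set" where
  "Rset A P comps L = {((i, a), (j, b)). a \<in> comps i \<and> b \<in> comps j \<and> P i j > 0 \<and>
                                         b = beta_idx A comps L i a j}"

(* Q_{r,r'} = P_{tau(r) tau(r')} if t(r) = s(r'), else 0 *)
definition Qm :: "('x \<Rightarrow> 'x \<Rightarrow> real) \<Rightarrow> 'x arc \<Rightarrow> 'x arc \<Rightarrow> real" where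
  "Qm P r r' = (if snd r = fst r' then P (fst (snd r)) (fst (snd r')) else 0)"

definition Qedges :: "'x arc set \<Rightarrow> ('x \<Rightarrow> 'x \<Rightarrow> real) \<Rightarrow> ('x arc \<times> 'x arc) set" where
  "Qedges S P = {(r, r'). r \<in> S \<and> r' \<in> S \<and> Qm P r r' > 0}"

definition recurrent_class :: "'x arc set \<Rightarrow> ('x \<Rightarrow> 'x \<Rightarrow> real) \<Rightarrow> 'x arc set \<Rightarrow> bool" where
  "recurrent_class R P C \<longleftrightarrow> C \<subseteq> R \<and> C \<noteq> {} \<and>
     (\<forall>r\<in>C. \<forall>r'\<in>R. Qm P r r' > 0 \<longrightarrow> r' \<in> C) \<and>
     (\<forall>r\<in>C. \<forall>r'\<in>C. (r, r') \<in> (Qedges C P)\<^sup>*)"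

(* B_r = +- L_{t(r)}^{-1} A_{tau(r)} L_{s(r)}, sign chosen to make it positive *)
definition Bmat :: "('x \<Rightarrow> real^2^2) \<Rightarrow> ('x \<Rightarrow> nat \<Rightarrow> real^2^2) \<Rightarrow> 'x arc \<Rightarrow> real^2^2" where
  "Bmat A L r = (let M = matrix_inv (L (fst (snd r)) (snd (snd r))) ** A (fst (snd r)) **
                         L (fst (fst r)) (snd (fst r)) in if M $ 1 $ 1 > 0 then M else - M)"

section \<open>Aperiodic reduction\<close>

definition period_at :: "('r \<times> 'r) set \<Rightarrow> 'r \<Rightarrow> nat" where
  "period_at E r0 = Gcd {n. n > 0 \<and> (r0, r0) \<in> E ^^ n}"

definition cyclic_class :: "('r \<times> 'r) set \<Rightarrow> 'r set \<Rightarrow> 'r \<Rightarrow> nat \<Rightarrow> nat \<Rightarrow> 'r set" where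
  "cyclic_class E C r0 d u = {r \<in> C. \<exists>n. n mod d = u \<and> (r0, r) \<in> E ^^ n}"

text \<open>Reduced state space: d-tuples (lists of length d); for d = 1 this is a copy of C.\<close>
definition red_states :: "('x \<Rightarrow> 'x \<Rightarrow> real) \<Rightarrow> 'x arc set \<Rightarrow> 'x arc \<Rightarrow> nat \<Rightarrow> 'x arc list set" where
  "red_states P C r0 d = {cs. length cs = d \<and>
      (\<forall>u<d. cs ! u \<in> cyclic_class (Qedges C P) C r0 d u) \<and>
      (\<forall>u. Suc u < d \<longrightarrow> Qm P (cs ! u) (cs ! Suc u) > 0)}"

definition red_Q :: "('x \<Rightarrow> 'x \<Rightarrow> real) \<Rightarrow> nat \<Rightarrow> 'x arc list \<Rightarrow> 'x arc list \<Rightarrow> real" where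
  "red_Q P d c c' = Qm P (c ! (d - 1)) (c' ! 0) * (\<Prod>u<d - 1. Qm P (c' ! u) (c' ! Suc u))"

(* prodB [c0,...,c_{d-1}] = B_{c_{d-1}} ... B_{c_0} *)
fun prodB :: "('r \<Rightarrow> real^2^2) \<Rightarrow> 'r list \<Rightarrow> real^2^2" where
  "prodB B [] = mat 1"
| "prodB B (c # cs) = prodB B cs ** B c"

definition stationary_on :: "'s set \<Rightarrow> ('s \<Rightarrow> 's \<Rightarrow> real) \<Rightarrow> ('s \<Rightarrow> real) \<Rightarrow> bool" where
  "stationary_on S Q \<pi> \<longleftrightarrow> (\<forall>c\<in>S. \<pi> c \<ge> 0) \<and> (\<Sum>c\<in>S. \<pi> c) = 1 \<and>
     (\<forall>c'\<in>S. (\<Sum>c\<in>S. \<pi> c * Q c c') = \<pi> c')"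

section \<open>Moebius data\<close>

definition mob_alpha :: "real^2^2 \<Rightarrow> real" where
  "mob_alpha M = (M$1$1 - M$1$2 - M$2$1 + M$2$2) / 2"
definition mob_beta :: "real^2^2 \<Rightarrow> real" where
  "mob_beta M = (M$1$1 + M$1$2 - M$2$1 - M$2$2) / 2"
definition mob_gamma :: "real^2^2 \<Rightarrow> real" where
  "mob_gamma M = (M$1$1 - M$1$2 + M$2$1 - M$2$2) / 2"
definition mob_delta :: "real^2^2 \<Rightarrow> real" where
  "mob_delta M = (M$1$1 + M$1$2 + M$2$1 + M$2$2) / 2"

definition mob_f :: "real^2^2 \<Rightarrow> real \<Rightarrow> real" where
  "mob_f M x = (mob_alpha M * x + mob_beta M) / (mob_gamma M * x + mob_delta M)"
definition mob_fT :: "real^2^2 \<Rightarrow> real \<Rightarrow> real" where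
  "mob_fT M x = (mob_alpha M * x + mob_gamma M) / (mob_beta M * x + mob_delta M)"
text \<open>ell(x) = Log(gamma x + delta); only used at real points where the argument is positive.\<close>
definition mob_ell :: "real^2^2 \<Rightarrow> real \<Rightarrow> real" where
  "mob_ell M x = ln (mob_gamma M * x + mob_delta M)"

definition dhyp :: "real \<Rightarrow> real \<Rightarrow> real" where
  "dhyp x y = 2 * \<bar>artanh x - artanh y\<bar>"

section \<open>Operators\<close>

definition bcoef :: "real^2^2 \<Rightarrow> nat \<Rightarrow> nat \<Rightarrow> real" where
  "bcoef M k n =
     (if n = 0 then 0
      else if k = 0 then (mob_fT M 0) ^ n
      else (\<Sum>l\<in>{1..min k n}. real (n choose l) * real ((k - 1) choose (l - 1)) *
              (mob_fT M 0) ^ (n - l) * (- mob_f M 0) ^ (k - l) * (deriv (mob_f M) 0) ^ l))"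

definition vvec :: "real \<Rightarrow> real \<Rightarrow> nat \<Rightarrow> real" where
  "vvec x c n = (if n = 0 then c else - ((- x) ^ n) / real n)"

definition seed :: "'s set \<Rightarrow> ('s \<Rightarrow> 's \<Rightarrow> real) \<Rightarrow> ('s \<Rightarrow> real) \<Rightarrow> ('s \<Rightarrow> real^2^2) \<Rightarrow> 's \<Rightarrow> nat \<Rightarrow> real" where
  "seed S Q \<pi> B s = (\<lambda>n. \<Sum>r\<in>S. \<pi> r * Q r s / \<pi> s * vvec (mob_f (B r) 0) (mob_ell (B r) 0) n)"

text \<open>T_{m x m}: (T u)_{r'} = sum_r pi_r Q_{r,r'} / pi_{r'} T_{r,m} u_r, where T_{r,m} is the
  matrix (b_{k,n}) truncated to 0 <= k,n <= m-1 acting by (T_{r,m} w)_k = sum_n b_{k,n} w_n.\<close>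
definition Tmm :: "'s set \<Rightarrow> ('s \<Rightarrow> 's \<Rightarrow> real) \<Rightarrow> ('s \<Rightarrow> real) \<Rightarrow> ('s \<Rightarrow> real^2^2) \<Rightarrow> nat \<Rightarrow>
                   ('s \<Rightarrow> nat \<Rightarrow> real) \<Rightarrow> ('s \<Rightarrow> nat \<Rightarrow> real)" where
  "Tmm S Q \<pi> B m u = (\<lambda>r' k. if k < m then
       (\<Sum>r\<in>S. \<pi> r * Q r r' / \<pi> r' * (\<Sum>n<m. bcoef (B r) k n * u r n)) else 0)"

definition bracket0 :: "'s set \<Rightarrow> ('s \<Rightarrow> real) \<Rightarrow> ('s \<Rightarrow> nat \<Rightarrow> real) \<Rightarrow> real" where
  "bracket0 S \<pi> w = (\<Sum>r\<in>S. \<pi> r * w r 0)"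

text \<open>K(rho) = (1/2pi) contour integral over |z| = rho of |dz| / |1 - z|, parametrised by arclength.\<close>
definition Kconst :: "real \<Rightarrow> real" where
  "Kconst \<rho> = integral {0..2*pi} (\<lambda>\<theta>. \<rho> / cmod (1 - complex_of_real \<rho> * cis \<theta>)) / (2 * pi)"

end

theory Submission
  imports Defs "HOL-Complex_Analysis.Complex_Analysis"
begin

text \<open>Conjugating by the matrices \<open>L\<close> turns the cocycle along the arcs of the recurrent class into
  products of positive matrices. Writing a positive vector as \<open>(s, t)\<close> with \<open>x = (s - t) / (s + t)\<close>,
  its size \<open>s + t\<close> is multiplied by \<open>exp (\<ell>(x))\<close> in one step while \<open>x\<close> moves to \<open>f(x)\<close>. Hence
  \<open>d * lam\<close> is the Cesaro limit of the mean increments \<open>e k\<close>. Every \<open>f\<close> contracts the hyperbolic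
  metric by \<open>\<rho>\<close> and every \<open>\<ell>\<close> is Lipschitz for it, so the increments converge geometrically; this is
  the first error term.

  The increments telescope: \<open>e (Suc l) - e l\<close> is the mean of \<open>G(x) - G(0)\<close>, where \<open>G\<close> is obtained from
  \<open>\<ell>(x) - \<ell>(0) = log (1 + t x)\<close> by composing \<open>l\<close> times with the maps \<open>f\<close> and averaging. Read on row
  vectors, the truncated operator performs the same compositions but truncates the Taylor series
  after each of them. As \<open>f\<close> maps the complex unit disc into the disc of radius \<open>\<rho>\<close>, composition does not
  increase sup norms from the latter to the former, and by Cauchy's formula the Taylor remainder of order
  \<open>m\<close> has norm at most \<open>\<rho> ^ (m - 1) * Kconst \<rho>\<close> in the opposite direction. Starting from the bound
  \<open>log (1 / (1 - \<rho> * D))\<close> for \<open>log (1 + t x)\<close>, a geometric sum gives the second term, and the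
  very first truncation gives the third.\<close>

text \<open>The stationary chain of blocks and \<open>\<mu>\<close> are never coupled. Dominated
  convergence turns the almost sure exponent into a limit of finite means over words with a
  prescribed first symbol, which makes sense because \<open>p\<close> is positive. From an arc of
  \<open>C\<close> the admissible next arcs correspond one to one to the admissible next symbols,
  with equal probabilities. So the means pass to arcs, and from there to blocks, up to a bounded
  error caused by finitely many changes of basis. The matrices \<open>bcoef\<close> have a zero
  column at index 0, hence see functions only modulo constants. This is harmless because only
  differences of values at f(0) and at 0 enter; these two points are the origin of the factor 2 in
  the last two error terms. The basis -(-x)^n/n is dictated by log (1 + t x), whose coefficients in
  it are the powers t^n. Composition leads from the disc of radius \<rho> to the unit disc and
  truncation leads back, so no disc shrinks from step to step and the norms grow only by the factor
  1 + \<rho> ^ (m - 1) K(\<rho>).\<close>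

no_notation fps_nth (infixl "$" 75)

section \<open>The constant K\<close>

lemma norm_one_minus_cis:
  "cmod (1 - complex_of_real \<rho> * cis \<theta>) ^ 2 = 1 + \<rho>^2 - 2 * \<rho> * cos \<theta>"
proof -
  have "cmod (1 - complex_of_real \<rho> * cis \<theta>) ^ 2 = (1 - \<rho> * cos \<theta>)^2 + (\<rho> * sin \<theta>)^2"
    by (simp add: cmod_power2)
  also have "\<dots> = 1 + \<rho>^2 * ((sin \<theta>)^2 + (cos \<theta>)^2) - 2 * \<rho> * cos \<theta>"
    by (simp only: power2_eq_square) algebra
  finally show ?thesis by simp
qed

lemma norm_one_minus_cis_ge:
  assumes "0 < \<rho>" "\<rho> < 1"
  shows "1 - \<rho> \<le> cmod (1 - complex_of_real \<rho> * cis \<theta>)"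
  using norm_triangle_ineq2[of 1 "complex_of_real \<rho> * cis \<theta>"] assms by (simp add: norm_mult)

lemma one_minus_cis_continuous:
  assumes "0 < \<rho>" "\<rho> < 1"
  shows "continuous_on S (\<lambda>\<theta>. 1 / cmod (1 - complex_of_real \<rho> * cis \<theta>))"
proof (intro continuous_intros ballI)
  show "cmod (1 - complex_of_real \<rho> * cis \<theta>) \<noteq> 0" for \<theta>
    using norm_one_minus_cis_ge[OF assms, of \<theta>] assms by linarith
qed

lemma one_minus_cis_integrable:
  assumes "0 < \<rho>" "\<rho> < 1"
  shows "(\<lambda>\<theta>. 1 / cmod (1 - complex_of_real \<rho> * cis \<theta>)) integrable_on {a..b}"
  by (intro integrable_continuous_real one_minus_cis_continuous assms)

lemma Kconst_eq:
  "Kconst \<rho> = \<rho> / (2 * pi) * integral {0..2*pi} (\<lambda>\<theta>. 1 / cmod (1 - complex_of_real \<rho> * cis \<theta>))"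
proof -
  have "integral {0..2*pi} (\<lambda>\<theta>. \<rho> / cmod (1 - complex_of_real \<rho> * cis \<theta>))
      = integral {0..2*pi} (\<lambda>\<theta>. \<rho> * (1 / cmod (1 - complex_of_real \<rho> * cis \<theta>)))" by simp
  also have "\<dots> = \<rho> * integral {0..2*pi} (\<lambda>\<theta>. 1 / cmod (1 - complex_of_real \<rho> * cis \<theta>))"
    by (rule integral_mult_right)
  finally show ?thesis by (simp add: Kconst_def)
qed

lemma Kconst_pos:
  assumes "0 < \<rho>" "\<rho> < 1"
  shows "0 < Kconst \<rho>"
proof -
  have "integral {0..2*pi} (\<lambda>\<theta>::real. 1/2::real) \<le> integral {0..2*pi} (\<lambda>\<theta>. 1 / cmod (1 - complex_of_real \<rho> * cis \<theta>))"
  proof (rule integral_le)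
    show "1/2 \<le> 1 / cmod (1 - complex_of_real \<rho> * cis \<theta>)" for \<theta>
    proof -
      have "cmod (1 - complex_of_real \<rho> * cis \<theta>) \<le> 2"
        using norm_triangle_ineq4[of 1 "complex_of_real \<rho> * cis \<theta>"] assms by (simp add: norm_mult)
      moreover have "0 < cmod (1 - complex_of_real \<rho> * cis \<theta>)"
        using norm_one_minus_cis_ge[OF assms, of \<theta>] assms by linarith
      ultimately show ?thesis by (simp add: field_simps)
    qed
  qed (use one_minus_cis_integrable[OF assms] in auto)
  then have "0 < integral {0..2*pi} (\<lambda>\<theta>. 1 / cmod (1 - complex_of_real \<rho> * cis \<theta>))"
    using pi_gt_zero by (auto simp del: pi_gt_zero intro: less_le_trans)
  then show ?thesis using assms by (simp add: Kconst_eq)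
qed

text \<open>With z = \<rho> e^(i \<theta>) the integrand is the real part of (1 + z)/(1 - z) = 1 + 2
  z/(1 - z), so \<theta> - 2 arg(1 - z) is a primitive. As Re(1 - z) > 0, the argument is an
  arctangent on the whole circle, and it vanishes at both ends.\<close>

lemma poisson_kernel_has_integral:
  fixes \<rho> :: real
  assumes "0 < \<rho>" "\<rho> < 1"
  shows "((\<lambda>\<theta>. (1 - \<rho>^2) / (1 + \<rho>^2 - 2 * \<rho> * cos \<theta>)) has_integral (2*pi)) {0..2*pi}"
proof -
  let ?F = "\<lambda>\<theta>. \<theta> + 2 * arctan (\<rho> * sin \<theta> / (1 - \<rho> * cos \<theta>))"
  have pos: "0 < 1 - \<rho> * cos \<theta>" for \<theta>
  proof -
    have "\<rho> * cos \<theta> \<le> \<rho> * 1" using assms by (intro mult_left_mono) auto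
    then show ?thesis using assms by linarith
  qed
  have der: "(?F has_real_derivative (1 - \<rho>^2) / (1 + \<rho>^2 - 2 * \<rho> * cos \<theta>)) (at \<theta>)" for \<theta>
  proof -
    let ?p = "1 - \<rho> * cos \<theta>"
    have nz: "?p \<noteq> 0" using pos[of \<theta>] by simp
    have W: "?p^2 + (\<rho> * sin \<theta>)^2 = 1 + \<rho>^2 - 2 * \<rho> * cos \<theta>"
      using norm_one_minus_cis[of \<rho> \<theta>] by (simp add: cmod_power2)
    have Wpos: "0 < ?p^2 + (\<rho> * sin \<theta>)^2" using nz by (simp add: add_pos_nonneg)
    have "(?F has_real_derivative 1 + 2 * (((\<rho> * cos \<theta>) * ?p - (\<rho> * sin \<theta>) * (\<rho> * sin \<theta>)) / (?p * ?p)
       / (1 + (\<rho> * sin \<theta> / ?p)^2))) (at \<theta>)"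
      using nz by (auto intro!: derivative_eq_intros simp: field_simps)
    also have "((\<rho> * cos \<theta>) * ?p - (\<rho> * sin \<theta>) * (\<rho> * sin \<theta>)) / (?p * ?p)
       / (1 + (\<rho> * sin \<theta> / ?p)^2) = (\<rho> * cos \<theta> * ?p - (\<rho> * sin \<theta>)^2) / (?p^2 + (\<rho> * sin \<theta>)^2)"
      using nz Wpos by (simp add: divide_simps power2_eq_square)
    also have "1 + 2 * \<dots> = (?p^2 + (\<rho> * sin \<theta>)^2 + 2 * (\<rho> * cos \<theta> * ?p - (\<rho> * sin \<theta>)^2)) / (?p^2 + (\<rho> * sin \<theta>)^2)"
      using Wpos by (simp add: add_divide_distrib add_frac_eq divide_simps)
    also have "?p^2 + (\<rho> * sin \<theta>)^2 + 2 * (\<rho> * cos \<theta> * ?p - (\<rho> * sin \<theta>)^2) = 1 - \<rho>^2 * ((sin \<theta>)^2 + (cos \<theta>)^2)"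
      by (simp only: power2_eq_square) algebra
    finally show ?thesis by (simp add: W)
  qed
  have "((\<lambda>\<theta>. (1 - \<rho>^2) / (1 + \<rho>^2 - 2 * \<rho> * cos \<theta>)) has_integral (?F (2*pi) - ?F 0)) {0..2*pi}"
    by (rule fundamental_theorem_of_calculus)
       (use der in \<open>auto simp: has_real_derivative_iff_has_vector_derivative[symmetric] intro: has_field_derivative_at_within\<close>)
  then show ?thesis by simp
qed

text \<open>Cauchy-Schwarz against the Poisson kernel, pointwise as AM-GM.\<close>

lemma Kconst_le_L2:
  assumes "0 < \<rho>" "\<rho> < 1"
  shows "Kconst \<rho> \<le> \<rho> / sqrt (1 - \<rho>^2)"
proof -
  \<comment> \<open>With this weight the two terms of the AM-GM bound have the same integral, so
    nothing is lost against Cauchy-Schwarz.\<close>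
  define k where "k = sqrt (1 - \<rho>^2)"
  have r2: "\<rho>^2 < 1" using assms by (simp add: power_less_one_iff)
  have k: "k > 0" "k^2 = 1 - \<rho>^2" using r2 by (auto simp: k_def)
  let ?w = "\<lambda>\<theta>. cmod (1 - complex_of_real \<rho> * cis \<theta>)"
  have int: "((\<lambda>\<theta>. 1/2 * (1/k) + 1/(2*k) * ((1 - \<rho>^2) / (1 + \<rho>^2 - 2 * \<rho> * cos \<theta>)))
     has_integral ((2*pi - 0) *\<^sub>R (1/2 * (1/k)) + 1/(2*k) * (2*pi))) {0..2*pi}"
    using has_integral_const_real[of "1/2 * (1/k)" 0 "2*pi"]
    by (intro has_integral_add has_integral_mult_right poisson_kernel_has_integral assms) auto
  have "integral {0..2*pi} (\<lambda>\<theta>. 1 / ?w \<theta>) \<le> integral {0..2*pi} (\<lambda>\<theta>. 1/2 * (1/k) + 1/(2*k) * ((1 - \<rho>^2) / (1 + \<rho>^2 - 2 * \<rho> * cos \<theta>)))"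
  proof (rule integral_le[OF one_minus_cis_integrable[OF assms] has_integral_integrable[OF int]])
    fix \<theta>
    have w: "0 < ?w \<theta>"
      using norm_one_minus_cis_ge[OF assms, of \<theta>] assms by linarith
    have "0 \<le> (?w \<theta> - k)^2" by simp
    then have "2 * k * ?w \<theta> \<le> ?w \<theta>^2 + k^2" by (simp add: power2_eq_square algebra_simps)
    then have "1 / ?w \<theta> \<le> 1/2 * (1/k) + 1/(2*k) * (k^2 / ?w \<theta>^2)"
      using w k(1) by (simp add: field_simps power2_eq_square)
    then show "1 / ?w \<theta> \<le> 1/2 * (1/k) + 1/(2*k) * ((1 - \<rho>^2) / (1 + \<rho>^2 - 2 * \<rho> * cos \<theta>))"
      by (simp add: k(2) norm_one_minus_cis)
  qed
  also have "\<dots> = 2 * pi / k" using integral_unique[OF int] k by (simp add: field_simps)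
  finally have "\<rho> / (2 * pi) * integral {0..2*pi} (\<lambda>\<theta>. 1 / ?w \<theta>) \<le> \<rho> / (2*pi) * (2*pi/k)"
    using assms by (intro mult_left_mono) auto
  also have "\<dots> = \<rho> / k" by simp
  finally show ?thesis by (simp add: Kconst_eq k_def)
qed

text \<open>In the half-angle variable the integrand of \<open>Kconst\<close> is \<open>1 / w\<close> up to a constant. Dividing
  \<open>1 / w - 1 \<ge> 0\<close> by the cosine can only increase it and makes it explicitly integrable.\<close>

lemma log_antiderivative:
  fixes c s :: real
  assumes "0 < c" "c < 1" "0 \<le> s" "s < 1"
  defines "w \<equiv> sqrt (c^2 + (1 - c^2) * s^2)"
  shows "((\<lambda>s. ln ((sqrt (c^2 + (1 - c^2) * s^2) + s) / (c * (1 + s)))) has_real_derivative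
     ((1 / w - 1) / (1 - s^2))) (at s)"
proof -
  have c2: "c^2 < 1" using assms by (simp add: power_less_one_iff)
  have W: "0 < c^2 + (1 - c^2) * s^2" using c2 assms by (simp add: add_pos_nonneg)
  then have w: "w > 0" "w^2 = c^2 + (1 - c^2) * s^2" by (auto simp: w_def)
  have s2: "s^2 < 1" using assms by (simp add: power_less_one_iff)
  have *: "((\<lambda>s. ln ((sqrt (c^2 + (1 - c^2) * s^2) + s) / (c * (1 + s)))) has_real_derivative
     ((((1 - c^2) * s / w + 1) * (c * (1 + s)) - (w + s) * c) / (c * (1 + s))^2) / ((w + s) / (c * (1 + s)))) (at s)"
  proof -
    have nz: "w + s > 0" "c * (1 + s) > 0"
      using w(1) assms(1-4) by (simp_all add: add_pos_nonneg)
    define g where "g = (\<lambda>s. sqrt (c^2 + (1 - c^2) * s^2))"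
    have gs: "g s = w" by (simp add: g_def w_def)
    have "(g has_real_derivative ((1 - c^2) * s / w)) (at s)"
      using W w(1) unfolding w_def g_def
      by (auto intro!: derivative_eq_intros simp: divide_simps)
    then have "((\<lambda>s. (g s + s) / (c * (1 + s))) has_real_derivative
       ((((1 - c^2) * s / w + 1) * (c * (1 + s)) - (w + s) * c) / (c * (1 + s))^2)) (at s)"
      using nz unfolding gs[symmetric]
      by (auto intro!: derivative_eq_intros simp: power2_eq_square)
    then have "((\<lambda>s. (sqrt (c^2 + (1 - c^2) * s^2) + s) / (c * (1 + s))) has_real_derivative
       ((((1 - c^2) * s / w + 1) * (c * (1 + s)) - (w + s) * c) / (c * (1 + s))^2)) (at s)"
      by (simp add: g_def)
    from DERIV_chain2[OF DERIV_ln_divide this] show ?thesis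
      using nz unfolding w_def by (simp add: mult.commute)
  qed
  have "((((1 - c^2) * s / w + 1) * (c * (1 + s)) - (w + s) * c) / (c * (1 + s))^2) / ((w + s) / (c * (1 + s)))
     = ((1 - c^2) * s / w + 1) / (w + s) - 1 / (1 + s)"
  proof -
    have "((A * (c * (1 + s)) - u * c) / (c * (1 + s))^2) / (u / (c * (1 + s))) = A / u - 1 / (1 + s)"
      if "u > 0" for A u :: real
      using that assms(1-4) by (simp add: divide_simps power2_eq_square) (simp add: algebra_simps)
    moreover have "w + s > 0" using w(1) assms(3) by simp
    ultimately show ?thesis by blast
  qed
  also have "((1 - c^2) * s / w + 1) / (w + s) = (1 - s * w) / (w * (1 - s^2))"
  proof -
    \<comment> \<open>Behind this identity is the conjugate of w + s: since w^2 - s^2 = c^2 (1 -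
      s^2), rationalising the denominator produces the factor 1 - s^2.\<close>
    have "((1 - c^2) * s + w) * (1 - s^2) = (1 - s * w) * (w + s)"
      using w(2) by algebra
    then have "((1 - c^2) * s + w) / (w + s) = (1 - s * w) / (1 - s^2)"
      using s2 w(1) assms(3) by (simp add: frac_eq_eq)
    moreover have "((1 - c^2) * s / w + 1) / (w + s) = ((1 - c^2) * s + w) / (w + s) / w"
      using w(1) by (simp add: field_simps)
    ultimately show ?thesis by (simp add: mult.commute)
  qed
  also have "(1 - s * w) / (w * (1 - s^2)) - 1 / (1 + s) = (1 / w - 1) / (1 - s^2)"
  proof -
    have "1 / (1 + s) = (1 - s) / (1 - s^2)"
      using assms s2 by (simp add: divide_simps power2_eq_square) (simp add: algebra_simps)
    then have "(1 - s * w) / (w * (1 - s^2)) - 1 / (1 + s) = ((1 - s * w) / w - (1 - s)) / (1 - s^2)"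
      by (simp add: diff_divide_distrib)
    also have "(1 - s * w) / w - (1 - s) = 1 / w - 1" using w(1) by (simp add: field_simps)
    finally show ?thesis .
  qed
  finally show ?thesis using * by simp
qed

lemma Kconst_le_log:
  assumes "0 < \<rho>" "\<rho> < 1"
  shows "Kconst \<rho> \<le> 2 * \<rho> / (pi * (1 + \<rho>)) * (pi / 2 + ln ((1 + \<rho>) / (1 - \<rho>)))"
proof -
  \<comment> \<open>The modulus |1 - \<rho> e^(i \<theta>)| runs between 1 - \<rho> and 1 + \<rho>;
    divided by 1 + \<rho> it runs between \<open>c\<close> and 1.\<close>
  define c where "c = (1 - \<rho>) / (1 + \<rho>)"
  have c: "0 < c" "c < 1" using assms by (auto simp: c_def field_simps)
  have c2: "c^2 < 1" using c by (simp add: power_less_one_iff)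
  let ?w = "\<lambda>\<theta>. cmod (1 - complex_of_real \<rho> * cis \<theta>)"
  define w where "w \<theta> = sqrt (c^2 + (1 - c^2) * sin (\<theta>/2)^2)" for \<theta>
  define H where "H \<theta> = ln ((w \<theta> + sin (\<theta>/2)) / (c * (1 + sin (\<theta>/2))))" for \<theta>
  have Wpos: "0 < c^2 + (1 - c^2) * x^2" for x using c c2 by (simp add: add_pos_nonneg)
  have wpos: "w \<theta> > 0" for \<theta> using Wpos by (simp add: w_def)
  have weq: "?w \<theta> = (1 + \<rho>) * w \<theta>" for \<theta>
  proof -
    have "c^2 + (1 - c^2) * sin (\<theta>/2)^2 = ((1 - \<rho>)^2 + 4 * \<rho> * sin (\<theta>/2)^2) / (1 + \<rho>)^2"
      using assms by (simp add: c_def divide_simps) (simp add: power2_eq_square algebra_simps)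
    also have "(1 - \<rho>)^2 + 4 * \<rho> * sin (\<theta>/2)^2 = 1 + \<rho>^2 - 2 * \<rho> * cos \<theta>"
    proof -
      have "cos \<theta> = 1 - 2 * sin (\<theta>/2)^2" using cos_double_sin[of "\<theta>/2"] by simp
      then show ?thesis by (simp only:) (simp add: power2_eq_square algebra_simps)
    qed
    also have "\<dots> = (?w \<theta>)^2" by (simp add: norm_one_minus_cis)
    finally show ?thesis using assms by (simp add: w_def real_sqrt_divide)
  qed
  have wle: "w \<theta> \<le> 1" for \<theta>
  proof -
    have "(1 - c^2) * sin (\<theta>/2)^2 \<le> (1 - c^2) * 1"
      using c c2 by (intro mult_left_mono) (auto simp: abs_square_le_1)
    then show ?thesis by (simp add: w_def)
  qed
  have int: "(\<lambda>\<theta>. 1 / w \<theta>) integrable_on {a..b}" for a b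
    unfolding w_def using Wpos
    by (intro integrable_continuous_real continuous_intros) (auto simp: less_imp_neq[symmetric] order.strict_iff_not)
  have contH: "continuous_on S H" if "S \<subseteq> {0..2*pi}" for S
  proof -
    have s: "0 \<le> sin (\<theta>/2)" if "\<theta> \<in> S" for \<theta>
      using that \<open>S \<subseteq> _\<close> by (intro sin_ge_zero) (auto simp: subset_iff)
    have "w \<theta> + sin (\<theta>/2) > 0" "1 + sin (\<theta>/2) > 0" if "\<theta> \<in> S" for \<theta>
      using wpos[of \<theta>] s[OF that] c by (auto simp: add_pos_nonneg)
    moreover have "continuous_on S w" unfolding w_def by (intro continuous_intros) auto
    ultimately show ?thesis unfolding H_def
      using c by (intro continuous_intros) (auto simp: less_imp_neq[symmetric] zero_less_divide_iff)
  qed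
  \<comment> \<open>At \<open>pi\<close> numerator and cosine vanish together, so this point is left
    out. The interior form of the fundamental theorem, applied on both sides of \<open>pi\<close>,
    asks only for continuity of \<open>H\<close> there.\<close>
  have derH: "(H has_real_derivative ((1 / w \<theta> - 1) / (2 * cos (\<theta>/2)))) (at \<theta>)"
    if "0 < \<theta>" "\<theta> < 2*pi" "\<theta> \<noteq> pi" for \<theta>
  proof -
    have cnz: "cos (\<theta>/2) \<noteq> 0"
    proof (cases "\<theta> < pi")
      case True then show ?thesis using that cos_gt_zero[of "\<theta>/2"] by auto
    next
      case False
      then have "cos (pi - \<theta>/2) > 0" using that by (intro cos_gt_zero) auto
      then show ?thesis by simp
    qed
    have s0: "0 \<le> sin (\<theta>/2)" using that by (intro sin_ge_zero) auto
    have "sin (\<theta>/2)^2 + cos (\<theta>/2)^2 = 1" by simp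
    then have cs: "cos (\<theta>/2)^2 = 1 - sin (\<theta>/2)^2" by linarith
    have s1: "sin (\<theta>/2) < 1"
    proof -
      have "sin (\<theta>/2) \<noteq> 1" using cs cnz by auto
      then show ?thesis using sin_le_one[of "\<theta>/2"] by linarith
    qed
    have "((\<lambda>\<theta>. sin (\<theta>/2)) has_real_derivative cos (\<theta>/2) / 2) (at \<theta>)"
      by (auto intro!: derivative_eq_intros)
    from DERIV_chain2[OF log_antiderivative[OF c s0 s1] this]
    have "(H has_real_derivative ((1 / w \<theta> - 1) / (1 - sin (\<theta>/2)^2) * (cos (\<theta>/2) / 2))) (at \<theta>)"
      unfolding H_def w_def by simp
    moreover have "(1 / w \<theta> - 1) / (1 - sin (\<theta>/2)^2) * (cos (\<theta>/2) / 2) = (1 / w \<theta> - 1) / (2 * cos (\<theta>/2))"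
      unfolding cs[symmetric] using cnz by (simp add: power2_eq_square)
    ultimately show ?thesis by simp
  qed
  have H0: "H 0 = 0" "H (2*pi) = 0" "H pi = ln (1/c)"
    using c by (auto simp: H_def w_def)
  have half: "x / y = 2 * (x / (2 * y))" "x / (- y) = - 2 * (x / (2 * y))" for x y :: real by simp_all
  have wpi: "w pi = 1" by (simp add: w_def)
  have le1: "integral {0..pi} (\<lambda>\<theta>. 1 / w \<theta>) \<le> pi + 2 * ln (1/c)"
  proof -
    have *: "((\<lambda>\<theta>. 1 + 2 * ((1 / w \<theta> - 1) / (2 * cos (\<theta>/2)))) has_integral
        ((pi + 2 * H pi) - (0 + 2 * H 0))) {0..pi}"
      by (rule fundamental_theorem_of_calculus_interior)
         (auto intro!: continuous_intros contH derivative_eq_intros derH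
           simp: has_real_derivative_iff_has_vector_derivative[symmetric])
    have "integral {0..pi} (\<lambda>\<theta>. 1 / w \<theta>) \<le> integral {0..pi} (\<lambda>\<theta>. 1 + 2 * ((1 / w \<theta> - 1) / (2 * cos (\<theta>/2))))"
    proof (rule integral_le[OF int has_integral_integrable[OF *]])
      fix \<theta> assume th: "\<theta> \<in> {0..pi}"
      show "1 / w \<theta> \<le> 1 + 2 * ((1 / w \<theta> - 1) / (2 * cos (\<theta>/2)))"
      proof (cases "\<theta> = pi")
        case True then show ?thesis using wpi by simp
      next
        case False
        then have cp: "cos (\<theta>/2) > 0" using th by (intro cos_gt_zero_pi) auto
        have "1 / w \<theta> - 1 \<ge> 0" using wle wpos by (simp add: field_simps)
        then have "(1 / w \<theta> - 1) * cos (\<theta>/2) \<le> (1 / w \<theta> - 1) * 1"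
          by (intro mult_left_mono) auto
        then have "1 / w \<theta> - 1 \<le> (1 / w \<theta> - 1) / cos (\<theta>/2)" using cp by (subst le_divide_eq) auto
        also have "\<dots> = 2 * ((1 / w \<theta> - 1) / (2 * cos (\<theta>/2)))" by (rule half)
        finally show ?thesis by simp
      qed
    qed
    then show ?thesis using integral_unique[OF *] H0 by simp
  qed
  have le2: "integral {pi..2*pi} (\<lambda>\<theta>. 1 / w \<theta>) \<le> pi + 2 * ln (1/c)"
  proof -
    \<comment> \<open>Beyond \<open>pi\<close> the cosine is negative, whence the opposite sign of
      \<open>H\<close>.\<close>
    have *: "((\<lambda>\<theta>. 1 - 2 * ((1 / w \<theta> - 1) / (2 * cos (\<theta>/2)))) has_integral
        ((2 * pi - 2 * H (2*pi)) - (pi - 2 * H pi))) {pi..2*pi}"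
      by (rule fundamental_theorem_of_calculus_interior)
         (auto intro!: continuous_intros contH derivative_eq_intros derH
           simp: has_real_derivative_iff_has_vector_derivative[symmetric])
    have "integral {pi..2*pi} (\<lambda>\<theta>. 1 / w \<theta>) \<le> integral {pi..2*pi} (\<lambda>\<theta>. 1 - 2 * ((1 / w \<theta> - 1) / (2 * cos (\<theta>/2))))"
    proof (rule integral_le[OF int has_integral_integrable[OF *]])
      fix \<theta> assume th: "\<theta> \<in> {pi..2*pi}"
      show "1 / w \<theta> \<le> 1 - 2 * ((1 / w \<theta> - 1) / (2 * cos (\<theta>/2)))"
      proof (cases "\<theta> = pi")
        case True then show ?thesis using wpi by simp
      next
        case False
        then have "cos (pi - \<theta>/2) > 0" using th by (intro cos_gt_zero_pi) auto
        then have cp: "- cos (\<theta>/2) > 0" by simp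
        have "1 / w \<theta> - 1 \<ge> 0" using wle wpos by (simp add: field_simps)
        then have "(1 / w \<theta> - 1) * (- cos (\<theta>/2)) \<le> (1 / w \<theta> - 1) * 1"
          using cos_ge_minus_one[of "\<theta>/2"] by (intro mult_left_mono) auto
        then have "1 / w \<theta> - 1 \<le> (1 / w \<theta> - 1) / (- cos (\<theta>/2))" using cp by (subst le_divide_eq) auto
        also have "\<dots> = - 2 * ((1 / w \<theta> - 1) / (2 * cos (\<theta>/2)))" by (rule half)
        finally show ?thesis by linarith
      qed
    qed
    then show ?thesis using integral_unique[OF *] H0 by simp
  qed
  have "integral {0..2*pi} (\<lambda>\<theta>. 1 / ?w \<theta>) = integral {0..2*pi} (\<lambda>\<theta>. 1 / (1 + \<rho>) * (1 / w \<theta>))"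
    by (simp add: weq)
  also have "\<dots> = 1 / (1 + \<rho>) * integral {0..2*pi} (\<lambda>\<theta>. 1 / w \<theta>)"
    by (rule integral_mult_right)
  also have "integral {0..2*pi} (\<lambda>\<theta>. 1 / w \<theta>) = integral {0..pi} (\<lambda>\<theta>. 1 / w \<theta>) + integral {pi..2*pi} (\<lambda>\<theta>. 1 / w \<theta>)"
    by (rule Henstock_Kurzweil_Integration.integral_combine[symmetric]) (auto intro: int)
  finally have "integral {0..2*pi} (\<lambda>\<theta>. 1 / ?w \<theta>) \<le> 1 / (1 + \<rho>) * (2 * pi + 4 * ln (1/c))"
    using le1 le2 assms by (simp add: divide_right_mono)
  then have "Kconst \<rho> \<le> \<rho> / (2 * pi) * (1 / (1 + \<rho>) * (2 * pi + 4 * ln (1/c)))"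
    unfolding Kconst_eq using assms by (intro mult_left_mono) auto
  also have "\<dots> = 2 * \<rho> / (pi * (1 + \<rho>)) * (pi / 2 + ln (1/c))"
    using assms by (simp add: divide_simps) (simp add: algebra_simps)
  finally show ?thesis by (simp add: c_def)
qed

section \<open>Taylor remainders on the unit disc\<close>

text \<open>Function and Taylor coefficients are Cauchy integrals over the unit circle; summing the
  geometric series leaves the kernel (\<rho>/u)^m / (u - \<rho>). On that circle |u - \<rho>| = |1 -
  \<rho> u|, so the mean modulus of the kernel is \<rho> ^ (m - 1) K(\<rho>). This is where
  \<open>Kconst\<close> comes from.\<close>

lemma taylor_remainder_real:
  fixes h :: "complex \<Rightarrow> complex" and a :: "nat \<Rightarrow> complex"
  assumes rho: "0 < \<rho>" "\<rho> < 1"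
    and holo: "h holomorphic_on ball 0 1" and cont: "continuous_on (cball 0 1) h"
    and bound: "\<And>z. cmod z \<le> 1 \<Longrightarrow> cmod (h z) \<le> N"
    and series: "\<And>z. cmod z < 1 \<Longrightarrow> (\<lambda>n. a n * z ^ n) sums h z"
    and m: "1 \<le> m"
  shows "cmod (h (of_real \<rho>) - (\<Sum>n<m. a n * of_real \<rho> ^ n)) \<le> \<rho> ^ (m - 1) * Kconst \<rho> * N"
proof -
  let ?x = "complex_of_real \<rho>"
  have coeff: "a n = (deriv ^^ n) h 0 / fact n" for n
  proof -
    have "h has_fps_expansion Abs_fps a"
    proof (rule has_fps_expansionI)
      have "\<forall>\<^sub>F u in nhds 0. u \<in> ball (0::complex) 1"
        by (rule eventually_nhds_in_open) auto
      then show "\<forall>\<^sub>F u in nhds 0. (\<lambda>n. fps_nth (Abs_fps a) n * u ^ n) sums h u"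
        by eventually_elim (use series in auto)
    qed
    from fps_nth_fps_expansion[OF this, of n] show ?thesis by simp
  qed
  define I where "I u = h u * (?x / u) ^ m / (u - ?x)" for u
  have ker: "h u / (u - ?x) - (\<Sum>k<m. ?x ^ k * (h u / (u - 0) ^ Suc k)) = I u" if "cmod u = 1" for u
  proof -
    have u: "u \<noteq> 0" "u \<noteq> ?x" using that rho by auto
    have "(\<Sum>k<m. ?x ^ k * (h u / (u - 0) ^ Suc k)) = h u / u * (\<Sum>k<m. (?x / u) ^ k)"
      by (simp add: sum_distrib_left power_divide field_simps)
    also have "(\<Sum>k<m. (?x / u) ^ k) = (1 - (?x / u) ^ m) / (1 - ?x / u)"
      using u by (subst sum_gp_strict) auto
    also have "h u / u * \<dots> = h u * (1 - (?x / u) ^ m) / (u - ?x)"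
      using u by (simp add: divide_simps)
    finally show ?thesis by (simp add: I_def diff_divide_distrib[symmetric] algebra_simps)
  qed
  have c1: "((\<lambda>u. h u / (u - ?x)) has_contour_integral (2 * of_real pi * \<i> * h ?x)) (circlepath 0 1)"
    using rho by (intro Cauchy_integral_circlepath cont holo) auto
  have c2: "((\<lambda>u. \<Sum>k<m. ?x ^ k * (h u / (u - 0) ^ Suc k)) has_contour_integral
      (\<Sum>k<m. ?x ^ k * ((2 * pi * \<i>) / (fact k) * (deriv ^^ k) h 0))) (circlepath 0 1)"
    by (intro has_contour_integral_sum has_contour_integral_lmul
        Cauchy_has_contour_integral_higher_derivative_circlepath cont holo) auto
  have "((\<lambda>u. h u / (u - ?x) - (\<Sum>k<m. ?x ^ k * (h u / (u - 0) ^ Suc k))) has_contour_integral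
     (2 * of_real pi * \<i> * (h ?x - (\<Sum>n<m. a n * ?x ^ n)))) (circlepath 0 1)"
    using has_contour_integral_diff[OF c1 c2]
    by (simp add: coeff sum_distrib_left algebra_simps)
  then have "(I has_contour_integral (2 * of_real pi * \<i> * (h ?x - (\<Sum>n<m. a n * ?x ^ n)))) (circlepath 0 1)"
    by (rule has_contour_integral_eq) (rule ker, simp)
  then have hi: "((\<lambda>t. I (circlepath 0 1 t) * vector_derivative (circlepath 0 1) (at t within {0..1})) has_integral
      (2 * of_real pi * \<i> * (h ?x - (\<Sum>n<m. a n * ?x ^ n)))) {0..1}"
    by (simp add: has_contour_integral_def)
  let ?w = "\<lambda>\<theta>. cmod (1 - complex_of_real \<rho> * cis \<theta>)"
  have "((\<lambda>\<theta>. 1 / ?w \<theta>) has_integral (integral {0..2*pi} (\<lambda>\<theta>. 1 / ?w \<theta>))) {0..2*pi}"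
    by (intro integrable_integral one_minus_cis_integrable rho)
  from has_integral_stretch_real[OF this, of "2*pi"]
  have "((\<lambda>t. 1 / ?w (2 * pi * t)) has_integral (1 / (2 * pi) * integral {0..2*pi} (\<lambda>\<theta>. 1 / ?w \<theta>))) {0..1}"
    by simp
  then have "((\<lambda>t. 1 / ?w (2 * pi * t)) has_integral (Kconst \<rho> / \<rho>)) {0..1}"
    using rho by (simp add: Kconst_eq)
  from has_integral_mult_right[OF this, of "N * \<rho> ^ m * (2 * pi)"]
  have wi: "((\<lambda>t. N * \<rho> ^ m * (2 * pi) * (1 / ?w (2 * pi * t))) has_integral (N * \<rho> ^ m * (2 * pi) * (Kconst \<rho> / \<rho>))) {0..1}" .
  have "cmod (2 * of_real pi * \<i> * (h ?x - (\<Sum>n<m. a n * ?x ^ n))) \<le> N * \<rho> ^ m * (2 * pi) * (Kconst \<rho> / \<rho>)"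
    unfolding integral_unique[OF hi, symmetric] integral_unique[OF wi, symmetric]
  proof (rule integral_norm_bound_integral[OF has_integral_integrable[OF hi] has_integral_integrable[OF wi]])
    fix t :: real assume t: "t \<in> {0..1}"
    let ?u = "cis (2 * pi * t)"
    have u: "circlepath 0 1 t = ?u" by (simp add: circlepath cis_conv_exp mult_ac)
    have n: "cmod (?u - ?x) = ?w (2 * pi * t)"
    proof -
      have "?u - ?x = ?u * cnj (1 - ?x * ?u)" by (simp add: algebra_simps cis_cnj cis_mult)
      then show ?thesis by (simp add: norm_mult del: complex_cnj_diff)
    qed
    have "cmod (I ?u) = cmod (h ?u) * \<rho> ^ m / ?w (2 * pi * t)"
      using rho by (simp add: I_def norm_mult norm_divide norm_power n)
    also have "\<dots> \<le> N * \<rho> ^ m / ?w (2 * pi * t)"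
      using rho by (intro divide_right_mono mult_right_mono bound) auto
    finally show "cmod (I (circlepath 0 1 t) * vector_derivative (circlepath 0 1) (at t within {0..1}))
       \<le> N * \<rho> ^ m * (2 * pi) * (1 / ?w (2 * pi * t))"
      using t mult_right_mono[of _ _ "2 * pi"] by (fastforce simp: u vector_derivative_circlepath01 norm_mult)
  qed
  moreover have "cmod (2 * of_real pi * \<i> * (h ?x - (\<Sum>n<m. a n * ?x ^ n))) = 2 * pi * cmod (h ?x - (\<Sum>n<m. a n * ?x ^ n))"
    unfolding norm_mult by simp
  moreover have "N * \<rho> ^ m * (2 * pi) * (Kconst \<rho> / \<rho>) = 2 * pi * (N * \<rho> ^ m * Kconst \<rho> / \<rho>)" by simp
  ultimately have "2 * pi * cmod (h ?x - (\<Sum>n<m. a n * ?x ^ n)) \<le> 2 * pi * (N * \<rho> ^ m * Kconst \<rho> / \<rho>)"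
    by (simp only:)
  then have "cmod (h ?x - (\<Sum>n<m. a n * ?x ^ n)) \<le> N * \<rho> ^ m * Kconst \<rho> / \<rho>"
    by (simp only: mult_le_cancel_left_pos[of "2*pi"] pi_gt_zero zero_less_mult_iff zero_less_numeral simp_thms)
  also have "\<dots> = \<rho> ^ (m - 1) * Kconst \<rho> * N"
    using m rho by (cases m) auto
  finally show ?thesis .
qed

text \<open>By the maximum principle only |x| = \<rho> matters, and a rotation carries such a point
  to \<rho> itself; the rotated function satisfies the same hypotheses.\<close>

lemma taylor_remainder_bound:
  fixes h :: "complex \<Rightarrow> complex" and a :: "nat \<Rightarrow> complex"
  assumes rho: "0 < \<rho>" "\<rho> < 1"
    and holo: "h holomorphic_on ball 0 1" and cont: "continuous_on (cball 0 1) h"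
    and bound: "\<And>z. cmod z \<le> 1 \<Longrightarrow> cmod (h z) \<le> N"
    and series: "\<And>z. cmod z < 1 \<Longrightarrow> (\<lambda>n. a n * z ^ n) sums h z"
    and m: "1 \<le> m" and x: "cmod x \<le> \<rho>"
  shows "cmod (h x - (\<Sum>n<m. a n * x ^ n)) \<le> \<rho> ^ (m - 1) * Kconst \<rho> * N"
proof (rule maximum_modulus_frontier[of "\<lambda>x. h x - (\<Sum>n<m. a n * x ^ n)" "cball 0 \<rho>"])
  show "(\<lambda>x. h x - (\<Sum>n<m. a n * x ^ n)) holomorphic_on interior (cball 0 \<rho>)"
    using rho by (intro holomorphic_intros holomorphic_on_subset[OF holo]) auto
  show "continuous_on (closure (cball 0 \<rho>)) (\<lambda>x. h x - (\<Sum>n<m. a n * x ^ n))"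
    using rho by (intro continuous_intros continuous_on_subset[OF cont]) auto
  show "bounded (cball (0::complex) \<rho>)" by simp
  show "x \<in> cball 0 \<rho>" using x by simp
  fix z :: complex assume "z \<in> frontier (cball 0 \<rho>)"
  then have z: "cmod z = \<rho>" using rho by simp
  define e where "e = z / of_real \<rho>"
  have e: "cmod e = 1" "z = e * of_real \<rho>" using z rho by (auto simp: e_def norm_divide)
  have "cmod ((\<lambda>u. h (e * u)) (of_real \<rho>) - (\<Sum>n<m. (a n * e ^ n) * of_real \<rho> ^ n)) \<le> \<rho> ^ (m - 1) * Kconst \<rho> * N"
  proof (rule taylor_remainder_real[OF rho _ _ _ _ m])
    show "(\<lambda>u. h (e * u)) holomorphic_on ball 0 1"
      using e by (intro holomorphic_on_compose_gen[OF _ holo, unfolded o_def] holomorphic_intros) (auto simp: norm_mult)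
    show "continuous_on (cball 0 1) (\<lambda>u. h (e * u))"
      using e by (intro continuous_on_compose2[OF cont] continuous_intros) (auto simp: norm_mult)
    show "cmod (h (e * z)) \<le> N" if "cmod z \<le> 1" for z
      using that e by (intro bound) (simp add: norm_mult)
    show "(\<lambda>n. a n * e ^ n * z ^ n) sums h (e * z)" if "cmod z < 1" for z
      using series[of "e * z"] that e by (simp add: norm_mult power_mult_distrib mult.assoc)
  qed
  then show "cmod (h z - (\<Sum>n<m. a n * z ^ n)) \<le> \<rho> ^ (m - 1) * Kconst \<rho> * N"
    by (simp add: e(2) power_mult_distrib mult.assoc)
qed

section \<open>Moebius maps of positive matrices\<close>

lemma negative_binomial_sums:
  fixes z :: complex
  assumes "cmod z < 1"
  shows "(\<lambda>n. (-1) ^ n * of_nat ((n + l) choose l) * z ^ n) sums (1 / (1 + z) ^ Suc l)"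
proof -
  have nz: "1 + z \<noteq> 0" using assms by (metis add_eq_0_iff2 norm_minus_cancel norm_one less_irrefl)
  have "((- of_nat (Suc l)) gchoose n) = (-1) ^ n * (of_nat ((n + l) choose l) :: complex)" for n
  proof -
    have "((- of_nat (Suc l)) gchoose n) = (-1) ^ n * ((of_nat (Suc l) + of_nat n - 1 :: complex) gchoose n)"
      by (rule gbinomial_minus)
    also have "(of_nat (Suc l) + of_nat n - 1 :: complex) = of_nat (n + l)" by simp
    also have "(of_nat (n + l) :: complex) gchoose n = of_nat ((n + l) choose l)"
      by (metis add_diff_cancel_left' binomial_gbinomial binomial_symmetric le_add1)
    finally show ?thesis .
  qed
  moreover have "(1 + z) powr (- of_nat (Suc l)) = 1 / (1 + z) ^ Suc l"
    using nz by (simp only: powr_minus powr_nat' inverse_eq_divide simp_thms)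
  ultimately show ?thesis
    using gen_binomial_complex[OF assms, of "- of_nat (Suc l)"] by (simp only:)
qed

text \<open>Indexed by the degree \<open>n\<close> in z, so that the series of different powers can
  be added term by term. The exponent is written \<open>Suc l\<close> because for exponent 0
  truncated subtraction would spoil the formula binom(n - 1, l - 1) for the coefficients.\<close>

lemma power_mobius_sums:
  fixes z t :: complex
  assumes "cmod (t * z) < 1"
  shows "(\<lambda>n. if n < Suc l then 0 else (- t) ^ (n - Suc l) * of_nat ((n - 1) choose l) * z ^ n)
    sums (z / (1 + t * z)) ^ Suc l"
proof -
  have "(\<lambda>n. z ^ Suc l * ((-1) ^ n * of_nat ((n + l) choose l) * (t * z) ^ n)) sums (z ^ Suc l * (1 / (1 + t * z) ^ Suc l))"
    by (intro sums_mult negative_binomial_sums assms)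
  also have "z ^ Suc l * (1 / (1 + t * z) ^ Suc l) = (z / (1 + t * z)) ^ Suc l"
    by (simp add: power_divide)
  also have "(\<lambda>n. z ^ Suc l * ((-1) ^ n * of_nat ((n + l) choose l) * (t * z) ^ n)) =
     (\<lambda>n. (\<lambda>n. if n < Suc l then 0 else (- t) ^ (n - Suc l) * of_nat ((n - 1) choose l) * z ^ n) (n + Suc l))"
    by (auto simp: fun_eq_iff power_mult_distrib power_add mult_ac power_minus[of t])
  finally show ?thesis by (subst (asm) sums_zero_iff_shift) auto
qed

lemma tanh_artanh:
  fixes x :: real
  assumes "\<bar>x\<bar> < 1"
  shows "tanh (artanh x) = x"
proof -
  have x: "1 + x > 0" "1 - x > 0" using assms by auto
  then have "exp (- 2 * artanh x) = (1 - x) / (1 + x)"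
    by (simp add: artanh_def exp_minus)
  then show ?thesis using x unfolding tanh_real_altdef by (simp only:) (simp add: divide_simps)
qed

definition cmob :: "real^2^2 \<Rightarrow> complex \<Rightarrow> complex" where
  "cmob M z = (of_real (mob_alpha M) * z + of_real (mob_beta M)) / (of_real (mob_gamma M) * z + of_real (mob_delta M))"

lemma cmob_of_real: "cmob M (of_real x) = of_real (mob_f M x)"
  by (simp add: cmob_def mob_f_def)

text \<open>\<open>log (1 + x * y) = (\<Sum>n. vbasis n x * y ^ n)\<close>, so \<open>vbasis n x\<close> is entry \<open>n \<ge> 1\<close> of the vector \<open>v(x; c)\<close>.\<close>

definition vbasis :: "nat \<Rightarrow> 'a::real_normed_field \<Rightarrow> 'a" where
  "vbasis n z = - ((- z) ^ n) / of_nat n"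

text \<open>Division by 0 yields 0. Index 0 of the vectors is reserved for the additive constant,
  which has no basis function.\<close>

lemma vbasis_0 [simp]: "vbasis 0 z = 0" by (simp add: vbasis_def)

lemma vbasis_of_real: "vbasis n (of_real x :: 'a::real_normed_field) = of_real (vbasis n x)"
  by (simp add: vbasis_def)

text \<open>The absorption identity l binom(k, l) = k binom(k - 1, l - 1), used for \<open>k\<close>
  and for \<open>n\<close>, trades the normalisation 1/k of the basis on the left for 1/n on the
  right. This explains the asymmetric product of binomials in \<open>bcoef\<close>.\<close>

lemma mobius_coefficient:
  fixes t f0 f1 z :: complex
  assumes "1 \<le> l" "l \<le> k" "l \<le> n"
  shows "- ((-1) ^ k) / of_nat k * (of_nat (k choose l) * f0 ^ (k - l) * f1 ^ l *
       ((- t) ^ (n - l) * of_nat ((n - 1) choose (l - 1)) * z ^ n)) =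
     of_nat (n choose l) * of_nat ((k - 1) choose (l - 1)) *
       t ^ (n - l) * (- f0) ^ (k - l) * f1 ^ l * vbasis n z"
proof -
  have "l * (k choose l) = k * ((k - 1) choose (l - 1))" "l * (n choose l) = n * ((n - 1) choose (l - 1))"
    using assms by (simp_all only: times_binomial_minus1_eq)
  then have "of_nat l * of_nat (k choose l) = (of_nat k * of_nat ((k - 1) choose (l - 1)) :: complex)"
    "of_nat l * of_nat (n choose l) = (of_nat n * of_nat ((n - 1) choose (l - 1)) :: complex)"
    unfolding of_nat_mult[symmetric] by simp_all
  then have bin: "of_nat (k choose l) = (of_nat k * of_nat ((k - 1) choose (l - 1)) / of_nat l :: complex)"
    "of_nat (n choose l) = (of_nat n * of_nat ((n - 1) choose (l - 1)) / of_nat l :: complex)"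
    using assms by (simp_all add: field_simps)
  have "(-1) ^ k = ((-1) ^ (k - l) * (-1) ^ l :: complex)" "(-1) ^ n = ((-1) ^ (n - l) * (-1) ^ l :: complex)"
    using assms by (simp_all flip: power_add)
  then have sg: "(-1) ^ k * (- 1) ^ (n - l) = ((-1) ^ (k - l) * (-1) ^ n :: complex)"
    by simp
  have "- ((-1) ^ k) / of_nat k * (of_nat (k choose l) * f0 ^ (k - l) * f1 ^ l *
       ((- t) ^ (n - l) * of_nat ((n - 1) choose (l - 1)) * z ^ n)) =
     - (((-1) ^ k * (- 1) ^ (n - l)) * (of_nat ((k - 1) choose (l - 1)) * of_nat ((n - 1) choose (l - 1)) / of_nat l)
        * f0 ^ (k - l) * f1 ^ l * t ^ (n - l) * z ^ n)"
    using assms unfolding bin power_minus[of t] by simp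
  also have "\<dots> = of_nat (n choose l) * of_nat ((k - 1) choose (l - 1)) *
       t ^ (n - l) * (- f0) ^ (k - l) * f1 ^ l * vbasis n z"
    using assms unfolding sg bin(2) vbasis_def power_minus[of f0] power_minus[of z] by simp
  finally show ?thesis .
qed

locale pos_matrix =
  fixes M :: "real^2^2"
  assumes pos: "\<And>i j. M $ i $ j > 0"
begin

lemma delta_bounds: "mob_delta M > 0" "\<bar>mob_gamma M\<bar> < mob_delta M" "\<bar>mob_beta M\<bar> < mob_delta M"
  using pos[of 1 1] pos[of 1 2] pos[of 2 1] pos[of 2 2]
  by (auto simp: mob_delta_def mob_gamma_def mob_beta_def abs_less_iff)

lemma fT0_eq: "mob_fT M 0 = mob_gamma M / mob_delta M"
  and f0_eq: "mob_f M 0 = mob_beta M / mob_delta M"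
  by (simp_all add: mob_fT_def mob_f_def)

lemma fT0_less_1: "\<bar>mob_fT M 0\<bar> < 1"
  using delta_bounds by (simp add: fT0_eq)

lemma den_pos: "\<bar>x\<bar> \<le> 1 \<Longrightarrow> mob_gamma M * x + mob_delta M > 0"
proof -
  assume "\<bar>x\<bar> \<le> 1"
  then have "\<bar>mob_gamma M * x\<bar> \<le> \<bar>mob_gamma M\<bar> * 1" unfolding abs_mult by (intro mult_left_mono) auto
  then show ?thesis using delta_bounds by (auto simp: abs_if split: if_splits)
qed

lemma cden_nonzero: "cmod z \<le> 1 \<Longrightarrow> of_real (mob_gamma M) * z + of_real (mob_delta M) \<noteq> 0"
proof
  assume z: "cmod z \<le> 1" and "of_real (mob_gamma M) * z + of_real (mob_delta M) = 0"
  then have "cmod (of_real (mob_gamma M) * z) = \<bar>mob_delta M\<bar>"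
    by (metis add_eq_0_iff2 norm_minus_cancel norm_of_real)
  moreover have "cmod (of_real (mob_gamma M) * z) \<le> \<bar>mob_gamma M\<bar> * 1"
    unfolding norm_mult using z by (simp add: mult_left_le)
  ultimately show False using delta_bounds by auto
qed

lemma has_derivative_f:
  assumes "\<bar>x\<bar> \<le> 1"
  shows "(mob_f M has_real_derivative ((mob_alpha M * mob_delta M - mob_beta M * mob_gamma M) / (mob_gamma M * x + mob_delta M)^2)) (at x)"
  unfolding mob_f_def[abs_def]
  by (rule derivative_eq_intros refl | use den_pos[OF assms] in \<open>simp add: power2_eq_square algebra_simps\<close>)+

lemma deriv_f0: "deriv (mob_f M) 0 = (mob_alpha M * mob_delta M - mob_beta M * mob_gamma M) / (mob_delta M)^2"
  using DERIV_imp_deriv[OF has_derivative_f[of 0]] by simp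

text \<open>Isolates z / (1 + t z), whose powers have an explicit expansion. This is why
  \<open>bcoef\<close> involves only f(0), f'(0) and the value of the transposed map at 0.\<close>

lemma cmob_form:
  assumes "cmod z \<le> 1"
  shows "cmob M z = of_real (mob_f M 0) + of_real (deriv (mob_f M) 0) * (z / (1 + of_real (mob_fT M 0) * z))"
proof -
  let ?d = "complex_of_real (mob_delta M)" and ?g = "complex_of_real (mob_gamma M)"
  let ?a = "complex_of_real (mob_alpha M)" and ?b = "complex_of_real (mob_beta M)"
  have d: "?d \<noteq> 0" using delta_bounds by simp
  have den: "?g * z + ?d \<noteq> 0" by (rule cden_nonzero[OF assms])
  have "z / (1 + of_real (mob_fT M 0) * z) = ?d * z / (?g * z + ?d)"
    using d den by (simp add: fT0_eq divide_simps add.commute)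
  then have "of_real (mob_f M 0) + of_real (deriv (mob_f M) 0) * (z / (1 + of_real (mob_fT M 0) * z))
    = ?b / ?d + (?a * ?d - ?b * ?g) / ?d^2 * (?d * z / (?g * z + ?d))"
    by (simp add: f0_eq deriv_f0)
  also have "\<dots> = (?a * z + ?b) / (?g * z + ?d)"
    using d den by (simp add: divide_simps power2_eq_square) (simp add: algebra_simps)
  finally show ?thesis by (simp add: cmob_def)
qed

lemma cmob_holomorphic: "cmob M holomorphic_on ball 0 1"
  unfolding cmob_def[abs_def] using cden_nonzero by (intro holomorphic_intros) auto

lemma cmob_continuous: "continuous_on (cball 0 1) (cmob M)"
  unfolding cmob_def[abs_def] using cden_nonzero by (intro continuous_intros) auto

lemma mob_size:
  assumes "u > 0" "v > 0"
  defines "x \<equiv> (u - v) / (u + v)"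
  defines "u' \<equiv> M $ 1 $ 1 * u + M $ 1 $ 2 * v" and "v' \<equiv> M $ 2 $ 1 * u + M $ 2 $ 2 * v"
  shows "u' > 0" "v' > 0" "ln (u' + v') = ln (u + v) + mob_ell M x" "(u' - v') / (u' + v') = mob_f M x" "\<bar>x\<bar> < 1"
proof -
  show p: "u' > 0" "v' > 0" using pos assms by (auto simp: u'_def v'_def intro!: add_pos_pos)
  show x: "\<bar>x\<bar> < 1" using assms(1,2) by (auto simp: x_def abs_if divide_simps)
  have s: "u' + v' = (u + v) * (mob_gamma M * x + mob_delta M)"
    using assms(1,2) unfolding x_def u'_def v'_def mob_gamma_def mob_delta_def
    by (simp add: divide_simps) (simp add: algebra_simps)
  have d: "u' - v' = (u + v) * (mob_alpha M * x + mob_beta M)"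
    using assms(1,2) unfolding x_def u'_def v'_def mob_alpha_def mob_beta_def
    by (simp add: divide_simps) (simp add: algebra_simps)
  have den: "mob_gamma M * x + mob_delta M > 0" using x by (intro den_pos) auto
  show "ln (u' + v') = ln (u + v) + mob_ell M x"
    unfolding s mob_ell_def using assms(1,2) den by (simp add: ln_mult)
  show "(u' - v') / (u' + v') = mob_f M x"
    unfolding s d mob_f_def using assms(1,2) by simp
qed

text \<open>The matrix \<open>b\<close>, acting on rows, is composition with \<open>f\<close> modulo constants.\<close>

lemma bcoef_sums:
  assumes k: "1 \<le> k" and z: "cmod z < 1"
  shows "(\<lambda>n. of_real (bcoef M k n) * vbasis n z) sums (vbasis k (cmob M z) - of_real (vbasis k (mob_f M 0)))"
proof -
  let ?t = "complex_of_real (mob_fT M 0)" and ?f0 = "complex_of_real (mob_f M 0)"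
  let ?f1 = "complex_of_real (deriv (mob_f M) 0)"
  define y where "y = z / (1 + ?t * z)"
  have "cmod (?t * z) < 1"
  proof -
    have "cmod (?t * z) \<le> 1 * cmod z" unfolding norm_mult using fT0_less_1 by (intro mult_right_mono) auto
    then show ?thesis using z by simp
  qed
  note ps = power_mobius_sums[OF this]
  let ?g = "\<lambda>l n. if n < l then 0 else (- ?t) ^ (n - l) * of_nat ((n - 1) choose (l - 1)) * z ^ n"
  have g: "?g l sums y ^ l" if "l \<in> {1..k}" for l
  proof -
    have "Suc (l - 1) = l" using that by simp
    then show ?thesis using ps[of "l - 1"] unfolding y_def by (simp only:)
  qed
  let ?c = "\<lambda>l. of_nat (k choose l) * ?f0 ^ (k - l) * ?f1 ^ l"
  define s where "s = (- ((-1) ^ k) / of_nat k :: complex)"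
  define F where "F n = (\<Sum>l=1..k. ?c l * ?g l n)" for n
  define Y where "Y = (\<Sum>l=1..k. ?c l * y ^ l)"
  have S: "(\<lambda>n. s * F n) sums (s * Y)"
    unfolding F_def Y_def by (rule sums_mult, rule sums_sum, rule sums_mult, rule g)
  \<comment> \<open>The term \<open>l = 0\<close> of the binomial expansion is the constant f(0)^k,
    the part that the matrix drops.\<close>
  have E1: "Y = (cmob M z) ^ k - ?f0 ^ k"
  proof -
    have "(cmob M z) ^ k = (?f1 * y + ?f0) ^ k"
      using z by (simp add: cmob_form y_def add.commute)
    also have "\<dots> = (\<Sum>l\<le>k. ?c l * y ^ l)"
      by (simp add: binomial_ring power_mult_distrib mult_ac)
    also have "\<dots> = (\<Sum>l\<in>insert 0 {1..k}. ?c l * y ^ l)"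
      by (rule sum.cong) auto
    finally show ?thesis by (simp add: Y_def)
  qed
  have E2: "s * ((cmob M z) ^ k - ?f0 ^ k) = vbasis k (cmob M z) - of_real (vbasis k (mob_f M 0))"
    unfolding vbasis_def s_def by (simp add: power_minus[of "cmob M z"] power_minus[of "mob_f M 0"] right_diff_distrib diff_divide_distrib)
  have E3: "s * F n = of_real (bcoef M k n) * vbasis n z" for n
  proof -
    have "- ((-1) ^ k) / of_nat k * (\<Sum>l=1..k. ?c l * ?g l n) = of_real (bcoef M k n) * vbasis n z"
    proof (cases "n = 0")
      case True then show ?thesis by (auto simp: intro!: sum.neutral)
    next
      case False
      \<comment> \<open>The \<open>l\<close>-th power has no terms of degree below \<open>l\<close>,
        which is the source of the upper limit \<open>min k n\<close> in
        \<open>bcoef\<close>.\<close>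
      have "(\<Sum>l=1..k. ?c l * ?g l n) = (\<Sum>l=1..min k n. ?c l * ?g l n)"
        by (rule sum.mono_neutral_right) auto
      then have "- ((-1) ^ k) / of_nat k * (\<Sum>l=1..k. ?c l * ?g l n)
          = - ((-1) ^ k) / of_nat k * (\<Sum>l=1..min k n. ?c l * ?g l n)"
        by (rule arg_cong)
      also have "\<dots> = (\<Sum>l=1..min k n. - ((-1) ^ k) / of_nat k * (?c l * ?g l n))"
        by (rule sum_distrib_left)
      also have "\<dots> = (\<Sum>l\<in>{1..min k n}. of_nat (n choose l) * of_nat ((k - 1) choose (l - 1)) *
              ?t ^ (n - l) * (- ?f0) ^ (k - l) * ?f1 ^ l * vbasis n z)"
      proof (rule sum.cong[OF refl])
        fix l assume l: "l \<in> {1..min k n}"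
        then have "\<not> n < l" by simp
        then show "- ((-1) ^ k) / of_nat k * (?c l * ?g l n) = of_nat (n choose l) * of_nat ((k - 1) choose (l - 1)) *
              ?t ^ (n - l) * (- ?f0) ^ (k - l) * ?f1 ^ l * vbasis n z"
          unfolding if_not_P[OF \<open>\<not> n < l\<close>] by (intro mobius_coefficient) (use l in auto)
      qed
      also have "\<dots> = of_real (bcoef M k n) * vbasis n z"
        using False k by (simp add: bcoef_def sum_distrib_right)
      finally show ?thesis .
    qed
    then show ?thesis unfolding s_def F_def .
  qed
  show ?thesis using S unfolding E1 E2 E3 .
qed

end

section \<open>Contraction of the complex disc and of the hyperbolic metric\<close>

locale contracting_matrix = pos_matrix +
  fixes \<rho> :: real
  assumes rho: "0 < \<rho>" "\<rho> < 1"
    and contr: "\<And>x. \<bar>x\<bar> \<le> 1 \<Longrightarrow> \<bar>mob_f M x\<bar> \<le> \<rho>"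
begin

text \<open>For fixed \<open>\<bar>z\<bar>\<close> the difference \<open>\<rho>\<^sup>2 \<bar>den\<bar>\<^sup>2 - \<bar>num\<bar>\<^sup>2\<close> is affine in \<open>Re z\<close>, so it suffices to look at
  the real points \<open>z = \<plusminus>\<bar>z\<bar>\<close>.\<close>

lemma cmob_disc:
  assumes z: "cmod z \<le> 1"
  shows "cmod (cmob M z) \<le> \<rho>"
proof -
  define a b g d where "a = mob_alpha M" and "b = mob_beta M" and "g = mob_gamma M" and "d = mob_delta M"
  define s where "s = cmod z"
  have s: "0 \<le> s" "s \<le> 1" using z by (auto simp: s_def)
  have nsq: "(cmod (of_real p * z + of_real q))^2 = p^2 * s^2 + q^2 + 2 * p * q * Re z" for p q
  proof -
    have "(cmod (of_real p * z + of_real q))^2 = (p * Re z + q)^2 + (p * Im z)^2" by (simp add: cmod_power2)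
    also have "\<dots> = p^2 * ((Re z)^2 + (Im z)^2) + q^2 + 2 * p * q * Re z" by (simp add: power2_eq_square algebra_simps)
    finally show ?thesis by (simp add: s_def cmod_power2)
  qed
  have real: "(a * x + b)^2 \<le> \<rho>^2 * (g * x + d)^2" if "\<bar>x\<bar> \<le> 1" for x
  proof -
    have den: "g * x + d > 0" using den_pos[OF that] by (simp add: g_def d_def)
    have "\<bar>a * x + b\<bar> \<le> \<rho> * (g * x + d)"
      using contr[OF that] den by (simp add: mob_f_def a_def b_def g_def d_def abs_divide divide_le_eq)
    then have "\<bar>a * x + b\<bar>^2 \<le> (\<rho> * (g * x + d))^2" by (intro power_mono) auto
    then show ?thesis by (simp add: power_mult_distrib)
  qed
  define A where "A = \<rho>^2 * (g^2 * s^2 + d^2) - (a^2 * s^2 + b^2)"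
  define B where "B = 2 * (\<rho>^2 * g * d - a * b)"
  have "0 \<le> A + B * s" "0 \<le> A - B * s"
    using real[of s] real[of "- s"] s unfolding A_def B_def by (simp_all add: power2_eq_square algebra_simps)
  then have "\<bar>B * s\<bar> \<le> A" by auto
  moreover have "\<bar>B * Re z\<bar> \<le> \<bar>B * s\<bar>"
    unfolding abs_mult using s abs_Re_le_cmod[of z] by (intro mult_left_mono) (auto simp: s_def)
  ultimately have "0 \<le> A + B * Re z" by linarith
  then have "(cmod (of_real a * z + of_real b))^2 \<le> \<rho>^2 * (cmod (of_real g * z + of_real d))^2"
    unfolding nsq A_def B_def by (simp add: algebra_simps)
  then have "(cmod (of_real a * z + of_real b))^2 \<le> (\<rho> * cmod (of_real g * z + of_real d))^2"
    by (simp add: power_mult_distrib)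
  then have "cmod (of_real a * z + of_real b) \<le> \<rho> * cmod (of_real g * z + of_real d)"
    by (rule power2_le_imp_le) (use rho in simp)
  moreover have "cmod (of_real g * z + of_real d) > 0" using cden_nonzero[OF z] by (simp add: g_def d_def)
  ultimately show ?thesis unfolding cmob_def norm_divide by (simp add: divide_le_eq a_def b_def g_def d_def)
qed

lemma f_interval: "\<bar>x\<bar> < 1 \<Longrightarrow> \<bar>mob_f M x\<bar> < 1"
  using contr[of x] rho by simp

text \<open>This is Schwarz-Pick for f/\<rho>, which maps [-1, 1] into itself: |f'| (1 - x^2) \<le>
  \<rho> - f^2/\<rho> \<le> \<rho> (1 - f^2). For the first inequality, \<open>p\<close> and
  \<open>q\<close> are affine and nonnegative on [-1, 1], so their product is controlled by
  interpolation from the four values at the ends, and the determinant of f is a combination of those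
  values too.\<close>

lemma f_derivative_bound:
  assumes x: "\<bar>x\<bar> < 1"
  shows "\<bar>mob_alpha M * mob_delta M - mob_beta M * mob_gamma M\<bar> / (mob_gamma M * x + mob_delta M)^2 * (1 - x^2)
    \<le> \<rho> * (1 - (mob_f M x)^2)"
proof -
  define a b g d where "a = mob_alpha M" and "b = mob_beta M" and "g = mob_gamma M" and "d = mob_delta M"
  define p where "p x = \<rho> * (g * x + d) - (a * x + b)" for x
  define q where "q x = \<rho> * (g * x + d) + (a * x + b)" for x
  have den: "g * x + d > 0" if "\<bar>x\<bar> \<le> 1" for x using den_pos[OF that] by (simp add: g_def d_def)
  have pq: "0 \<le> p x" "0 \<le> q x" if "\<bar>x\<bar> \<le> 1" for x
    using contr[OF that] den[OF that]
    by (auto simp: p_def q_def mob_f_def a_def b_def g_def d_def abs_divide divide_le_eq abs_le_iff)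
  have nn: "0 \<le> p 1 * q 1" "0 \<le> p (-1) * q (-1)" "0 \<le> p 1 * q (-1)" "0 \<le> p (-1) * q 1"
    using pq[of 1] pq[of "-1"] by auto
  have "4 * \<rho> * (a * d - b * g) = p (-1) * q 1 - p 1 * q (-1)"
    unfolding p_def q_def by algebra
  then have D: "4 * \<rho> * \<bar>a * d - b * g\<bar> \<le> p (-1) * q 1 + p 1 * q (-1)"
    using nn rho by (cases "a * d - b * g \<ge> 0") (auto simp: abs_if algebra_simps)
  have x2: "0 \<le> 1 - x^2" using x by (simp add: abs_square_le_1)
  have "4 * (p x * q x) = p 1 * q 1 * (1 + x)^2 + p (-1) * q (-1) * (1 - x)^2 + (p (-1) * q 1 + p 1 * q (-1)) * (1 - x^2)"
  proof -
    have "2 * p x = p 1 * (1 + x) + p (-1) * (1 - x)" "2 * q x = q 1 * (1 + x) + q (-1) * (1 - x)"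
      by (simp_all add: p_def q_def algebra_simps)
    then have "(2 * p x) * (2 * q x) = (p 1 * (1 + x) + p (-1) * (1 - x)) * (q 1 * (1 + x) + q (-1) * (1 - x))" by simp
    then show ?thesis by algebra
  qed
  also have "\<dots> \<ge> (p (-1) * q 1 + p 1 * q (-1)) * (1 - x^2)" using nn by auto
  finally have le: "4 * \<rho> * \<bar>a * d - b * g\<bar> * (1 - x^2) \<le> 4 * (p x * q x)"
    using mult_right_mono[OF D x2] by linarith
  define X Y Z where "X = \<bar>a * d - b * g\<bar> * (1 - x^2)" and "Y = (g * x + d)^2" and "Z = (a * x + b)^2"
  have "p x * q x = \<rho>^2 * Y - Z"
    unfolding p_def q_def Y_def Z_def by (simp add: power2_eq_square algebra_simps)
  \<comment> \<open>Passing from f/\<rho> back to f; here the factor \<rho> is gained.\<close>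
  moreover have "\<rho>^2 * Z \<le> Z"
    using rho by (simp add: Z_def mult_left_le_one_le power_le_one)
  ultimately have "4 * \<rho> * X \<le> 4 * (\<rho>^2 * Y - \<rho>^2 * Z)"
    using le by (simp add: X_def mult.assoc)
  then have "\<rho> * X \<le> \<rho> * (\<rho> * (Y - Z))"
    by (simp add: power2_eq_square algebra_simps)
  then have "\<bar>a * d - b * g\<bar> * (1 - x^2) \<le> \<rho> * ((g * x + d)^2 - (a * x + b)^2)"
    using rho by (simp add: X_def Y_def Z_def)
  then have "\<bar>a * d - b * g\<bar> * (1 - x^2) / (g * x + d)^2 \<le> \<rho> * ((g * x + d)^2 - (a * x + b)^2) / (g * x + d)^2"
    by (rule divide_right_mono) simp
  also have "\<dots> = \<rho> * (1 - ((a * x + b) / (g * x + d))^2)"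
  proof -
    have "\<rho> * (A - B) / A = \<rho> * (1 - B / A)" if "A \<noteq> 0" for A B using that by (simp add: field_simps)
    then show ?thesis using den[of x] x by (simp add: power_divide)
  qed
  finally show ?thesis by (simp add: mob_f_def a_def b_def g_def d_def)
qed

text \<open>In the coordinate \<open>artanh\<close> the interval becomes the whole line, and the
  preceding bound says that the conjugated map has derivative at most \<rho>. The mean value theorem
  does the rest.\<close>

lemma artanh_contraction:
  assumes "\<bar>x\<bar> < 1" "\<bar>y\<bar> < 1"
  shows "\<bar>artanh (mob_f M x) - artanh (mob_f M y)\<bar> \<le> \<rho> * \<bar>artanh x - artanh y\<bar>"
proof -
  let ?\<Delta> = "mob_alpha M * mob_delta M - mob_beta M * mob_gamma M"
  let ?f' = "\<lambda>x. ?\<Delta> / (mob_gamma M * x + mob_delta M)^2"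
  have "norm (artanh (mob_f M (tanh (artanh x))) - artanh (mob_f M (tanh (artanh y)))) \<le> \<rho> * norm (artanh x - artanh y)"
  proof (rule field_differentiable_bound[of UNIV])
    fix u :: real
    have t: "\<bar>tanh u\<bar> < 1" using tanh_real_bounds[of u] by (auto simp: abs_less_iff)
    have f: "\<bar>mob_f M (tanh u)\<bar> < 1" by (rule f_interval[OF t])
    then have f2: "(mob_f M (tanh u))^2 < 1" by (simp add: abs_square_less_1)
    have "((\<lambda>u. mob_f M (tanh u)) has_real_derivative ?f' (tanh u) * (1 - tanh u ^ 2)) (at u)"
      using t by (intro DERIV_chain2[OF has_derivative_f]) (auto intro!: derivative_eq_intros)
    from DERIV_chain2[OF artanh_real_has_field_derivative[OF f] this]
    show "((\<lambda>u. artanh (mob_f M (tanh u))) has_real_derivative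
       1 / (1 - (mob_f M (tanh u))^2) * (?f' (tanh u) * (1 - tanh u ^ 2))) (at u within UNIV)" by simp
    have b: "\<bar>?f' (tanh u)\<bar> * (1 - tanh u ^ 2) \<le> \<rho> * (1 - (mob_f M (tanh u))^2)"
      using f_derivative_bound[OF t] by (simp add: abs_divide)
    have "\<bar>1 / X * (Y * Z)\<bar> \<le> \<rho>" if "\<bar>Y\<bar> * Z \<le> \<rho> * X" "0 \<le> Z" "0 < X" for X Y Z :: real
      using that by (simp add: abs_mult divide_le_eq)
    from this[OF b] show "norm (1 / (1 - (mob_f M (tanh u))^2) * (?f' (tanh u) * (1 - tanh u ^ 2))) \<le> \<rho>"
      using f2 t by (simp add: abs_square_le_1)
  qed auto
  then show ?thesis using assms by (simp add: tanh_artanh)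
qed

end

context pos_matrix begin

text \<open>Along x = tanh u the derivative of \<open>mob_ell\<close> is t (1 - x^2) / (1 + t x).
  Its modulus is largest at x = -t / (1 + r) with r = sqrt(1 - t^2), where it equals 2 |t| / (1 +
  r); the 2 is absorbed by \<open>dhyp\<close>.\<close>

lemma ell_lipschitz:
  assumes "\<bar>x\<bar> < 1" "\<bar>y\<bar> < 1"
  shows "\<bar>mob_ell M x - mob_ell M y\<bar> \<le> \<bar>mob_fT M 0\<bar> / (1 + sqrt (1 - \<bar>mob_fT M 0\<bar>^2)) * dhyp x y"
proof -
  define t where "t = mob_fT M 0"
  define r where "r = sqrt (1 - t^2)"
  have t1: "\<bar>t\<bar> < 1" unfolding t_def by (rule fT0_less_1)
  then have "t^2 < 1" by (simp add: abs_square_less_1)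
  then have r: "r > 0" "r^2 = 1 - t^2" by (auto simp: r_def)
  have "norm (mob_ell M (tanh (artanh x)) - mob_ell M (tanh (artanh y))) \<le> 2 * (\<bar>t\<bar> / (1 + r)) * norm (artanh x - artanh y)"
  proof (rule field_differentiable_bound[of UNIV])
    fix u :: real
    define w where "w = tanh u"
    have w: "\<bar>w\<bar> < 1" using tanh_real_bounds[of u] by (auto simp: abs_less_iff w_def)
    have den: "mob_gamma M * w + mob_delta M > 0" using w by (intro den_pos) auto
    have "((\<lambda>x. mob_gamma M * x + mob_delta M) has_real_derivative mob_gamma M) (at w)"
      by (auto intro!: derivative_eq_intros)
    from DERIV_chain2[OF DERIV_ln_divide[OF den] this]
    have "(mob_ell M has_real_derivative 1 / (mob_gamma M * w + mob_delta M) * mob_gamma M) (at (tanh u))"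
      unfolding mob_ell_def[abs_def] w_def .
    moreover have "(tanh has_real_derivative 1 - w ^ 2) (at u)"
      unfolding w_def by (auto intro!: derivative_eq_intros)
    ultimately show "((\<lambda>u. mob_ell M (tanh u)) has_real_derivative
      1 / (mob_gamma M * tanh u + mob_delta M) * mob_gamma M * (1 - tanh u ^ 2)) (at u within UNIV)"
      unfolding w_def by (rule DERIV_chain2)
    have tw: "1 + t * w > 0" using den delta_bounds(1) by (simp add: t_def fT0_eq field_simps)
    have w2: "0 \<le> 1 - w^2" using w by (simp add: abs_square_le_1)
    have "1 / (mob_gamma M * w + mob_delta M) * mob_gamma M * (1 - w^2) = t * (1 - w^2) / (1 + t * w)"
    proof -
      have "mob_gamma M * w + mob_delta M = mob_delta M * (1 + t * w)"
        using delta_bounds(1) by (simp add: t_def fT0_eq field_simps)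
      moreover have "mob_gamma M = mob_delta M * t"
        using delta_bounds(1) by (simp add: t_def fT0_eq)
      ultimately show ?thesis using delta_bounds(1) by (simp only:) simp
    qed
    moreover have "(1 - w^2) / (1 + t * w) \<le> 2 / (1 + r)"
    proof -
      \<comment> \<open>The square vanishes exactly at the maximiser, so no constant is
        lost.\<close>
      have "0 \<le> (r * w + w + t)^2" by simp
      also have "\<dots> = (1 + r) * ((1 + r) * w^2 + 2 * t * w + (1 - r))"
        using r(2) by algebra
      finally have "0 \<le> (1 + r) * w^2 + 2 * t * w + (1 - r)" using r(1) by (simp add: zero_le_mult_iff)
      then have "(1 - w^2) * (1 + r) \<le> 2 * (1 + t * w)" by (simp add: algebra_simps)
      then show ?thesis using tw r(1) by (simp add: divide_le_eq le_divide_eq mult.commute)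
    qed
    then have "\<bar>t\<bar> * ((1 - w^2) / (1 + t * w)) \<le> \<bar>t\<bar> * (2 / (1 + r))" by (rule mult_left_mono) simp
    ultimately show "norm (1 / (mob_gamma M * tanh u + mob_delta M) * mob_gamma M * (1 - tanh u ^ 2)) \<le> 2 * (\<bar>t\<bar> / (1 + r))"
      using tw w2 unfolding w_def[symmetric] by (simp add: abs_mult abs_divide mult.commute)
  qed auto
  then show ?thesis using assms by (simp add: tanh_artanh dhyp_def t_def r_def mult.commute mult.left_commute)
qed

lemma ell_series:
  assumes "\<bar>x\<bar> \<le> 1"
  shows "(\<lambda>n. mob_fT M 0 ^ n * vbasis n x) sums (mob_ell M x - mob_ell M 0)"
proof -
  have "\<bar>mob_fT M 0 * x\<bar> \<le> \<bar>mob_fT M 0\<bar> * 1" unfolding abs_mult using assms by (intro mult_left_mono) auto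
  then have "\<bar>mob_fT M 0 * x\<bar> < 1" using fT0_less_1 by linarith
  then have "(\<lambda>n. - ((- (mob_fT M 0 * x)) ^ n) / of_nat n) sums ln (1 + mob_fT M 0 * x)"
    by (rule Complex_Transcendental.ln_series')
  moreover have "- ((- (mob_fT M 0 * x)) ^ n) / of_nat n = mob_fT M 0 ^ n * vbasis n x" for n
    unfolding vbasis_def power_mult_distrib[symmetric] by (simp add: power_mult_distrib[symmetric])
  moreover have "ln (1 + mob_fT M 0 * x) = mob_ell M x - mob_ell M 0"
  proof -
    have "1 + mob_fT M 0 * x = (mob_gamma M * x + mob_delta M) / mob_delta M"
      using delta_bounds by (simp add: fT0_eq field_simps)
    then show ?thesis using den_pos[OF assms] delta_bounds by (simp add: mob_ell_def ln_div)
  qed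
  ultimately show ?thesis by simp
qed

end

section \<open>Contracting Moebius chains and truncated transfer operators\<close>

lemma ln_geometric_sums:
  fixes y :: real
  assumes "0 \<le> y" "y < 1"
  shows "(\<lambda>n. y ^ n / n) sums ln (1 / (1 - y))"
  using sums_minus[OF Complex_Transcendental.ln_series'[of "- y"]] assms by (simp add: ln_div)

lemma ln_tail_bounds:
  fixes y :: real
  assumes y: "0 \<le> y" "y < 1"
  shows "(\<Sum>n<m. y ^ n / n) \<le> ln (1 / (1 - y))"
    and "1 \<le> m \<Longrightarrow> ln (1 / (1 - y)) - (\<Sum>n<m. y ^ n / n) \<le> y ^ m / (m * (1 - y))"
proof -
  note S = ln_geometric_sums[OF y]
  then have sm: "summable (\<lambda>n. y ^ n / real n)" by (rule sums_summable)
  show "(\<Sum>n<m. y ^ n / n) \<le> ln (1 / (1 - y))"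
    unfolding sums_unique[OF S] by (rule sum_le_suminf[OF sm]) (use y in auto)
  assume m: "1 \<le> m"
  have G: "(\<lambda>n. y ^ m / m * y ^ n) sums (y ^ m / m * (1 / (1 - y)))"
    using y by (intro sums_mult geometric_sums) auto
  have "ln (1 / (1 - y)) - (\<Sum>n<m. y ^ n / n) = (\<Sum>n. y ^ (n + m) / real (n + m))"
    unfolding sums_unique[OF S] using suminf_minus_initial_segment[OF sm, of m] by simp
  also have "\<dots> \<le> (\<Sum>n. y ^ m / m * y ^ n)"
  proof (rule suminf_le)
    show "y ^ (n + m) / real (n + m) \<le> y ^ m / m * y ^ n" for n
      using y m by (simp add: power_add mult.commute frac_le)
    show "summable (\<lambda>n. y ^ (n + m) / real (n + m))"
      using sm by (subst summable_iff_shift)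
  qed (use G in \<open>rule sums_summable\<close>)
  also have "\<dots> = y ^ m / (m * (1 - y))" using sums_unique[OF G] by simp
  finally show "ln (1 / (1 - y)) - (\<Sum>n<m. y ^ n / n) \<le> y ^ m / (m * (1 - y))" .
qed

lemma abs_weighted_sum_le:
  fixes w a :: "'a \<Rightarrow> real"
  assumes "\<And>i. i \<in> S \<Longrightarrow> 0 \<le> w i" "sum w S = 1" "\<And>i. i \<in> S \<Longrightarrow> \<bar>a i\<bar> \<le> b"
  shows "\<bar>\<Sum>i\<in>S. w i * a i\<bar> \<le> b"
proof -
  have "\<bar>\<Sum>i\<in>S. w i * a i\<bar> \<le> (\<Sum>i\<in>S. w i * b)"
    by (rule order_trans[OF sum_abs sum_mono]) (use assms in \<open>auto simp: abs_mult intro: mult_left_mono\<close>)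
  then show ?thesis using assms(2) by (simp flip: sum_distrib_right)
qed

lemma norm_weighted_sum_le:
  fixes w :: "'a \<Rightarrow> real" and a :: "'a \<Rightarrow> complex"
  assumes "\<And>i. i \<in> S \<Longrightarrow> 0 \<le> w i" "sum w S = 1" "\<And>i. i \<in> S \<Longrightarrow> cmod (a i) \<le> b"
  shows "cmod (\<Sum>i\<in>S. of_real (w i) * a i) \<le> b"
proof -
  have "cmod (\<Sum>i\<in>S. of_real (w i) * a i) \<le> (\<Sum>i\<in>S. w i * b)"
    by (rule order_trans[OF norm_sum sum_mono]) (use assms in \<open>auto simp: norm_mult intro: mult_left_mono\<close>)
  then show ?thesis using assms(2) by (simp flip: sum_distrib_right)
qed

text \<open>Only the terms before \<open>k\<close> can be far from \<open>c\<close>, and their share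
  in the mean tends to 0.\<close>

lemma cesaro_limit_bound:
  fixes e :: "nat \<Rightarrow> real"
  assumes lim: "(\<lambda>N. (\<Sum>k<N. e k) / real N) \<longlonglongrightarrow> l"
    and b: "\<And>j. k \<le> j \<Longrightarrow> \<bar>e j - c\<bar> \<le> b"
  shows "\<bar>l - c\<bar> \<le> b"
proof -
  define K where "K = (\<Sum>j<k. \<bar>e j - c\<bar>)"
  have b0: "0 \<le> b" using b[of k] by linarith
  have le: "\<bar>(\<Sum>j<N. e j) / real N - c\<bar> \<le> K / real N + b" if "N \<ge> max 1 k" for N
  proof -
    have N: "N > 0" "k \<le> N" using that by auto
    have "\<bar>\<Sum>j<N. e j - c\<bar> \<le> (\<Sum>j<N. \<bar>e j - c\<bar>)" by (rule sum_abs)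
    also have "\<dots> = K + (\<Sum>j=k..<N. \<bar>e j - c\<bar>)"
      unfolding K_def lessThan_atLeast0 using N by (simp add: sum.atLeastLessThan_concat)
    also have "(\<Sum>j=k..<N. \<bar>e j - c\<bar>) \<le> (\<Sum>j=k..<N. b)" by (rule sum_mono) (auto intro: b)
    also have "\<dots> \<le> real N * b" using b0 by (simp add: mult_right_mono)
    finally have "\<bar>\<Sum>j<N. e j - c\<bar> \<le> K + real N * b" by simp
    moreover have "(\<Sum>j<N. e j - c) = real N * ((\<Sum>j<N. e j) / real N - c)"
      using N by (simp add: sum_subtractf algebra_simps)
    ultimately have "real N * \<bar>(\<Sum>j<N. e j) / real N - c\<bar> \<le> K + real N * b" by (simp add: abs_mult)
    then show ?thesis using N by (simp add: field_simps)
  qed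
  have "(\<lambda>N. \<bar>(\<Sum>k<N. e k) / real N - c\<bar>) \<longlonglongrightarrow> \<bar>l - c\<bar>"
    by (intro tendsto_intros lim)
  moreover have "(\<lambda>N. K / real N + b) \<longlonglongrightarrow> 0 + b"
    by (intro tendsto_intros tendsto_divide_0[OF tendsto_const] filterlim_real_sequentially filterlim_at_top_imp_at_infinity)
  ultimately show ?thesis using le by (intro LIMSEQ_le[of _ "\<bar>l - c\<bar>" _ b]) (auto intro!: exI[of _ "max 1 k"])
qed

text \<open>Evaluates the accumulated truncation error: \<open>a\<close> will be the error of the
  first truncation, \<open>b\<close> the initial size and \<open>R\<close> the relative error of
  each later truncation.\<close>

lemma sum_geometric_excess:
  fixes a b R :: real
  assumes "R \<noteq> 0"
  shows "(\<Sum>l<j. 2 * (a + b * ((1 + R) ^ l - 1))) = 2 * (real j * a + b * (((1 + R) ^ j - 1) / R - real j))"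
proof -
  have "(\<Sum>l<j. 2 * (a + b * ((1 + R) ^ l - 1))) = 2 * (real j * a + b * ((\<Sum>l<j. (1 + R) ^ l) - real j))"
    by (induction j) (simp_all add: algebra_simps)
  then show ?thesis using assms geometric_sum[of "1 + R" j] by simp
qed

locale mobius_chain =
  fixes S :: "'s set" and Q :: "'s \<Rightarrow> 's \<Rightarrow> real" and \<pi> :: "'s \<Rightarrow> real" and B :: "'s \<Rightarrow> real^2^2" and \<rho> :: real
  assumes fin: "finite S"
    and Q_nonneg: "\<And>r s. r \<in> S \<Longrightarrow> s \<in> S \<Longrightarrow> 0 \<le> Q r s"
    and Q_row: "\<And>r. r \<in> S \<Longrightarrow> (\<Sum>s\<in>S. Q r s) = 1"
    and stationary: "stationary_on S Q \<pi>"
    and contracting: "\<And>r. r \<in> S \<Longrightarrow> contracting_matrix (B r) \<rho>"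
begin

abbreviation f where "f r \<equiv> mob_f (B r)"
abbreviation t where "t r \<equiv> mob_fT (B r) 0"

lemma pos: "r \<in> S \<Longrightarrow> pos_matrix (B r)"
  using contracting by (simp add: contracting_matrix_def)

lemma pi_nonneg: "r \<in> S \<Longrightarrow> 0 \<le> \<pi> r"
  and pi_sum: "(\<Sum>r\<in>S. \<pi> r) = 1"
  and pi_stat: "s \<in> S \<Longrightarrow> (\<Sum>r\<in>S. \<pi> r * Q r s) = \<pi> s"
  using stationary by (auto simp: stationary_on_def)

lemma S_nonempty: "S \<noteq> {}"
  using pi_sum by auto

lemma rho: "0 < \<rho>" "\<rho> < 1"
  using S_nonempty contracting contracting_matrix.rho by blast+

lemma f_bound: "r \<in> S \<Longrightarrow> \<bar>x\<bar> \<le> 1 \<Longrightarrow> \<bar>f r x\<bar> \<le> \<rho>"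
  using contracting contracting_matrix.contr by blast

lemma pi_Q_weights:
  "\<And>p. p \<in> S \<times> S \<Longrightarrow> 0 \<le> \<pi> (fst p) * Q (fst p) (snd p)"
  "(\<Sum>p\<in>S \<times> S. \<pi> (fst p) * Q (fst p) (snd p)) = 1"
  by (auto simp: pi_nonneg Q_nonneg sum.cartesian_product' sum_distrib_left[symmetric] Q_row pi_sum)

section \<open>Transfer operator and convergence of the mean increments\<close>

definition transfer :: "('s \<Rightarrow> real \<Rightarrow> real) \<Rightarrow> 's \<Rightarrow> real \<Rightarrow> real" where
  "transfer g r x = (\<Sum>s\<in>S. Q r s * g s (f r x))"

text \<open>The mean growth in step \<open>k\<close> of a path that starts in the state
  \<open>r\<close> at the point \<open>x\<close>. \<open>H\<close> is what the exponent needs; its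
  companion \<open>G\<close>, normalised at the first stage, is what an operator blind to constants
  can follow.\<close>

definition H :: "nat \<Rightarrow> 's \<Rightarrow> real \<Rightarrow> real" where
  "H k = (transfer ^^ k) (\<lambda>r x. mob_ell (B r) x)"

definition G :: "nat \<Rightarrow> 's \<Rightarrow> real \<Rightarrow> real" where
  "G k = (transfer ^^ k) (\<lambda>r x. mob_ell (B r) x - mob_ell (B r) 0)"

lemma H_Suc: "H (Suc k) r x = (\<Sum>s\<in>S. Q r s * H k s (f r x))"
  and G_Suc: "G (Suc k) r x = (\<Sum>s\<in>S. Q r s * G k s (f r x))"
  by (simp_all add: H_def G_def transfer_def)

lemma H_G: "\<exists>c. \<forall>x. H k r x = G k r x + c"
proof (induction k arbitrary: r)
  case 0 show ?case by (rule exI[of _ "mob_ell (B r) 0"]) (simp add: H_def G_def)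
next
  case (Suc k)
  then obtain c where c: "\<And>s x. H k s x = G k s x + c s" by metis
  show ?case
    by (rule exI[of _ "\<Sum>s\<in>S. Q r s * c s"])
       (simp add: H_Suc G_Suc c distrib_left sum.distrib)
qed

lemma H_diff: "H k r x - H k r y = G k r x - G k r y"
  using H_G[of k r] by auto

definition lip :: real where
  "lip = Max ((\<lambda>c. \<bar>t c\<bar> / (1 + sqrt (1 - \<bar>t c\<bar>^2))) ` S)"

lemma lip_ge: "r \<in> S \<Longrightarrow> \<bar>t r\<bar> / (1 + sqrt (1 - \<bar>t r\<bar>^2)) \<le> lip"
  unfolding lip_def using fin by (intro Max_ge) auto

lemma lip_nonneg: "0 \<le> lip"
proof -
  obtain r where r: "r \<in> S" using S_nonempty by auto
  have "0 \<le> \<bar>t r\<bar> / (1 + sqrt (1 - \<bar>t r\<bar>^2))"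
    using pos_matrix.fT0_less_1[OF pos[OF r]] by (intro divide_nonneg_nonneg add_nonneg_nonneg real_sqrt_ge_zero) (auto simp: abs_square_le_1)
  then show ?thesis using lip_ge[OF r] by linarith
qed

lemma H_lipschitz:
  assumes "r \<in> S" "\<bar>x\<bar> < 1" "\<bar>y\<bar> < 1"
  shows "\<bar>H k r x - H k r y\<bar> \<le> lip * \<rho> ^ k * dhyp x y"
  using assms
proof (induction k arbitrary: r x y)
  case 0
  have "\<bar>mob_ell (B r) x - mob_ell (B r) y\<bar> \<le> \<bar>t r\<bar> / (1 + sqrt (1 - \<bar>t r\<bar>^2)) * dhyp x y"
    by (rule pos_matrix.ell_lipschitz[OF pos]) (use 0 in auto)
  also have "\<dots> \<le> lip * dhyp x y"
    by (rule mult_right_mono[OF lip_ge]) (use 0 in \<open>auto simp: dhyp_def\<close>)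
  finally show ?case by (simp add: H_def)
next
  case (Suc k)
  have f: "\<bar>f r x\<bar> < 1" "\<bar>f r y\<bar> < 1"
    using f_bound[of r x] f_bound[of r y] Suc.prems rho by auto
  have "H (Suc k) r x - H (Suc k) r y = (\<Sum>s\<in>S. Q r s * (H k s (f r x) - H k s (f r y)))"
    by (simp add: H_Suc sum_subtractf right_diff_distrib)
  also have "\<bar>\<dots>\<bar> \<le> lip * \<rho> ^ k * dhyp (f r x) (f r y)"
    by (intro abs_weighted_sum_le Q_nonneg Q_row Suc.IH f) (use Suc.prems in auto)
  also have "\<dots> \<le> lip * \<rho> ^ k * (\<rho> * dhyp x y)"
    using contracting_matrix.artanh_contraction[OF contracting, of r x y] Suc.prems lip_nonneg rho
    by (intro mult_left_mono mult_nonneg_nonneg) (auto simp: dhyp_def)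
  finally show ?case by (simp add: mult_ac)
qed

text \<open>For the stationary chain \<open>c\<^sub>0, c\<^sub>1, \<dots>\<close> this is the mean of \<open>\<ell>(f(\<dots>f(0)\<dots>))\<close>, where \<open>\<ell>\<close> belongs
  to \<open>c\<^sub>k\<close> and the maps to \<open>c\<^sub>0, \<dots>, c\<^bsub>k-1\<^esub>\<close>: the mean growth contributed by the step \<open>k\<close>.\<close>

definition e :: "nat \<Rightarrow> real" where
  "e k = (\<Sum>q\<in>S. \<pi> q * H k q 0)"

text \<open>By stationarity an extra state can be inserted in front of the path in
  \<open>e k\<close>. Both means then run over the same pairs of states, and only the starting
  points f(0) and 0 differ.\<close>

lemma e_diff:
  "e (Suc k) - e k = (\<Sum>p\<in>S \<times> S. \<pi> (fst p) * Q (fst p) (snd p) * (H k (snd p) (f (fst p) 0) - H k (snd p) 0))"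
proof -
  have "e (Suc k) = (\<Sum>q\<in>S. \<Sum>r\<in>S. \<pi> q * Q q r * H k r (f q 0))"
    by (simp add: e_def H_Suc sum_distrib_left mult.assoc)
  moreover have "e k = (\<Sum>r\<in>S. \<Sum>q\<in>S. \<pi> q * Q q r * H k r 0)"
    unfolding e_def by (rule sum.cong) (auto simp: pi_stat sum_distrib_right[symmetric])
  then have "e k = (\<Sum>q\<in>S. \<Sum>r\<in>S. \<pi> q * Q q r * H k r 0)"
    by (subst (asm) sum.swap)
  ultimately show ?thesis
    by (simp add: sum.cartesian_product' right_diff_distrib sum_subtractf)
qed

definition E :: real where
  "E = 1 / (1 - \<rho>) * lip * (\<Sum>c\<in>S. \<pi> c * dhyp (f c 0) 0)"

lemma e_step: "\<bar>e (Suc k) - e k\<bar> \<le> (1 - \<rho>) * E * \<rho> ^ k"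
proof -
  have "\<bar>e (Suc k) - e k\<bar> \<le> (\<Sum>p\<in>S \<times> S. \<pi> (fst p) * Q (fst p) (snd p) * (lip * \<rho> ^ k * dhyp (f (fst p) 0) 0))"
    unfolding e_diff
  proof (rule order_trans[OF sum_abs sum_mono])
    fix p assume p: "p \<in> S \<times> S"
    have "\<bar>f (fst p) 0\<bar> < 1" using f_bound[of "fst p" 0] p rho by auto
    then have "\<bar>H k (snd p) (f (fst p) 0) - H k (snd p) 0\<bar> \<le> lip * \<rho> ^ k * dhyp (f (fst p) 0) 0"
      using p by (intro H_lipschitz) auto
    then show "\<bar>\<pi> (fst p) * Q (fst p) (snd p) * (H k (snd p) (f (fst p) 0) - H k (snd p) 0)\<bar>
      \<le> \<pi> (fst p) * Q (fst p) (snd p) * (lip * \<rho> ^ k * dhyp (f (fst p) 0) 0)"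
      using pi_Q_weights(1)[OF p] unfolding abs_mult[of "\<pi> (fst p) * Q (fst p) (snd p)"] by (simp add: mult_left_mono)
  qed
  also have "\<dots> = (\<Sum>q\<in>S. \<Sum>r\<in>S. Q q r * (\<pi> q * (lip * \<rho> ^ k * dhyp (f q 0) 0)))"
    by (simp add: sum.cartesian_product' mult_ac)
  also have "\<dots> = (\<Sum>q\<in>S. \<pi> q * (lip * \<rho> ^ k * dhyp (f q 0) 0))"
    by (rule sum.cong) (auto simp: sum_distrib_right[symmetric] Q_row)
  also have "\<dots> = (1 - \<rho>) * E * \<rho> ^ k"
    using rho by (simp add: E_def sum_distrib_left mult_ac)
  finally show ?thesis .
qed

lemma E_nonneg: "0 \<le> E"
  unfolding E_def using rho lip_nonneg pi_nonneg
  by (intro mult_nonneg_nonneg sum_nonneg) (auto simp: dhyp_def)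

lemma e_tail:
  assumes "k \<le> j"
  shows "\<bar>e j - e k\<bar> \<le> E * \<rho> ^ k"
proof -
  \<comment> \<open>The factor 1 - \<rho>^i is the exact partial geometric sum, so the induction
    closes without loss; it accounts for the 1 / (1 - \<rho>) in \<open>E\<close>.\<close>
  have "\<bar>e (k + i) - e k\<bar> \<le> E * \<rho> ^ k * (1 - \<rho> ^ i)" for i
  proof (induction i)
    case (Suc i)
    have "\<bar>e (k + Suc i) - e k\<bar> \<le> (1 - \<rho>) * E * \<rho> ^ (k + i) + E * \<rho> ^ k * (1 - \<rho> ^ i)"
      using e_step[of "k + i"] Suc by simp
    also have "\<dots> = E * \<rho> ^ k * (1 - \<rho> ^ Suc i)"
      by (simp add: power_add algebra_simps)
    finally show ?case .
  qed simp
  from this[of "j - k"] have "\<bar>e j - e k\<bar> \<le> E * \<rho> ^ k * (1 - \<rho> ^ (j - k))" using assms by simp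
  also have "\<dots> \<le> E * \<rho> ^ k * 1"
    using rho E_nonneg by (intro mult_left_mono) auto
  finally show ?thesis by simp
qed

text \<open>\<open>approx m j r\<close> is a polynomial of degree less than \<open>m\<close>: truncate the series of \<open>G 0\<close>, then
  \<open>j\<close> times apply \<open>transfer\<close> and truncate the Taylor series at \<open>0\<close> again. In the basis \<open>vbasis\<close> its
  coefficients arise by letting the truncated operator act on row vectors. The constant terms
  \<open>cst\<close>, which the operator forgets, make the truncation a genuine Taylor truncation.\<close>

fun coef :: "nat \<Rightarrow> nat \<Rightarrow> 's \<Rightarrow> nat \<Rightarrow> real" where
  "coef m 0 r n = (if n = 0 then 0 else t r ^ n)"
| "coef m (Suc j) r n = (\<Sum>s\<in>S. Q r s * (\<Sum>k<m. coef m j s k * bcoef (B r) k n))"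

fun cst :: "nat \<Rightarrow> nat \<Rightarrow> 's \<Rightarrow> real" where
  "cst m 0 r = 0"
| "cst m (Suc j) r = (\<Sum>s\<in>S. Q r s * (cst m j s + (\<Sum>k<m. coef m j s k * vbasis k (f r 0))))"

definition approx :: "nat \<Rightarrow> nat \<Rightarrow> 's \<Rightarrow> real \<Rightarrow> real" where
  "approx m j r x = cst m j r + (\<Sum>n<m. coef m j r n * vbasis n x)"

definition capprox :: "nat \<Rightarrow> nat \<Rightarrow> 's \<Rightarrow> complex \<Rightarrow> complex" where
  "capprox m j r z = of_real (cst m j r) + (\<Sum>n<m. of_real (coef m j r n) * vbasis n z)"

lemma capprox_of_real: "capprox m j r (of_real x) = of_real (approx m j r x)"
  by (simp add: capprox_def approx_def vbasis_of_real)

lemma coef_0: "coef m j r 0 = 0"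
  by (cases j) (simp_all add: bcoef_def)

text \<open>\<open>capprox\<close> before the last truncation.\<close>

definition pushed :: "nat \<Rightarrow> nat \<Rightarrow> 's \<Rightarrow> complex \<Rightarrow> complex" where
  "pushed m j r z = (\<Sum>s\<in>S. of_real (Q r s) * capprox m j s (cmob (B r) z))"

text \<open>\<open>bcoef_sums\<close> is applied to each basis function. The constants vbasis k
  (f(0)) that it subtracts are exactly what \<open>cst\<close> collects.\<close>

lemma pushed_sums:
  assumes r: "r \<in> S" and z: "cmod z < 1"
  shows "(\<lambda>n. of_real (coef m (Suc j) r n) * vbasis n z) sums (pushed m j r z - of_real (cst m (Suc j) r))"
proof -
  have "(\<lambda>n. \<Sum>s\<in>S. of_real (Q r s) * (\<Sum>k<m. of_real (coef m j s k) * (of_real (bcoef (B r) k n) * vbasis n z)))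
    sums (\<Sum>s\<in>S. of_real (Q r s) * (\<Sum>k<m. of_real (coef m j s k) * (vbasis k (cmob (B r) z) - of_real (vbasis k (f r 0)))))"
  proof (rule sums_sum, rule sums_mult, rule sums_sum)
    fix s k
    show "(\<lambda>n. of_real (coef m j s k) * (of_real (bcoef (B r) k n) * vbasis n z))
      sums (of_real (coef m j s k) * (vbasis k (cmob (B r) z) - of_real (vbasis k (f r 0))))"
    proof (cases "k = 0")
      case True then show ?thesis by (simp add: coef_0)
    next
      case False
      then show ?thesis by (intro sums_mult pos_matrix.bcoef_sums[OF pos[OF r]] z) auto
    qed
  qed
  also have "(\<Sum>s\<in>S. of_real (Q r s) * (\<Sum>k<m. of_real (coef m j s k) * (vbasis k (cmob (B r) z) - of_real (vbasis k (f r 0)))))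
    = pushed m j r z - of_real (cst m (Suc j) r)"
    by (simp add: pushed_def capprox_def right_diff_distrib distrib_left sum.distrib sum_subtractf)
  also have "(\<lambda>n. \<Sum>s\<in>S. of_real (Q r s) * (\<Sum>k<m. of_real (coef m j s k) * (of_real (bcoef (B r) k n) * vbasis n z)))
    = (\<lambda>n. of_real (coef m (Suc j) r n) * vbasis n z)"
    by (simp add: sum_distrib_right mult.assoc)
  finally show ?thesis .
qed

lemma vbasis_continuous [continuous_intros]:
  "continuous_on A g \<Longrightarrow> continuous_on A (\<lambda>z. vbasis k (g z :: complex))"
  unfolding vbasis_def by (cases "k = 0") (auto intro!: continuous_intros)

lemma vbasis_holomorphic [holomorphic_intros]:
  "g holomorphic_on A \<Longrightarrow> (\<lambda>z. vbasis k (g z)) holomorphic_on A"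
  unfolding vbasis_def by (cases "k = 0") (auto intro!: holomorphic_intros)

lemma truncation_step:
  assumes r: "r \<in> S" and m: "1 \<le> m" and z: "cmod z \<le> \<rho>"
    and N: "\<And>s z. s \<in> S \<Longrightarrow> cmod z \<le> \<rho> \<Longrightarrow> cmod (capprox m j s z) \<le> N"
  shows "cmod (pushed m j r z - capprox m (Suc j) r z) \<le> \<rho> ^ (m - 1) * Kconst \<rho> * N"
    and "\<And>z. cmod z \<le> 1 \<Longrightarrow> cmod (pushed m j r z) \<le> N"
proof -
  show bound: "\<And>z. cmod z \<le> 1 \<Longrightarrow> cmod (pushed m j r z) \<le> N"
    unfolding pushed_def using r contracting_matrix.cmob_disc[OF contracting[OF r]]
    by (intro norm_weighted_sum_le N Q_nonneg Q_row) auto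
  \<comment> \<open>The ordinary Taylor coefficients, constant term included: the normalisation of
    the basis is undone so that the Taylor bound applies.\<close>
  define a where "a n = (if n = 0 then complex_of_real (cst m (Suc j) r) else of_real (coef m (Suc j) r n) * (- ((-1) ^ n) / of_nat n))" for n
  have a: "a n * z ^ n = (if n = 0 then of_real (cst m (Suc j) r) else 0) + of_real (coef m (Suc j) r n) * vbasis n z" for n z
    by (simp add: a_def vbasis_def power_minus[of z])
  have "cmod (pushed m j r z - (\<Sum>n<m. a n * z ^ n)) \<le> \<rho> ^ (m - 1) * Kconst \<rho> * N"
  proof (rule taylor_remainder_bound[OF rho _ _ bound _ m z])
    show "pushed m j r holomorphic_on ball 0 1"
      unfolding pushed_def[abs_def] capprox_def
      by (intro holomorphic_intros pos_matrix.cmob_holomorphic pos r)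
    show "continuous_on (cball 0 1) (pushed m j r)"
      unfolding pushed_def[abs_def] capprox_def
      by (intro continuous_intros pos_matrix.cmob_continuous pos r)
    show "(\<lambda>n. a n * z ^ n) sums pushed m j r z" if "cmod z < 1" for z
      using sums_add[OF sums_single[of 0 "\<lambda>_. of_real (cst m (Suc j) r)"] pushed_sums[OF r that, of m j]]
      by (simp add: a)
  qed auto
  also have "(\<Sum>n<m. a n * z ^ n) = capprox m (Suc j) r z"
    using m by (simp add: a sum.distrib capprox_def del: coef.simps cst.simps)
  finally show "cmod (pushed m j r z - capprox m (Suc j) r z) \<le> \<rho> ^ (m - 1) * Kconst \<rho> * N" .
qed

section \<open>Propagation of the truncation error\<close>

definition D :: real where "D = Max ((\<lambda>c. \<bar>t c\<bar>) ` S)"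

lemma D_ge: "r \<in> S \<Longrightarrow> \<bar>t r\<bar> \<le> D"
  unfolding D_def using fin by (intro Max_ge) auto

lemma D_range: "0 \<le> D" "D < 1"
proof -
  obtain r where "r \<in> S" using S_nonempty by auto
  then show "0 \<le> D" using D_ge[of r] by auto
  show "D < 1" unfolding D_def using fin S_nonempty pos_matrix.fT0_less_1[OF pos] by (subst Max_less_iff) auto
qed

lemma rhoD: "0 \<le> \<rho> * D" "\<rho> * D < 1"
  using rho D_range mult_strict_mono[of \<rho> 1 D 1] by auto

abbreviation lnD where "lnD \<equiv> ln (1 / (1 - \<rho> * D))"
abbreviation rhom where "rhom m \<equiv> \<rho> ^ (m - 1) * Kconst \<rho>"

text \<open>Stated over a general normed field because it serves both the bound on the complex disc
  and the tail of the real series.\<close>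

lemma term_bound:
  assumes "r \<in> S" "norm z \<le> \<rho>"
  shows "norm (of_real (coef m 0 r n) * vbasis n (z :: 'b::real_normed_field)) \<le> (\<rho> * D) ^ n / n"
proof (cases "n = 0")
  case False
  have "\<bar>t r\<bar> ^ n * norm z ^ n \<le> D ^ n * \<rho> ^ n"
    using D_ge[OF assms(1)] assms(2) by (intro mult_mono power_mono) auto
  then show ?thesis using False
    by (simp add: vbasis_def norm_mult norm_divide norm_power power_abs power_mult_distrib divide_right_mono mult.commute)
qed simp

lemma capprox_bound:
  assumes "r \<in> S" "1 \<le> m" "cmod z \<le> \<rho>"
  shows "cmod (capprox m j r z) \<le> lnD * (1 + rhom m) ^ j"
  using assms
proof (induction j arbitrary: r z)
  case 0
  have "cmod (capprox m 0 r z) \<le> (\<Sum>n<m. (\<rho> * D) ^ n / n)"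
    unfolding capprox_def using 0 by (simp del: coef.simps) (intro order_trans[OF norm_sum sum_mono] term_bound)
  also have "\<dots> \<le> lnD" by (rule ln_tail_bounds(1)[OF rhoD])
  finally show ?case by simp
next
  case (Suc j)
  note ts = truncation_step[of r m z j "lnD * (1 + rhom m) ^ j", OF Suc.prems Suc.IH]
  have "cmod (capprox m (Suc j) r z) \<le> cmod (pushed m j r z) + cmod (pushed m j r z - capprox m (Suc j) r z)"
    by (metis norm_triangle_sub norm_minus_commute)
  also have "\<dots> \<le> lnD * (1 + rhom m) ^ j + rhom m * (lnD * (1 + rhom m) ^ j)"
    using Suc.prems rho by (intro add_mono ts) auto
  finally show ?case by (simp add: algebra_simps)
qed

text \<open>Bounds the remainder from order \<open>m\<close> on of the series of log (1 / (1 -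
  \<rho> D)), by comparison with a geometric series.\<close>

definition tail :: "nat \<Rightarrow> real" where
  "tail m = \<rho> ^ m * D ^ m / (m * (1 - \<rho> * D))"

text \<open>Old errors are only averaged and pass on unchanged, while step \<open>j\<close> adds
  \<open>rhom m\<close> times the current bound lnD (1 + rhom m)^j. These additions telescope; the
  initial truncation contributes \<open>tail m\<close>.\<close>

lemma approx_error:
  assumes "r \<in> S" "1 \<le> m" "\<bar>x\<bar> \<le> \<rho>"
  shows "\<bar>G j r x - approx m j r x\<bar> \<le> tail m + lnD * ((1 + rhom m) ^ j - 1)"
  using assms
proof (induction j arbitrary: r x)
  case 0
  have S: "(\<lambda>n. coef m 0 r n * vbasis n x) sums G 0 r x"
  proof -
    have "(\<lambda>n. coef m 0 r n * vbasis n x) = (\<lambda>n. t r ^ n * vbasis n x)" by (auto simp: fun_eq_iff)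
    then show ?thesis using pos_matrix.ell_series[OF pos[OF 0(1)], of x] 0 rho by (simp add: G_def)
  qed
  have sy: "(\<lambda>n. (\<rho> * D) ^ (n + m) / real (n + m)) sums (lnD - (\<Sum>n<m. (\<rho> * D) ^ n / n))"
    using ln_geometric_sums[OF rhoD] by (subst sums_iff_shift) simp
  have "G 0 r x - approx m 0 r x = (\<Sum>n. coef m 0 r (n + m) * vbasis (n + m) x)"
    unfolding sums_unique[OF S] approx_def
    using suminf_minus_initial_segment[OF sums_summable[OF S], of m] by (simp del: coef.simps)
  also have "\<bar>\<dots>\<bar> \<le> (\<Sum>n. (\<rho> * D) ^ (n + m) / real (n + m))"
  proof (rule order_trans[OF summable_rabs])
    have *: "\<bar>coef m 0 r n * vbasis n x\<bar> \<le> (\<rho> * D) ^ n / n" for n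
      using term_bound[of r x m n] 0 by (simp del: coef.simps)
    show sm: "summable (\<lambda>n. \<bar>coef m 0 r (n + m) * vbasis (n + m) x\<bar>)"
      by (rule summable_comparison_test'[OF sums_summable[OF sy], of 0]) (use *[of "_ + m"] in \<open>simp del: coef.simps\<close>)
    show "(\<Sum>n. \<bar>coef m 0 r (n + m) * vbasis (n + m) x\<bar>) \<le> (\<Sum>n. (\<rho> * D) ^ (n + m) / real (n + m))"
      by (rule suminf_le[OF * sm sums_summable[OF sy]])
  qed
  also have "\<dots> = lnD - (\<Sum>n<m. (\<rho> * D) ^ n / n)" by (rule sums_unique[OF sy, symmetric])
  also have "\<dots> \<le> tail m"
    using ln_tail_bounds(2)[OF rhoD 0(2)] by (simp add: tail_def power_mult_distrib)
  finally show ?case by simp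
next
  case (Suc j)
  have x1: "\<bar>x\<bar> \<le> 1" using Suc.prems rho by simp
  \<comment> \<open>Composition without truncation: it separates the inherited error from the fresh
    one.\<close>
  define h where "h = (\<Sum>s\<in>S. Q r s * approx m j s (f r x))"
  have hc: "complex_of_real h = pushed m j r (of_real x)"
    by (simp add: h_def pushed_def cmob_of_real capprox_of_real)
  have "G (Suc j) r x - h = (\<Sum>s\<in>S. Q r s * (G j s (f r x) - approx m j s (f r x)))"
    by (simp add: G_Suc h_def sum_subtractf right_diff_distrib)
  also have "\<bar>\<dots>\<bar> \<le> tail m + lnD * ((1 + rhom m) ^ j - 1)"
    using Suc.prems by (intro abs_weighted_sum_le Q_nonneg Q_row Suc.IH f_bound x1) auto
  finally have 1: "\<bar>G (Suc j) r x - h\<bar> \<le> tail m + lnD * ((1 + rhom m) ^ j - 1)" .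
  have "cmod (pushed m j r (of_real x) - capprox m (Suc j) r (of_real x)) \<le> rhom m * (lnD * (1 + rhom m) ^ j)"
    using Suc.prems by (intro truncation_step(1) capprox_bound) auto
  then have "\<bar>h - approx m (Suc j) r x\<bar> \<le> rhom m * (lnD * (1 + rhom m) ^ j)"
    unfolding hc[symmetric] capprox_of_real by (simp flip: of_real_diff del: of_real_diff)
  then have "\<bar>G (Suc j) r x - approx m (Suc j) r x\<bar> \<le> tail m + lnD * ((1 + rhom m) ^ j - 1) + rhom m * (lnD * (1 + rhom m) ^ j)"
    using 1 by linarith
  then show ?case by (simp add: algebra_simps)
qed

text \<open>If \<open>\<pi> s = 0\<close> the quotients are \<open>0\<close> by the convention \<open>x / 0 = 0\<close>, but then
  stationarity makes all \<open>\<pi> r * Q r s\<close> vanish as well.\<close>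

lemma pi_weighted:
  assumes s: "s \<in> S"
  shows "\<pi> s * (\<Sum>r\<in>S. \<pi> r * Q r s / \<pi> s * g r) = (\<Sum>r\<in>S. \<pi> r * Q r s * g r)"
proof (cases "\<pi> s = 0")
  case True
  then have "\<forall>r\<in>S. \<pi> r * Q r s = 0"
    using pi_stat[OF s] sum_nonneg_eq_0_iff[OF fin, of "\<lambda>r. \<pi> r * Q r s"] s by (simp add: pi_nonneg Q_nonneg)
  then have "(\<Sum>r\<in>S. \<pi> r * Q r s * g r) = 0" by (intro sum.neutral) auto
  then show ?thesis using True by simp
next
  case False then show ?thesis by (simp add: sum_distrib_left)
qed

section \<open>Brackets of powers of the truncated operator\<close>

lemma pi_Tmm:
  "s \<in> S \<Longrightarrow> k < m \<Longrightarrow>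
    \<pi> s * Tmm S Q \<pi> B m u s k = (\<Sum>r\<in>S. \<pi> r * Q r s * (\<Sum>n<m. bcoef (B r) k n * u r n))"
  by (simp only: Tmm_def if_True pi_weighted)

lemma pi_seed:
  "s \<in> S \<Longrightarrow>
    \<pi> s * seed S Q \<pi> B s n = (\<Sum>r\<in>S. \<pi> r * Q r s * vvec (f r 0) (mob_ell (B r) 0) n)"
  by (simp only: seed_def pi_weighted)

text \<open>The bracket selects row 0, which holds the coefficients of \<open>G 0\<close>, and an
  application of the operator to \<open>u\<close> can be moved to a step of \<open>coef\<close> on
  the row; hence \<open>u\<close> is arbitrary in the induction. The weights of the time-reversed
  chain turn into \<open>Q r s\<close> when multiplied by \<open>\<pi> s\<close>.\<close>

lemma bracket0_Tmm_pow:
  assumes m: "1 \<le> m"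
  shows "bracket0 S \<pi> ((Tmm S Q \<pi> B m ^^ Suc l) u) = (\<Sum>r\<in>S. \<pi> r * (\<Sum>n<m. coef m l r n * u r n))"
proof (induction l arbitrary: u)
  case 0
  have "bracket0 S \<pi> (Tmm S Q \<pi> B m u) = (\<Sum>s\<in>S. \<Sum>r\<in>S. \<pi> r * Q r s * (\<Sum>n<m. bcoef (B r) 0 n * u r n))"
    unfolding bracket0_def using m by (intro sum.cong refl pi_Tmm) auto
  also have "\<dots> = (\<Sum>r\<in>S. \<Sum>s\<in>S. \<pi> r * Q r s * (\<Sum>n<m. bcoef (B r) 0 n * u r n))"
    by (rule sum.swap)
  also have "\<dots> = (\<Sum>r\<in>S. \<Sum>s\<in>S. Q r s * (\<pi> r * (\<Sum>n<m. bcoef (B r) 0 n * u r n)))"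
    by (simp add: mult_ac)
  also have "\<dots> = (\<Sum>r\<in>S. \<pi> r * (\<Sum>n<m. bcoef (B r) 0 n * u r n))"
    by (rule sum.cong) (auto simp: sum_distrib_right[symmetric] Q_row)
  also have "\<dots> = (\<Sum>r\<in>S. \<pi> r * (\<Sum>n<m. coef m 0 r n * u r n))"
  proof -
    have "bcoef (B r) 0 n = coef m 0 r n" for r n by (simp add: bcoef_def)
    then show ?thesis by (simp only:)
  qed
  finally show ?case by simp
next
  case (Suc l)
  have "bracket0 S \<pi> ((Tmm S Q \<pi> B m ^^ Suc (Suc l)) u) = bracket0 S \<pi> ((Tmm S Q \<pi> B m ^^ Suc l) (Tmm S Q \<pi> B m u))"
    by (subst funpow_Suc_right) simp
  also have "\<dots> = (\<Sum>s\<in>S. \<Sum>k<m. coef m l s k * (\<pi> s * Tmm S Q \<pi> B m u s k))"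
    unfolding Suc.IH by (simp add: sum_distrib_left mult_ac)
  also have "\<dots> = (\<Sum>s\<in>S. \<Sum>k<m. coef m l s k * (\<Sum>r\<in>S. \<pi> r * Q r s * (\<Sum>n<m. bcoef (B r) k n * u r n)))"
    by (intro sum.cong refl arg_cong2[where f="(*)"] pi_Tmm) auto
  also have "\<dots> = (\<Sum>s\<in>S. \<Sum>k<m. \<Sum>r\<in>S. \<Sum>n<m. \<pi> r * (Q r s * (coef m l s k * bcoef (B r) k n) * u r n))"
    by (simp add: sum_distrib_left mult_ac)
  also have "\<dots> = (\<Sum>r\<in>S. \<Sum>n<m. \<Sum>s\<in>S. \<Sum>k<m. \<pi> r * (Q r s * (coef m l s k * bcoef (B r) k n) * u r n))"
    (is "(\<Sum>s\<in>S. \<Sum>k<m. \<Sum>r\<in>S. \<Sum>n<m. ?g s k r n) = _")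
  proof -
    have "(\<Sum>s\<in>S. \<Sum>k<m. \<Sum>r\<in>S. \<Sum>n<m. ?g s k r n) = (\<Sum>s\<in>S. \<Sum>r\<in>S. \<Sum>k<m. \<Sum>n<m. ?g s k r n)"
      by (rule sum.cong[OF refl]) (rule sum.swap)
    also have "\<dots> = (\<Sum>r\<in>S. \<Sum>s\<in>S. \<Sum>k<m. \<Sum>n<m. ?g s k r n)"
      by (rule sum.swap)
    also have "\<dots> = (\<Sum>r\<in>S. \<Sum>s\<in>S. \<Sum>n<m. \<Sum>k<m. ?g s k r n)"
      by (rule sum.cong[OF refl], rule sum.cong[OF refl]) (rule sum.swap)
    also have "\<dots> = (\<Sum>r\<in>S. \<Sum>n<m. \<Sum>s\<in>S. \<Sum>k<m. ?g s k r n)"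
      by (rule sum.cong[OF refl]) (rule sum.swap)
    finally show ?thesis .
  qed
  also have "\<dots> = (\<Sum>r\<in>S. \<pi> r * (\<Sum>n<m. coef m (Suc l) r n * u r n))"
    by (simp add: sum_distrib_left sum_distrib_right)
  finally show ?case .
qed

text \<open>Pairing a row of coefficients with v(x; c) evaluates the corresponding function at x up
  to its constant. Subtracting the value at 0 accounts for the constant, since all basis functions
  vanish there. The result has the shape of \<open>e_diff\<close>.\<close>

lemma bracket0_Tmm_pow_seed:
  assumes m: "1 \<le> m"
  shows "bracket0 S \<pi> ((Tmm S Q \<pi> B m ^^ Suc l) (seed S Q \<pi> B)) =
    (\<Sum>p\<in>S \<times> S. \<pi> (fst p) * Q (fst p) (snd p) * (approx m l (snd p) (f (fst p) 0) - approx m l (snd p) 0))"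
proof -
  have "bracket0 S \<pi> ((Tmm S Q \<pi> B m ^^ Suc l) (seed S Q \<pi> B)) = (\<Sum>r\<in>S. \<Sum>n<m. coef m l r n * (\<pi> r * seed S Q \<pi> B r n))"
    unfolding bracket0_Tmm_pow[OF m] by (simp add: sum_distrib_left mult_ac)
  also have "\<dots> = (\<Sum>r\<in>S. \<Sum>n<m. coef m l r n * (\<Sum>q\<in>S. \<pi> q * Q q r * vvec (f q 0) (mob_ell (B q) 0) n))"
    by (intro sum.cong refl arg_cong2[where f="(*)"] pi_seed)
  also have "\<dots> = (\<Sum>r\<in>S. \<Sum>n<m. \<Sum>q\<in>S. \<pi> q * Q q r * (coef m l r n * vvec (f q 0) (mob_ell (B q) 0) n))"
    by (simp add: sum_distrib_left mult_ac)
  also have "\<dots> = (\<Sum>q\<in>S. \<Sum>r\<in>S. \<Sum>n<m. \<pi> q * Q q r * (coef m l r n * vvec (f q 0) (mob_ell (B q) 0) n))"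
  proof -
    have "(\<Sum>r\<in>S. \<Sum>n<m. \<Sum>q\<in>S. g r n q) = (\<Sum>q\<in>S. \<Sum>r\<in>S. \<Sum>n<m. g r n q)" for g :: "'s \<Rightarrow> nat \<Rightarrow> 's \<Rightarrow> real"
    proof -
      have "(\<Sum>r\<in>S. \<Sum>n<m. \<Sum>q\<in>S. g r n q) = (\<Sum>r\<in>S. \<Sum>q\<in>S. \<Sum>n<m. g r n q)"
        by (rule sum.cong[OF refl]) (rule sum.swap)
      also have "\<dots> = (\<Sum>q\<in>S. \<Sum>r\<in>S. \<Sum>n<m. g r n q)" by (rule sum.swap)
      finally show ?thesis .
    qed
    then show ?thesis .
  qed
  also have "\<dots> = (\<Sum>q\<in>S. \<Sum>r\<in>S. \<pi> q * Q q r * (approx m l r (f q 0) - approx m l r 0))"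
  proof (intro sum.cong refl)
    fix q r
    have v: "coef m l r n * vvec (f q 0) (mob_ell (B q) 0) n = coef m l r n * vbasis n (f q 0)" for n
      by (cases "n = 0") (simp_all add: coef_0 vvec_def vbasis_def)
    have z: "(\<Sum>n<m. coef m l r n * vbasis n (0::real)) = 0"
      by (rule sum.neutral) (auto simp: vbasis_def zero_power)
    show "(\<Sum>n<m. \<pi> q * Q q r * (coef m l r n * vvec (f q 0) (mob_ell (B q) 0) n)) =
        \<pi> q * Q q r * (approx m l r (f q 0) - approx m l r 0)"
      unfolding v sum_distrib_left[symmetric] approx_def z by simp
  qed
  finally show ?thesis by (simp add: sum.cartesian_product')
qed

text \<open>The purpose of entry 0 of the seed: the term \<open>l = 0\<close> supplies the initial
  value of the telescoping sum.\<close>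

lemma bracket0_seed: "bracket0 S \<pi> (seed S Q \<pi> B) = e 0"
proof -
  have "bracket0 S \<pi> (seed S Q \<pi> B) = (\<Sum>s\<in>S. \<Sum>r\<in>S. \<pi> r * Q r s * mob_ell (B r) 0)"
    unfolding bracket0_def by (intro sum.cong refl) (simp add: pi_seed vvec_def)
  also have "\<dots> = (\<Sum>r\<in>S. \<Sum>s\<in>S. Q r s * (\<pi> r * mob_ell (B r) 0))"
    by (subst sum.swap) (simp add: mult_ac)
  also have "\<dots> = e 0"
    unfolding e_def by (rule sum.cong) (auto simp: sum_distrib_right[symmetric] Q_row H_def)
  finally show ?thesis .
qed

lemma bracket0_error:
  assumes m: "1 \<le> m"
  shows "\<bar>(e (Suc l) - e l) - bracket0 S \<pi> ((Tmm S Q \<pi> B m ^^ Suc l) (seed S Q \<pi> B))\<bar>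
    \<le> 2 * (tail m + lnD * ((1 + rhom m) ^ l - 1))"
proof -
  have "(e (Suc l) - e l) - bracket0 S \<pi> ((Tmm S Q \<pi> B m ^^ Suc l) (seed S Q \<pi> B)) =
    (\<Sum>p\<in>S \<times> S. \<pi> (fst p) * Q (fst p) (snd p) *
      ((G l (snd p) (f (fst p) 0) - approx m l (snd p) (f (fst p) 0)) - (G l (snd p) 0 - approx m l (snd p) 0)))"
    unfolding bracket0_Tmm_pow_seed[OF m] e_diff H_diff sum_subtractf[symmetric]
    by (intro sum.cong refl) (simp add: algebra_simps)
  also have "\<bar>\<dots>\<bar> \<le> 2 * (tail m + lnD * ((1 + rhom m) ^ l - 1))"
  proof (rule abs_weighted_sum_le[OF pi_Q_weights])
    fix p assume p: "p \<in> S \<times> S"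
    then have "\<bar>f (fst p) 0\<bar> \<le> \<rho>" by (intro f_bound) auto
    then show "\<bar>(G l (snd p) (f (fst p) 0) - approx m l (snd p) (f (fst p) 0)) - (G l (snd p) 0 - approx m l (snd p) 0)\<bar>
      \<le> 2 * (tail m + lnD * ((1 + rhom m) ^ l - 1))"
      using approx_error[of "snd p" m "f (fst p) 0" l] approx_error[of "snd p" m 0 l] m p rho by auto
  qed auto
  finally show ?thesis .
qed

theorem truncated_sum_error:
  assumes lim: "(\<lambda>N. (\<Sum>k<N. e k) / real N) \<longlonglongrightarrow> \<Lambda>" and n: "1 \<le> n" and m: "1 \<le> m"
  shows "\<bar>\<Lambda> - (\<Sum>l<n. bracket0 S \<pi> ((Tmm S Q \<pi> B m ^^ l) (seed S Q \<pi> B)))\<bar>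
    \<le> E * \<rho> ^ (n - 1) + 2 * lnD * (((1 + rhom m) ^ (n - 1) - 1 - real (n - 1) * rhom m) / rhom m)
      + 2 * real (n - 1) * \<rho> ^ m * D ^ m / (m * (1 - \<rho> * D))"
proof -
  define j where "j = n - 1"
  have nj: "n = Suc j" using n by (simp add: j_def)
  let ?b = "\<lambda>l. bracket0 S \<pi> ((Tmm S Q \<pi> B m ^^ l) (seed S Q \<pi> B))"
  define R where "R = rhom m"
  have R: "R > 0" using rho Kconst_pos by (simp add: R_def)
  define x where "x = (\<Sum>l<n. ?b l)"
  define b where "b = 2 * (real j * tail m + lnD * (((1 + R) ^ j - 1) / R - real j))"
  have "x = e 0 + (\<Sum>l<j. ?b (Suc l))"
    unfolding nj x_def by (subst sum.lessThan_Suc_shift) (simp add: bracket0_seed)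
  moreover have "e j = e 0 + (\<Sum>l<j. e (Suc l) - e l)"
    by (simp add: sum_lessThan_telescope)
  ultimately have "e j - x = (\<Sum>l<j. (e (Suc l) - e l) - ?b (Suc l))"
    by (simp add: sum_subtractf)
  moreover have "\<bar>\<Sum>l<j. (e (Suc l) - e l) - ?b (Suc l)\<bar> \<le> (\<Sum>l<j. 2 * (tail m + lnD * ((1 + R) ^ l - 1)))"
    unfolding R_def by (rule order_trans[OF sum_abs sum_mono]) (rule bracket0_error[OF m])
  moreover have "(\<Sum>l<j. 2 * (tail m + lnD * ((1 + R) ^ l - 1))) = b"
    unfolding b_def by (rule sum_geometric_excess) (use R in simp)
  ultimately have "\<bar>e j - x\<bar> \<le> b" by linarith
  moreover have "\<bar>\<Lambda> - e j\<bar> \<le> E * \<rho> ^ j"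
    by (rule cesaro_limit_bound[OF lim e_tail])
  ultimately have "\<bar>\<Lambda> - x\<bar> \<le> E * \<rho> ^ j + b" by linarith
  moreover have "b = 2 * lnD * (((1 + R) ^ j - 1 - real j * R) / R) + 2 * real j * \<rho> ^ m * D ^ m / (m * (1 - \<rho> * D))"
  proof -
    have "((1 + R) ^ j - 1) / R - real j = ((1 + R) ^ j - 1 - real j * R) / R"
      using R by (simp add: diff_divide_distrib)
    then have "b = 2 * (real j * tail m + lnD * (((1 + R) ^ j - 1 - real j * R) / R))"
      unfolding b_def by (rule arg_cong)
    also have "\<dots> = 2 * lnD * (((1 + R) ^ j - 1 - real j * R) / R) + 2 * real j * tail m"
      by (simp only: distrib_left mult.assoc add.commute)
    also have "2 * real j * tail m = 2 * real j * \<rho> ^ m * D ^ m / (m * (1 - \<rho> * D))"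
      by (simp add: tail_def)
    finally show ?thesis .
  qed
  ultimately show ?thesis unfolding R_def j_def x_def by (simp only: add.assoc)
qed

end

section \<open>Lyapunov exponents as limits of path means\<close>

definition lnorm :: "real^2^2 \<Rightarrow> real" where
  "lnorm M = ln (onorm (\<lambda>v. M *v v))"

text \<open>The matrix of a state is applied on leaving it, so a path of \<open>n\<close> steps
  visits n + 1 states and the matrix of the last one stays out, as in the product A_{x_{n-1}} ...
  A_{x_0}.\<close>

fun path_mean :: "'s set \<Rightarrow> ('s \<Rightarrow> 's \<Rightarrow> real) \<Rightarrow> ('s \<Rightarrow> real^2^2) \<Rightarrow> (real^2^2 \<Rightarrow> real) \<Rightarrow> nat \<Rightarrow> 's \<Rightarrow> real^2^2 \<Rightarrow> real" where
  "path_mean S Q B F 0 s M = F M"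
| "path_mean S Q B F (Suc n) s M = (\<Sum>s'\<in>S. Q s s' * path_mean S Q B F n s' (B s ** M))"

lemma mprodf_Suc_shift: "mprodf A x (Suc n) = mprodf A (\<lambda>k. x (Suc k)) n ** A (x 0)"
  by (induction n) (simp_all add: matrix_mul_assoc)

lemma mprodf_cong: "(\<And>k. k < n \<Longrightarrow> x k = y k) \<Longrightarrow> mprodf A x n = mprodf A y n"
  by (induction n) auto

lemma finite_words: "finite {w :: 'a::finite list. length w = n}"
  using finite_lists_length_eq[of "UNIV :: 'a set" n] by simp

lemma sum_lists_Suc:
  fixes g :: "'a list \<Rightarrow> real"
  shows "(\<Sum>w\<in>{w. set w \<subseteq> S \<and> length w = Suc n}. g w) = (\<Sum>k\<in>S. \<Sum>w\<in>{w. set w \<subseteq> S \<and> length w = n}. g (k # w))"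
proof -
  have "(\<Sum>k\<in>S. \<Sum>w\<in>{w. set w \<subseteq> S \<and> length w = n}. g (k # w))
    = (\<Sum>p\<in>S \<times> {w. set w \<subseteq> S \<and> length w = n}. g (fst p # snd p))"
    by (simp add: sum.cartesian_product')
  also have "\<dots> = (\<Sum>w\<in>{w. set w \<subseteq> S \<and> length w = Suc n}. g w)"
    by (rule sum.reindex_bij_witness[of _ "\<lambda>w. (hd w, tl w)" "\<lambda>p. fst p # snd p"]) (auto simp: length_Suc_conv)
  finally show ?thesis by simp
qed

lemma sum_words_Suc:
  fixes g :: "'a::finite list \<Rightarrow> real"
  shows "(\<Sum>w\<in>{w. length w = Suc n}. g w) = (\<Sum>k\<in>UNIV. \<Sum>w\<in>{w. length w = n}. g (k # w))"
  using sum_lists_Suc[of g UNIV n] by simp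

lemma path_mean_words:
  "path_mean (UNIV :: 'x::finite set) P A F n j M =
    (\<Sum>w\<in>{w. length w = n}. (\<Prod>k<n. P ((j # w) ! k) ((j # w) ! Suc k)) * F (mprodf A (\<lambda>k. (j # w) ! k) n ** M))"
proof (induction n arbitrary: j M)
  case (Suc n)
  have "(\<Prod>k<Suc n. P ((j # i # w) ! k) ((j # i # w) ! Suc k)) = P j i * (\<Prod>k<n. P ((i # w) ! k) ((i # w) ! Suc k))" for i w
    by (subst prod.lessThan_Suc_shift) simp
  moreover have "mprodf A (\<lambda>k. (j # i # w) ! k) (Suc n) ** M = mprodf A (\<lambda>k. (i # w) ! k) n ** (A j ** M)" for i w
    unfolding mprodf_Suc_shift by (simp add: matrix_mul_assoc)
  ultimately show ?case
    unfolding sum_words_Suc path_mean.simps Suc.IH by (simp only: sum_distrib_left mult.assoc)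
qed simp

text \<open>Provides the dominating constant for the convergence theorem. As there are finitely many
  invertible matrices, each step stretches vectors at least by \<open>b0\<close> and at most by
  \<open>B\<close>.\<close>

lemma invertible_growth_bounds:
  fixes A :: "'x::finite \<Rightarrow> real^2^2"
  assumes "\<forall>i. invertible (A i)"
  obtains c where "0 \<le> c" "\<And>x n. \<bar>lnorm (mprodf A x n)\<bar> \<le> real n * c"
proof -
  have bl: "bounded_linear (\<lambda>v. M *v v)" for M :: "real^2^2"
    by (rule matrix_vector_mul_bounded_linear)
  have "\<exists>b. b > 0 \<and> (\<forall>v. b * norm v \<le> norm (A i *v v))" for i
  proof -
    have "inj ((*v) (A i))" using assms by (metis inj_matrix_vector_mult)
    then show ?thesis using linear_inj_bounded_below_pos[of "(*v) (A i)"] by (metis matrix_vector_mul_linear)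
  qed
  then obtain b where b: "\<And>i. b i > 0" "\<And>i v. b i * norm v \<le> norm (A i *v v)" by metis
  define b0 where "b0 = Min (range b)"
  define B where "B = Max (insert 1 (range (\<lambda>i. onorm (\<lambda>v. A i *v v))))"
  have b0: "0 < b0" "\<And>i. b0 \<le> b i" using b by (auto simp: b0_def)
  have B: "1 \<le> B" "\<And>i. onorm (\<lambda>v. A i *v v) \<le> B" unfolding B_def by (rule Max_ge; simp)+
  have lo: "b0 ^ n * norm v \<le> norm (mprodf A x n *v v)" for x n v
  proof (induction n)
    case (Suc n)
    have "b0 ^ Suc n * norm v \<le> b0 * norm (mprodf A x n *v v)"
      using Suc b0 by (simp add: mult_left_mono mult.assoc)
    also have "\<dots> \<le> b (x n) * norm (mprodf A x n *v v)" using b0 by (intro mult_right_mono) auto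
    also have "\<dots> \<le> norm (A (x n) *v (mprodf A x n *v v))" by (rule b)
    finally show ?case by (simp add: matrix_vector_mul_assoc)
  qed simp
  have hi: "onorm (\<lambda>v. mprodf A x n *v v) \<le> B ^ n" for x n
  proof (induction n)
    case 0 show ?case using onorm_id_le by (simp add: id_def)
  next
    case (Suc n)
    have "onorm (\<lambda>v. mprodf A x (Suc n) *v v) \<le> onorm (\<lambda>v. A (x n) *v v) * onorm (\<lambda>v. mprodf A x n *v v)"
      using onorm_compose[OF bl[of "A (x n)"] bl[of "mprodf A x n"]] by (simp add: o_def matrix_vector_mul_assoc)
    also have "\<dots> \<le> B * B ^ n" using Suc B by (intro mult_mono onorm_pos_le bl) auto
    finally show ?case by simp
  qed
  have lo': "b0 ^ n \<le> onorm (\<lambda>v. mprodf A x n *v v)" for x n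
  proof -
    have "b0 ^ n * norm (axis 1 1 :: real^2) \<le> onorm (\<lambda>v. mprodf A x n *v v) * norm (axis 1 1 :: real^2)"
      by (rule order_trans[OF lo onorm[OF bl]])
    then show ?thesis by simp
  qed
  have "\<bar>lnorm (mprodf A x n)\<bar> \<le> real n * (\<bar>ln b0\<bar> + \<bar>ln B\<bar>)" for x n
  proof -
    have p1: "0 < b0 ^ n" using b0(1) by simp
    have p2: "0 < onorm (\<lambda>v. mprodf A x n *v v)" by (rule less_le_trans[OF p1 lo'])
    have "ln (b0 ^ n) \<le> lnorm (mprodf A x n)" unfolding lnorm_def by (rule ln_mono[OF lo' p1])
    moreover have "lnorm (mprodf A x n) \<le> ln (B ^ n)" unfolding lnorm_def by (rule ln_mono[OF hi p2])
    moreover have "ln (b0 ^ n) = real n * ln b0" "ln (B ^ n) = real n * ln B"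
      using b0(1) B(1) by (simp_all add: ln_realpow)
    moreover have "real n * (- \<bar>ln b0\<bar>) \<le> real n * ln b0" "real n * ln B \<le> real n * \<bar>ln B\<bar>"
      by (rule mult_left_mono; simp)+
    moreover have "0 \<le> real n * \<bar>ln b0\<bar>" "0 \<le> real n * \<bar>ln B\<bar>" by simp_all
    ultimately show ?thesis unfolding distrib_left abs_le_iff by linarith
  qed
  then show ?thesis by (intro that[of "\<bar>ln b0\<bar> + \<bar>ln B\<bar>"]) auto
qed

lemma stationary_positive:
  assumes stoch: "row_stochastic P" and irr: "irreducible_mat P" and stat: "stationary_vec P p"
  shows "p j > 0"
proof -
  have nn: "p i \<ge> 0" "P i k \<ge> 0" for i k using stat stoch by (auto simp: stationary_vec_def row_stochastic_def)
  have "\<exists>i. p i > 0"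
  proof (rule ccontr)
    assume "\<nexists>i. p i > 0"
    then have "p i = 0" for i using nn(1)[of i] by (metis less_eq_real_def)
    then show False using stat by (simp add: stationary_vec_def)
  qed
  then obtain i where i: "p i > 0" by auto
  have "(i, j) \<in> {(a, b). P a b > 0}\<^sup>*" using irr by (auto simp: irreducible_mat_def)
  then show ?thesis
  proof (induction rule: rtrancl_induct)
    case (step k l)
    then have "0 < p k * P k l" by simp
    also have "\<dots> \<le> (\<Sum>i\<in>UNIV. p i * P i l)" by (rule member_le_sum) (auto simp: nn)
    also have "\<dots> = p l" using stat by (simp add: stationary_vec_def)
    finally show ?case .
  qed (rule i)
qed

lemma integral_cylinder_function:
  fixes \<mu> :: "'x::finite stream measure" and g :: "'x list \<Rightarrow> real"
  assumes markov: "markov_measure P p \<mu>"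
  shows "(LINT \<omega>|\<mu>. g (stake n \<omega>)) = (\<Sum>w\<in>{w. length w = n}. measure \<mu> {\<omega> \<in> space \<mu>. stake n \<omega> = w} * g w)"
    and "(\<lambda>\<omega>. g (stake n \<omega>)) \<in> borel_measurable \<mu>"
proof -
  interpret prob_space \<mu> using markov by (simp add: markov_measure_def)
  have sets: "sets \<mu> = sets (stream_space (count_space UNIV))" using markov by (simp add: markov_measure_def)
  have st: "stake n \<in> measurable \<mu> (count_space UNIV)"
    using measurable_stake measurable_cong_sets[OF sets refl] by blast
  show "(\<lambda>\<omega>. g (stake n \<omega>)) \<in> borel_measurable \<mu>"
    by (rule measurable_compose[OF st]) simp
  have cyl: "{\<omega> \<in> space \<mu>. stake n \<omega> = w} \<in> sets \<mu>" for w
    using measurable_sets[OF st, of "{w}"] by (simp add: vimage_def Int_def conj_commute)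
  have "g (stake n \<omega>) = (\<Sum>w\<in>{w. length w = n}. g w * indicator {\<omega> \<in> space \<mu>. stake n \<omega> = w} \<omega>)"
    if "\<omega> \<in> space \<mu>" for \<omega>
  proof -
    have "(\<Sum>w\<in>{w. length w = n}. g w * indicator {\<omega> \<in> space \<mu>. stake n \<omega> = w} \<omega>)
      = (\<Sum>w\<in>{stake n \<omega>}. g w * indicator {\<omega> \<in> space \<mu>. stake n \<omega> = w} \<omega>)"
      by (rule sum.mono_neutral_right) (auto simp: finite_words indicator_def)
    then show ?thesis using that by (simp add: indicator_def)
  qed
  then have "(LINT \<omega>|\<mu>. g (stake n \<omega>)) = (LINT \<omega>|\<mu>. (\<Sum>w\<in>{w. length w = n}. g w * indicator {\<omega> \<in> space \<mu>. stake n \<omega> = w} \<omega>))"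
    by (intro Bochner_Integration.integral_cong) auto
  also have "\<dots> = (\<Sum>w\<in>{w. length w = n}. LINT \<omega>|\<mu>. g w * indicator {\<omega> \<in> space \<mu>. stake n \<omega> = w} \<omega>)"
    by (rule Bochner_Integration.integral_sum) (use cyl in \<open>auto simp: emeasure_eq_measure intro!: integrable_mult_right integrable_real_indicator\<close>)
  also have "\<dots> = (\<Sum>w\<in>{w. length w = n}. measure \<mu> {\<omega> \<in> space \<mu>. stake n \<omega> = w} * g w)"
    using cyl by (intro sum.cong) (auto simp: Int_def conj_commute conj_left_commute)
  finally show "(LINT \<omega>|\<mu>. g (stake n \<omega>)) = (\<Sum>w\<in>{w. length w = n}. measure \<mu> {\<omega> \<in> space \<mu>. stake n \<omega> = w} * g w)" .
qed

text \<open>The almost sure limit is integrated over the event that the first symbol is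
  \<open>j\<close>. The integrand depends on finitely many coordinates, so its integral is a finite
  sum over words; dividing by p j > 0 removes the initial distribution.\<close>

lemma path_mean_tendsto_lyapunov:
  fixes A :: "'x::finite \<Rightarrow> real^2^2"
  assumes invA: "\<forall>i. invertible (A i)"
    and stoch: "row_stochastic P" and irr: "irreducible_mat P" and stat: "stationary_vec P p"
    and markov: "markov_measure P p \<mu>" and lyap: "lyapunov_value A \<mu> lam"
  shows "(\<lambda>n. path_mean UNIV P A lnorm n j (mat 1) / real n) \<longlonglongrightarrow> lam"
proof -
  interpret prob_space \<mu> using markov by (simp add: markov_measure_def)
  have pj: "p j > 0" by (rule stationary_positive[OF stoch irr stat])
  obtain c where c: "0 \<le> c" "\<And>x n. \<bar>lnorm (mprodf A x n)\<bar> \<le> real n * c"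
    using invertible_growth_bounds[OF invA] by blast
  \<comment> \<open>It is evaluated on words of n + 1 letters, since \<open>path_mean\<close> also
    sums over a last state whose matrix is not applied.\<close>
  define g where "g n w = (if hd w = j then lnorm (mprodf A (\<lambda>k. w ! k) n) / real n else 0)" for n w
  have gb: "\<bar>g n w\<bar> \<le> c" for n w
  proof (cases "n = 0")
    case False
    then have "\<bar>lnorm (mprodf A (\<lambda>k. w ! k) n) / real n\<bar> \<le> c"
      using c(2)[of "\<lambda>k. w ! k" n] by (simp add: abs_divide divide_le_eq mult.commute)
    then show ?thesis using c(1) by (simp add: g_def)
  qed (use c(1) in \<open>simp add: g_def\<close>)
  have gst: "g n (stake (Suc n) \<omega>) = (if \<omega> !! 0 = j then lnorm (mprodf A (snth \<omega>) n) / real n else 0)" for n \<omega>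
  proof -
    have "mprodf A (\<lambda>k. stake (Suc n) \<omega> ! k) n = mprodf A (snth \<omega>) n"
      by (rule mprodf_cong) (simp del: stake.simps)
    moreover have "hd (stake (Suc n) \<omega>) = \<omega> !! 0" by simp
    ultimately show ?thesis by (simp add: g_def del: stake.simps)
  qed
  have int: "(LINT \<omega>|\<mu>. g n (stake (Suc n) \<omega>)) = p j * (path_mean UNIV P A lnorm n j (mat 1) / real n)" for n
  proof -
    have m: "measure \<mu> {\<omega> \<in> space \<mu>. stake (Suc n) \<omega> = k # w} = p k * (\<Prod>l<n. P ((k # w) ! l) ((k # w) ! Suc l))"
      if "length w = n" for k w
    proof -
      have "\<forall>w. w \<noteq> [] \<longrightarrow> measure \<mu> {\<omega> \<in> space \<mu>. stake (length w) \<omega> = w} = p (hd w) * (\<Prod>k<length w - 1. P (w ! k) (w ! Suc k))"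
        using markov by (simp add: markov_measure_def)
      from this[rule_format, of "k # w"] show ?thesis using that by simp
    qed
    have "(LINT \<omega>|\<mu>. g n (stake (Suc n) \<omega>)) =
      (\<Sum>k\<in>UNIV. \<Sum>w\<in>{w. length w = n}. measure \<mu> {\<omega> \<in> space \<mu>. stake (Suc n) \<omega> = k # w} * g n (k # w))"
      unfolding integral_cylinder_function(1)[OF markov] by (rule sum_words_Suc)
    also have "\<dots> = (\<Sum>k\<in>UNIV. if k = j then \<Sum>w\<in>{w. length w = n}. measure \<mu> {\<omega> \<in> space \<mu>. stake (Suc n) \<omega> = j # w} * g n (j # w) else 0)"
      by (intro sum.cong) (auto simp: g_def)
    also have "\<dots> = (\<Sum>w\<in>{w. length w = n}. measure \<mu> {\<omega> \<in> space \<mu>. stake (Suc n) \<omega> = j # w} * g n (j # w))"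
      by simp
    also have "\<dots> = (\<Sum>w\<in>{w. length w = n}. p j * ((\<Prod>l<n. P ((j # w) ! l) ((j # w) ! Suc l)) * lnorm (mprodf A (\<lambda>k. (j # w) ! k) n ** mat 1) / real n))"
      by (intro sum.cong refl) (simp add: m g_def del: stake.simps)
    also have "\<dots> = p j * (path_mean UNIV P A lnorm n j (mat 1) / real n)"
      by (simp only: path_mean_words sum_distrib_left sum_divide_distrib)
    finally show ?thesis .
  qed
  have lim: "(\<lambda>n. LINT \<omega>|\<mu>. g n (stake (Suc n) \<omega>)) \<longlonglongrightarrow> (LINT \<omega>|\<mu>. (if hd (stake 1 \<omega>) = j then lam else 0))"
  proof (rule integral_dominated_convergence[where w="\<lambda>_. c"])
    show "(\<lambda>\<omega>. if hd (stake 1 \<omega>) = j then lam else 0) \<in> borel_measurable \<mu>"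
      by (rule integral_cylinder_function(2)[OF markov, of "\<lambda>w. if hd w = j then lam else 0"])
    show "(\<lambda>\<omega>. g n (stake (Suc n) \<omega>)) \<in> borel_measurable \<mu>" for n
      by (rule integral_cylinder_function(2)[OF markov])
    show "AE \<omega> in \<mu>. (\<lambda>n. g n (stake (Suc n) \<omega>)) \<longlonglongrightarrow> (if hd (stake 1 \<omega>) = j then lam else 0)"
      using lyap unfolding lyapunov_value_def lnorm_def[symmetric] gst
      by (rule AE_mp) (auto simp: lnorm_def)
    show "AE \<omega> in \<mu>. norm (g n (stake (Suc n) \<omega>)) \<le> c" for n
      using gb by simp
  qed simp
  have "(LINT \<omega>|\<mu>. (if hd (stake 1 \<omega>) = j then lam else 0)) = p j * lam"
  proof -
    have "measure \<mu> {\<omega> \<in> space \<mu>. stake 1 \<omega> = [k]} = p k" for k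
    proof -
      have "\<forall>w. w \<noteq> [] \<longrightarrow> measure \<mu> {\<omega> \<in> space \<mu>. stake (length w) \<omega> = w} = p (hd w) * (\<Prod>k<length w - 1. P (w ! k) (w ! Suc k))"
        using markov by (simp add: markov_measure_def)
      from this[rule_format, of "[k]"] show ?thesis by simp
    qed
    moreover have "(LINT \<omega>|\<mu>. (if hd (stake 1 \<omega>) = j then lam else 0)) = 
       (\<Sum>k\<in>UNIV. \<Sum>w\<in>{w. length w = 0}. measure \<mu> {\<omega> \<in> space \<mu>. stake 1 \<omega> = k # w} * (if hd (k # w) = j then lam else 0))"
      unfolding integral_cylinder_function(1)[OF markov, of "\<lambda>w. if hd w = j then lam else 0"]
      using sum_words_Suc[of "\<lambda>w. measure \<mu> {\<omega> \<in> space \<mu>. stake 1 \<omega> = w} * (if hd w = j then lam else 0)" 0] by simp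
    ultimately show ?thesis by (simp add: if_distrib cong: if_cong)
  qed
  with lim have "(\<lambda>n. p j * (path_mean UNIV P A lnorm n j (mat 1) / real n)) \<longlonglongrightarrow> p j * lam"
    unfolding int by simp
  from tendsto_divide[OF this tendsto_const[of "p j"]] show ?thesis using pj by simp
qed

section \<open>Multicones and positive cocycles\<close>

lemma matrix_inv_inverse:
  assumes "invertible M"
  shows "matrix_inv M ** M = mat 1" "M ** matrix_inv M = mat 1"
  using someI_ex[of "\<lambda>M'. M ** M' = mat 1 \<and> M' ** M = mat 1"] assms
  unfolding matrix_inv_def invertible_def by auto

lemma mat2_nth:
  fixes X :: "real^2^2"
  shows "(X ** Y) $ i $ j = X $ i $ 1 * Y $ 1 $ j + X $ i $ 2 * Y $ 2 $ j"
    and "(X *v v) $ i = X $ i $ 1 * v $ 1 + X $ i $ 2 * v $ 2"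
  by (simp_all add: matrix_matrix_mult_def matrix_vector_mult_def sum_2)

lemma vec2_nth [simp]: "vec2 s t $ 1 = s" "vec2 s t $ 2 = t"
  by (simp_all add: vec2_def)

lemma matrix_vector_neg: "X *v (- y) = - (X *v (y :: real^2))" for X :: "real^2^2"
  using matrix_vector_mult_scaleR[of X "-1" y] by simp

definition same_sign :: "real^2 \<Rightarrow> bool" where
  "same_sign y \<longleftrightarrow> (y $ 1 > 0 \<and> y $ 2 > 0) \<or> (y $ 1 < 0 \<and> y $ 2 < 0)"

lemma dcone_iff:
  assumes "invertible L"
  shows "v \<in> dcone L \<longleftrightarrow> same_sign (matrix_inv L *v v)"
proof
  have inv: "matrix_inv L *v (L *v x) = x" "L *v (matrix_inv L *v x) = x" for x
    using matrix_inv_inverse[OF assms] by (simp_all add: matrix_vector_mul_assoc)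
  {
    assume "v \<in> dcone L"
    then obtain s t where st: "s > 0" "t > 0" "v = L *v vec2 s t \<or> v = - (L *v vec2 s t)" by (auto simp: dcone_def)
    then have "v = L *v vec2 s t \<or> v = L *v (- vec2 s t)" by (simp add: matrix_vector_neg)
    then have "matrix_inv L *v v = vec2 s t \<or> matrix_inv L *v v = - vec2 s t" using inv(1) by auto
    then show "same_sign (matrix_inv L *v v)" using st by (auto simp: same_sign_def)
  next
    assume a: "same_sign (matrix_inv L *v v)"
    define y where "y = matrix_inv L *v v"
    have y: "v = L *v y" by (simp add: y_def inv)
    show "v \<in> dcone L"
    proof (cases "y $ 1 > 0")
      case True
      then have "y = vec2 (y $ 1) (y $ 2)" "y $ 2 > 0" using a by (auto simp: vec_eq_iff forall_2 same_sign_def y_def)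
      then show ?thesis unfolding dcone_def using True y by fastforce
    next
      case False
      then have n: "y $ 1 < 0" "y $ 2 < 0" using a by (auto simp: same_sign_def y_def)
      have "y = - vec2 (- (y $ 1)) (- (y $ 2))" by (simp add: vec_eq_iff forall_2)
      then have "v = - (L *v vec2 (- (y $ 1)) (- (y $ 2)))" by (metis y matrix_vector_neg)
      then show ?thesis unfolding dcone_def using n
        by (intro CollectI exI[of _ "- (y $ 1)"] exI[of _ "- (y $ 2)"]) auto
    qed
  }
qed

lemma open_dcone:
  assumes "invertible L"
  shows "open (dcone L)"
proof -
  have "dcone L = {v. (matrix_inv L *v v) $ 1 > 0 \<and> (matrix_inv L *v v) $ 2 > 0} \<union>
      {v. (matrix_inv L *v v) $ 1 < 0 \<and> (matrix_inv L *v v) $ 2 < 0}"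
    by (auto simp: dcone_iff[OF assms] same_sign_def)
  also have "open \<dots>"
    by (intro open_Un open_Collect_conj open_Collect_less continuous_intros)
  finally show ?thesis .
qed

lemma dcone_scaleR:
  assumes "invertible L" "v \<in> dcone L" "c \<noteq> 0"
  shows "c *\<^sub>R v \<in> dcone L"
proof -
  have "same_sign (c *\<^sub>R y)" if "same_sign y" for y
    using that assms(3) by (cases "c > 0") (auto simp: same_sign_def zero_less_mult_iff mult_less_0_iff)
  then show ?thesis using assms by (simp add: dcone_iff matrix_vector_mult_scaleR)
qed

lemma onorm_matrix_mult: "onorm ((*v) (X ** Y)) \<le> onorm ((*v) X) * onorm ((*v) (Y :: real^2^2))" for X :: "real^2^2"
  using onorm_compose[OF matrix_vector_mul_bounded_linear[of X] matrix_vector_mul_bounded_linear[of Y]]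
  by (simp add: o_def matrix_vector_mul_assoc)

section \<open>Norms and entry sums of nonnegative matrices\<close>

lemma onorm_matrix_nonneg: "0 \<le> onorm ((*v) (X :: real^2^2))"
  by (rule onorm_pos_le[OF matrix_vector_mul_bounded_linear])

lemma onorm_matrix_scaleR: "onorm ((*v) (c *\<^sub>R (X :: real^2^2))) = \<bar>c\<bar> * onorm ((*v) X)"
  using onorm_scaleR[OF matrix_vector_mul_bounded_linear[of X], of c] by (simp add: scaleR_matrix_vector_assoc)

text \<open>The logarithm of the size s + t of M (1, 1); the vector (1, 1) corresponds to the point
  x = 0.\<close>

definition lsum :: "real^2^2 \<Rightarrow> real" where
  "lsum M = ln (M $ 1 $ 1 + M $ 1 $ 2 + (M $ 2 $ 1 + M $ 2 $ 2))"

text \<open>Weaker than positivity, in order to include the identity with which all products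
  start.\<close>

definition nonneg_rows :: "real^2^2 \<Rightarrow> bool" where
  "nonneg_rows M \<longleftrightarrow> (\<forall>i j. 0 \<le> M $ i $ j) \<and> (\<forall>i. 0 < M $ i $ 1 + M $ i $ 2)"

lemma nonneg_rows_mat_1: "nonneg_rows (mat 1)"
  by (auto simp: nonneg_rows_def mat_def forall_2)

lemma nonneg_rows_mult:
  assumes "\<And>i j. X $ i $ j > 0" "nonneg_rows M"
  shows "nonneg_rows (X ** M)"
proof -
  have M: "0 \<le> M $ i $ j" "0 < M $ i $ 1 + M $ i $ 2" for i j using assms(2) by (auto simp: nonneg_rows_def)
  have "0 < X $ i $ 1 * (M $ 1 $ 1 + M $ 1 $ 2) + X $ i $ 2 * (M $ 2 $ 1 + M $ 2 $ 2)" for i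
    by (rule add_pos_pos[OF mult_pos_pos[OF assms(1) M(2)[of 1]] mult_pos_pos[OF assms(1) M(2)[of 2]]])
  moreover have "0 \<le> X $ i $ j" for i j using assms(1)[of i j] by simp
  ultimately show ?thesis using M(1)
    by (auto simp: nonneg_rows_def mat2_nth algebra_simps intro!: add_nonneg_nonneg mult_nonneg_nonneg)
qed

text \<open>For nonnegative entries the entry sum and the norm agree up to a factor 4, and the
  changes of basis \<open>X\<close> and \<open>Y\<close> cost factors that do not depend on
  \<open>M\<close>.\<close>

lemma lsum_lnorm_compare:
  assumes M: "nonneg_rows M" and N: "N = \<sigma> *\<^sub>R (X ** M ** Y)" and \<sigma>: "\<bar>\<sigma>\<bar> = 1"
    and X: "X' ** X = mat 1" and Y: "Y ** Y' = mat 1"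
  shows "\<bar>lsum M - lnorm N\<bar> \<le> ln 4 + \<bar>ln (onorm ((*v) X))\<bar> + \<bar>ln (onorm ((*v) X'))\<bar> + \<bar>ln (onorm ((*v) Y))\<bar> + \<bar>ln (onorm ((*v) Y'))\<bar>"
proof -
  define s where "s = M $ 1 $ 1 + M $ 1 $ 2 + (M $ 2 $ 1 + M $ 2 $ 2)"
  let ?n = "\<lambda>X::real^2^2. onorm ((*v) X)"
  have Mnn: "0 \<le> M $ i $ j" "0 < M $ i $ 1 + M $ i $ 2" for i j using M by (auto simp: nonneg_rows_def)
  have s: "s > 0" using Mnn(2)[of 1] Mnn(2)[of 2] by (simp add: s_def)
  have n1: "?n M \<le> s"
    using onorm_le_matrix_component_sum[of M] Mnn(1) by (simp add: s_def sum_2)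
  have n2: "s \<le> 4 * ?n M"
    using matrix_component_le_onorm[of M 1 1] matrix_component_le_onorm[of M 1 2]
      matrix_component_le_onorm[of M 2 1] matrix_component_le_onorm[of M 2 2] by (simp add: s_def)
  have nM: "?n M > 0" using s n2 by linarith
  have "?n N = ?n (X ** M ** Y)" unfolding N onorm_matrix_scaleR using \<sigma> by simp
  also have "\<dots> \<le> ?n (X ** M) * ?n Y" by (rule onorm_matrix_mult)
  also have "\<dots> \<le> ?n X * ?n M * ?n Y" by (intro mult_right_mono onorm_matrix_mult onorm_matrix_nonneg)
  finally have up: "?n N \<le> ?n X * ?n M * ?n Y" .
  have sq: "\<sigma> * \<sigma> = 1" using \<sigma> by (metis abs_mult_self_eq mult_1)
  have "X' ** N ** Y' = \<sigma> *\<^sub>R (X' ** X ** M ** (Y ** Y'))"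
    unfolding N by (simp add: matrix_scalar_ac scalar_matrix_assoc[symmetric] matrix_mul_assoc)
  then have "M = \<sigma> *\<^sub>R (X' ** N ** Y')"
    unfolding X Y using sq by simp
  then have "?n M = ?n (X' ** N ** Y')" using onorm_matrix_scaleR[of \<sigma> "X' ** N ** Y'"] \<sigma> by simp
  also have "\<dots> \<le> ?n (X' ** N) * ?n Y'" by (rule onorm_matrix_mult)
  also have "\<dots> \<le> ?n X' * ?n N * ?n Y'" by (intro mult_right_mono onorm_matrix_mult onorm_matrix_nonneg)
  finally have lo: "?n M \<le> ?n X' * ?n N * ?n Y'" .
  have "0 < ?n X' * ?n N * ?n Y'" using nM lo by linarith
  then have p1: "0 < ?n X'" "0 < ?n N" "0 < ?n Y'"
    using onorm_matrix_nonneg[of X'] onorm_matrix_nonneg[of N] onorm_matrix_nonneg[of Y'] by (auto simp: zero_less_mult_iff)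
  have "0 < ?n X * ?n M * ?n Y" using p1 up by linarith
  then have p2: "0 < ?n X" "0 < ?n Y"
    using onorm_matrix_nonneg[of X] onorm_matrix_nonneg[of M] onorm_matrix_nonneg[of Y] by (auto simp: zero_less_mult_iff)
  have "ln (?n N) \<le> ln (?n X * ?n M * ?n Y)" using p1 up by simp
  also have "\<dots> = ln (?n X) + ln (?n M) + ln (?n Y)" using p2 nM by (simp add: ln_mult)
  also have "ln (?n M) \<le> ln s" using nM n1 by simp
  finally have 1: "ln (?n N) \<le> ln (?n X) + ln s + ln (?n Y)" by simp
  have "ln s \<le> ln (4 * (?n X' * ?n N * ?n Y'))" using s n2 lo by (intro ln_mono) auto
  also have "\<dots> = ln 4 + ln (?n X') + ln (?n N) + ln (?n Y')" using p1 by (simp add: ln_mult)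
  finally have 2: "ln s \<le> ln 4 + ln (?n X') + ln (?n N) + ln (?n Y')" .
  have "0 \<le> ln (4::real)" by simp
  then show ?thesis using 1 2 unfolding lsum_def lnorm_def s_def[symmetric] by linarith
qed

section \<open>The chain of arcs and its positive matrices\<close>

locale multicone_chain =
  fixes A :: "'x::finite \<Rightarrow> real^2^2" and P :: "'x \<Rightarrow> 'x \<Rightarrow> real"
    and comps :: "'x \<Rightarrow> nat set" and L :: "'x \<Rightarrow> nat \<Rightarrow> real^2^2" and C :: "'x arc set"
  assumes stoch: "row_stochastic P"
    and mc: "multicone_data A P comps L"
    and rec: "recurrent_class (Rset A P comps L) P C"
begin

lemma P_nonneg: "0 \<le> P i j"
  and P_row: "(\<Sum>j\<in>UNIV. P i j) = 1"
  using stoch by (auto simp: row_stochastic_def)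

lemma L_inv: "a \<in> comps i \<Longrightarrow> invertible (L i a)"
  using mc by (auto simp: multicone_data_def)

text \<open>The \<open>THE\<close> in \<open>beta_idx\<close> is well defined: the image of an arc is connected and is covered by
  the disjoint open arcs of the target.\<close>

lemma beta_idx_props:
  assumes P: "P i j > 0" and a: "a \<in> comps i"
  shows "beta_idx A comps L i a j \<in> comps j" (is "?thesis1")
    and "(\<lambda>v. A j *v v) ` ccone (L i a) \<subseteq> dcone (L j (beta_idx A comps L i a j))" (is "?thesis2")
proof -
  have disj: "dcone (L j b) \<inter> dcone (L j b') = {}" if "b \<in> comps j" "b' \<in> comps j" "b \<noteq> b'" for b b'
    using mc that by (auto simp: multicone_data_def)
  have sub: "(\<lambda>v. A j *v v) ` ccone (L i a) \<subseteq> (\<Union>b\<in>comps j. dcone (L j b))"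
    using mc P a by (auto simp: multicone_data_def Mset_def)
  \<comment> \<open>The image of the segment between the two spanning vectors. It meets every line
    of the image arc and is connected, whereas the set of vectors \<open>ccone\<close> falls into
    two opposite halves.\<close>
  define T where "T = (\<lambda>t. A j *v (L i a *v vec2 (1 - t) t)) ` {0..1::real}"
  have "continuous_on {0..1} (\<lambda>t. A j *v (L i a *v vec2 (1 - t) t))"
  proof -
    have "(\<lambda>t. A j *v (L i a *v vec2 (1 - t) t)) = (\<lambda>t. (1 - t) *\<^sub>R (A j *v (L i a *v vec2 1 0)) + t *\<^sub>R (A j *v (L i a *v vec2 0 1)))"
    proof
      fix t
      have "vec2 (1 - t) t = (1 - t) *\<^sub>R vec2 1 0 + t *\<^sub>R vec2 0 1" by (simp add: vec_eq_iff forall_2)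
      then show "A j *v (L i a *v vec2 (1 - t) t) = (1 - t) *\<^sub>R (A j *v (L i a *v vec2 1 0)) + t *\<^sub>R (A j *v (L i a *v vec2 0 1))"
        by (simp only: matrix_vector_right_distrib matrix_vector_mult_scaleR)
    qed
    then show ?thesis by (simp only:) (intro continuous_intros)
  qed
  then have con: "connected T" unfolding T_def by (rule connected_continuous_image) simp
  have ccone: "L i a *v vec2 s t \<in> ccone (L i a)" if "s \<ge> 0" "t \<ge> 0" "(s, t) \<noteq> (0, 0)" for s t
    using that unfolding ccone_def by blast
  have T: "T \<subseteq> (\<Union>b\<in>comps j. dcone (L j b))"
    unfolding T_def by (rule image_subsetI, rule subsetD[OF sub], rule imageI, rule ccone) auto
  have "A j *v (L i a *v vec2 1 0) \<in> T" unfolding T_def by (rule image_eqI[of _ _ 0]) auto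
  then obtain b where b: "b \<in> comps j" "A j *v (L i a *v vec2 1 0) \<in> dcone (L j b)" "A j *v (L i a *v vec2 1 0) \<in> T" using T by blast
  define V where "V = (\<Union>b'\<in>comps j - {b}. dcone (L j b'))"
  have "open V" "open (dcone (L j b))" using L_inv b by (auto simp: V_def open_dcone)
  moreover have "dcone (L j b) \<inter> V = {}" using disj b by (auto simp: V_def)
  moreover have "T \<subseteq> dcone (L j b) \<union> V" using T by (auto simp: V_def)
  ultimately have "V \<inter> T = {}" using connectedD[OF con, of "dcone (L j b)" V] b by blast
  then have Tb: "T \<subseteq> dcone (L j b)" using \<open>T \<subseteq> dcone (L j b) \<union> V\<close> by blast
  have img: "(\<lambda>v. A j *v v) ` ccone (L i a) \<subseteq> dcone (L j b)"
  proof (rule image_subsetI)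
    fix v assume "v \<in> ccone (L i a)"
    then obtain s t where st: "s \<ge> 0" "t \<ge> 0" "(s, t) \<noteq> (0, 0)" "v = L i a *v vec2 s t \<or> v = - (L i a *v vec2 s t)"
      by (auto simp: ccone_def)
    define u where "u = t / (s + t)"
    have pos: "s + t > 0" using st by (auto simp: add_nonneg_eq_0_iff less_le)
    then have "(s + t) * u = t" by (simp add: u_def)
    then have "vec2 s t = (s + t) *\<^sub>R vec2 (1 - u) u" by (simp add: vec_eq_iff forall_2 right_diff_distrib)
    moreover have "A j *v (L i a *v vec2 (1 - u) u) \<in> dcone (L j b)"
      by (rule subsetD[OF Tb], unfold T_def, rule imageI) (use st pos in \<open>auto simp: u_def\<close>)
    ultimately obtain w where w: "w \<in> dcone (L j b)" "A j *v (L i a *v vec2 s t) = (s + t) *\<^sub>R w"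
      by (metis matrix_vector_mult_scaleR)
    have "A j *v v = (s + t) *\<^sub>R w \<or> A j *v v = (- (s + t)) *\<^sub>R w"
      using st(4) w(2) by (elim disjE) (simp_all only: matrix_vector_neg scaleR_minus_left simp_thms)
    then show "A j *v v \<in> dcone (L j b)"
      using dcone_scaleR[OF L_inv[OF b(1)] w(1), of "s + t"] dcone_scaleR[OF L_inv[OF b(1)] w(1), of "- (s + t)"] pos by auto
  qed
  have "\<exists>!b. b \<in> comps j \<and> (\<lambda>v. A j *v v) ` ccone (L i a) \<subseteq> dcone (L j b)"
  proof (rule ex1I[of _ b])
    fix b' assume b': "b' \<in> comps j \<and> (\<lambda>v. A j *v v) ` ccone (L i a) \<subseteq> dcone (L j b')"
    have "A j *v (L i a *v vec2 1 0) \<in> dcone (L j b')" using b' ccone[of 1 0] by auto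
    then show "b' = b" using disj[of b' b] b b' by blast
  qed (use b img in auto)
  from theI'[OF this] show ?thesis1 ?thesis2 unfolding beta_idx_def by auto
qed

lemma C_arc:
  assumes "r \<in> C"
  shows "snd (fst r) \<in> comps (fst (fst r))" "snd (snd r) \<in> comps (fst (snd r))"
    "P (fst (fst r)) (fst (snd r)) > 0"
    "snd (snd r) = beta_idx A comps L (fst (fst r)) (snd (fst r)) (fst (snd r))"
  using assms rec unfolding recurrent_class_def Rset_def by auto

lemma finite_C: "finite C"
proof -
  have "finite (Sigma UNIV comps)" using mc by (intro finite_SigmaI) (auto simp: multicone_data_def)
  moreover have "C \<subseteq> Sigma UNIV comps \<times> Sigma UNIV comps"
  proof
    fix r assume "r \<in> C"
    then show "r \<in> Sigma UNIV comps \<times> Sigma UNIV comps" using C_arc(1,2)[of r] by (cases r) auto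
  qed
  ultimately show ?thesis by (meson finite_SigmaI finite_subset)
qed

abbreviation source_mat where "source_mat r \<equiv> L (fst (fst r)) (snd (fst r))"
abbreviation target_mat where "target_mat r \<equiv> L (fst (snd r)) (snd (snd r))"

text \<open>The columns of \<open>M\<close> are images of the boundary lines of the cone and lie in
  an open quadrant or its negative. Both columns have the same sign, for otherwise some nonnegative
  combination would have first entry 0, although it too must land in the open cone.\<close>

lemma Bmat_props:
  assumes r: "r \<in> C"
  shows "Bmat A L r $ i $ j > 0"
    and "\<exists>\<sigma>. \<bar>\<sigma>\<bar> = 1 \<and> A (fst (snd r)) ** source_mat r = \<sigma> *\<^sub>R (target_mat r ** Bmat A L r)"
proof -
  define M where "M = matrix_inv (target_mat r) ** A (fst (snd r)) ** source_mat r"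
  note c = C_arc[OF r]
  have inv: "invertible (target_mat r)" using c by (intro L_inv)
  have ss: "same_sign (M *v vec2 s t)" if "s \<ge> 0" "t \<ge> 0" "(s, t) \<noteq> (0, 0)" for s t
  proof -
    have "source_mat r *v vec2 s t \<in> ccone (source_mat r)" using that unfolding ccone_def by blast
    then have "A (fst (snd r)) *v (source_mat r *v vec2 s t) \<in> dcone (target_mat r)"
      using beta_idx_props(2)[OF c(3) c(1)] c(4) by auto
    then show ?thesis using dcone_iff[OF inv] by (simp add: M_def matrix_vector_mul_assoc matrix_mul_assoc)
  qed
  have c1: "same_sign (vector [M $ 1 $ 1, M $ 2 $ 1])" and c2: "same_sign (vector [M $ 1 $ 2, M $ 2 $ 2])"
    using ss[of 1 0] ss[of 0 1] by (simp_all add: same_sign_def mat2_nth)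
  have B: "Bmat A L r = (if M $ 1 $ 1 > 0 then M else - M)"
    by (simp add: Bmat_def M_def Let_def)
  have "(\<forall>i j. M $ i $ j > 0) \<or> (\<forall>i j. M $ i $ j < 0)"
  proof (cases "M $ 1 $ 1 * M $ 1 $ 2 > 0")
    case True
    then show ?thesis using c1 c2 by (auto simp: same_sign_def forall_2 zero_less_mult_iff)
  next
    case False
    then have "M $ 1 $ 1 * M $ 1 $ 2 < 0" using c1 c2 by (auto simp: same_sign_def zero_less_mult_iff mult_less_0_iff)
    \<comment> \<open>For columns of opposite sign these weights cancel the first entry of the
      image.\<close>
    then have "same_sign (M *v vec2 \<bar>M $ 1 $ 2\<bar> \<bar>M $ 1 $ 1\<bar>)" by (intro ss) auto
    moreover have "M $ 1 $ 1 * \<bar>M $ 1 $ 2\<bar> + M $ 1 $ 2 * \<bar>M $ 1 $ 1\<bar> = 0"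
      using \<open>M $ 1 $ 1 * M $ 1 $ 2 < 0\<close> by (auto simp: mult_less_0_iff abs_if)
    ultimately show ?thesis by (simp add: same_sign_def mat2_nth)
  qed
  then show "Bmat A L r $ i $ j > 0" 
  proof
    assume "\<forall>i j. M $ i $ j < 0"
    moreover from this have "\<not> M $ 1 $ 1 > 0" by (simp add: less_imp_le not_less)
    ultimately show ?thesis by (simp add: B)
  qed (simp add: B)
  define \<sigma> where "\<sigma> = (if M $ 1 $ 1 > 0 then 1 else - 1 :: real)"
  have "M = \<sigma> *\<^sub>R Bmat A L r" by (simp add: B \<sigma>_def)
  then have "target_mat r ** M = \<sigma> *\<^sub>R (target_mat r ** Bmat A L r)"
    by (simp add: matrix_scalar_ac scalar_matrix_assoc)
  moreover have "target_mat r ** M = A (fst (snd r)) ** source_mat r"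
    using matrix_inv_inverse(2)[OF inv] by (simp add: M_def matrix_mul_assoc)
  ultimately have "A (fst (snd r)) ** source_mat r = \<sigma> *\<^sub>R (target_mat r ** Bmat A L r)"
    by simp
  then show "\<exists>\<sigma>. \<bar>\<sigma>\<bar> = 1 \<and> A (fst (snd r)) ** source_mat r = \<sigma> *\<^sub>R (target_mat r ** Bmat A L r)"
    by (intro exI[of _ \<sigma>]) (simp add: \<sigma>_def)
qed

lemma Qm_nonneg: "0 \<le> Qm P r r'"
  by (simp add: Qm_def P_nonneg)

text \<open>An arc has exactly one successor for each admissible symbol, as \<open>beta_idx\<close>
  determines the component, and \<open>C\<close> is closed. So the symbols read along the chain of
  arcs form the original Markov chain.\<close>

lemma Qm_sum:
  assumes r: "r \<in> C"
  shows "(\<Sum>r'\<in>C. Qm P r r' * F (fst (snd r'))) = (\<Sum>k\<in>UNIV. P (fst (snd r)) k * F k)"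
proof -
  define nx where "nx k = (snd r, (k, beta_idx A comps L (fst (snd r)) (snd (snd r)) k))" for k
  note c = C_arc[OF r]
  have Q: "Qm P r (nx k) = P (fst (snd r)) k" for k by (simp add: Qm_def nx_def)
  have nxC: "nx k \<in> C" if "P (fst (snd r)) k > 0" for k
  proof -
    have "nx k \<in> Rset A P comps L"
      using that c(2) beta_idx_props(1)[OF that c(2)] by (simp add: Rset_def nx_def case_prod_beta)
    then show ?thesis using rec r that Q[of k] unfolding recurrent_class_def by auto
  qed
  have nx: "r' = nx (fst (snd r'))" if "r' \<in> C" "Qm P r r' \<noteq> 0" for r'
    using C_arc(4)[OF that(1)] that(2) by (cases r') (auto simp: Qm_def nx_def split: if_splits)
  have "(\<Sum>r'\<in>C. Qm P r r' * F (fst (snd r'))) = (\<Sum>r'\<in>nx ` {k. P (fst (snd r)) k > 0}. Qm P r r' * F (fst (snd r')))"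
  proof (rule sum.mono_neutral_right[OF finite_C])
    show "nx ` {k. P (fst (snd r)) k > 0} \<subseteq> C" using nxC by auto
    show "\<forall>r'\<in>C - nx ` {k. P (fst (snd r)) k > 0}. Qm P r r' * F (fst (snd r')) = 0"
    proof
      fix r' assume r': "r' \<in> C - nx ` {k. P (fst (snd r)) k > 0}"
      have "Qm P r r' = 0"
      proof (rule ccontr)
        assume n: "Qm P r r' \<noteq> 0"
        then have "P (fst (snd r)) (fst (snd r')) > 0"
          using P_nonneg[of "fst (snd r)" "fst (snd r')"] by (auto simp: Qm_def split: if_splits)
        then show False using nx[OF _ n] r' by auto
      qed
      then show "Qm P r r' * F (fst (snd r')) = 0" by simp
    qed
  qed
  also have "\<dots> = (\<Sum>k\<in>{k. P (fst (snd r)) k > 0}. P (fst (snd r)) k * F k)"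
    by (subst sum.reindex) (auto simp: Q nx_def inj_on_def Qm_def)
  also have "\<dots> = (\<Sum>k\<in>UNIV. P (fst (snd r)) k * F k)"
    by (rule sum.mono_neutral_left) (use P_nonneg in \<open>auto simp: not_less intro: antisym\<close>)
  finally show ?thesis .
qed

lemma Qm_row: "r \<in> C \<Longrightarrow> (\<Sum>r'\<in>C. Qm P r r') = 1"
  using Qm_sum[of r "\<lambda>_. 1"] P_row by simp

text \<open>Along corresponding paths the two products stay related by N = \<open>\<sigma>\<close> L
  M Y, where L belongs to the current arc, \<open>Y\<close> undoes the L of the first arc and
  \<open>\<sigma>\<close> collects the signs chosen in \<open>Bmat\<close>. Intermediate changes of
  basis cancel, so only the two ends cost anything, and there are finitely many arcs.\<close>

lemma path_mean_compare:
  assumes r0: "r0 \<in> C"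
  shows "\<exists>K. \<forall>n. \<bar>path_mean C (Qm P) (Bmat A L) lsum n r0 (mat 1) - path_mean UNIV P A lnorm n (fst (snd r0)) (mat 1)\<bar> \<le> K"
proof -
  define Y where "Y = matrix_inv (source_mat r0)"
  define Y' where "Y' = source_mat r0"
  have YY: "Y ** Y' = mat 1" "Y' ** Y = mat 1"
    using matrix_inv_inverse[OF L_inv[OF C_arc(1)[OF r0]]] by (simp_all add: Y_def Y'_def)
  define k where "k r = \<bar>ln (onorm ((*v) (source_mat r)))\<bar> + \<bar>ln (onorm ((*v) (matrix_inv (source_mat r))))\<bar>" for r :: "'x arc"
  define K where "K = ln 4 + (\<Sum>r\<in>C. k r) + \<bar>ln (onorm ((*v) Y))\<bar> + \<bar>ln (onorm ((*v) Y'))\<bar>"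
  have main: "\<bar>path_mean C (Qm P) (Bmat A L) lsum n r M - path_mean UNIV P A lnorm n (fst (snd r)) N\<bar> \<le> K"
    if "r \<in> C" "nonneg_rows M" "\<bar>\<sigma>\<bar> = 1" "N = \<sigma> *\<^sub>R (source_mat r ** M ** Y)" for n r M N \<sigma>
    using that
  proof (induction n arbitrary: r M N \<sigma>)
    case 0
    have "\<bar>lsum M - lnorm N\<bar> \<le> ln 4 + \<bar>ln (onorm ((*v) (source_mat r)))\<bar> + \<bar>ln (onorm ((*v) (matrix_inv (source_mat r))))\<bar> + \<bar>ln (onorm ((*v) Y))\<bar> + \<bar>ln (onorm ((*v) Y'))\<bar>"
      by (rule lsum_lnorm_compare[OF 0(2,4,3) matrix_inv_inverse(1)[OF L_inv[OF C_arc(1)[OF 0(1)]]] YY(1)])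
    moreover have "k r \<le> (\<Sum>r\<in>C. k r)" by (rule member_le_sum) (use 0 finite_C in \<open>auto simp: k_def\<close>)
    ultimately show ?case by (simp add: K_def k_def)
  next
    case (Suc n)
    let ?B = "Bmat A L r" and ?A = "A (fst (snd r))"
    obtain \<tau> where \<tau>: "\<bar>\<tau>\<bar> = 1" "?A ** source_mat r = \<tau> *\<^sub>R (target_mat r ** ?B)"
      using Bmat_props(2)[OF Suc.prems(1)] by blast
    have N: "?A ** N = (\<sigma> * \<tau>) *\<^sub>R (target_mat r ** (?B ** M) ** Y)"
    proof -
      have "?A ** N = \<sigma> *\<^sub>R ((?A ** source_mat r) ** M ** Y)"
        unfolding Suc.prems(4) by (simp add: matrix_scalar_ac scalar_matrix_assoc[symmetric] matrix_mul_assoc)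
      also have "\<dots> = (\<sigma> * \<tau>) *\<^sub>R (target_mat r ** (?B ** M) ** Y)"
        unfolding \<tau>(2) by (simp add: scalar_matrix_assoc[symmetric] matrix_mul_assoc)
      finally show ?thesis .
    qed
    have "path_mean UNIV P A lnorm (Suc n) (fst (snd r)) N = (\<Sum>r'\<in>C. Qm P r r' * path_mean UNIV P A lnorm n (fst (snd r')) (?A ** N))"
      using Qm_sum[OF Suc.prems(1), of "\<lambda>k. path_mean UNIV P A lnorm n k (?A ** N)"] by simp
    then have "path_mean C (Qm P) (Bmat A L) lsum (Suc n) r M - path_mean UNIV P A lnorm (Suc n) (fst (snd r)) N
      = (\<Sum>r'\<in>C. Qm P r r' * (path_mean C (Qm P) (Bmat A L) lsum n r' (?B ** M) - path_mean UNIV P A lnorm n (fst (snd r')) (?A ** N)))"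
      by (simp add: sum_subtractf right_diff_distrib)
    also have "\<bar>\<dots>\<bar> \<le> (\<Sum>r'\<in>C. Qm P r r' * K)"
    proof (rule order_trans[OF sum_abs sum_mono])
      fix r' assume r': "r' \<in> C"
      show "\<bar>Qm P r r' * (path_mean C (Qm P) (Bmat A L) lsum n r' (?B ** M) - path_mean UNIV P A lnorm n (fst (snd r')) (?A ** N))\<bar> \<le> Qm P r r' * K"
      proof (cases "Qm P r r' = 0")
        case False
        then have "fst r' = snd r" by (auto simp: Qm_def split: if_splits)
        then have "\<bar>path_mean C (Qm P) (Bmat A L) lsum n r' (?B ** M) - path_mean UNIV P A lnorm n (fst (snd r')) (?A ** N)\<bar> \<le> K"
          using Suc.prems \<tau> N by (intro Suc.IH[OF r', of _ "\<sigma> * \<tau>"] nonneg_rows_mult Bmat_props(1)) (auto simp: abs_mult)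
        then show ?thesis using Qm_nonneg[of r r'] by (simp add: abs_mult mult_left_mono)
      qed simp
    qed
    also have "\<dots> = K" using Qm_row[OF Suc.prems(1)] by (simp flip: sum_distrib_right)
    finally show ?case .
  qed
  have "mat 1 = 1 *\<^sub>R (source_mat r0 ** mat 1 ** Y)" using YY(2) by (simp add: Y'_def)
  from main[OF r0 nonneg_rows_mat_1 _ this] show ?thesis by auto
qed

end

section \<open>Blocks of arcs\<close>

fun word_mean :: "'s set \<Rightarrow> ('s \<Rightarrow> 's \<Rightarrow> real) \<Rightarrow> nat \<Rightarrow> 's \<Rightarrow> ('s list \<Rightarrow> real) \<Rightarrow> real" where
  "word_mean S Q 0 s G = G []"
| "word_mean S Q (Suc n) s G = (\<Sum>s'\<in>S. Q s s' * word_mean S Q n s' (\<lambda>w. G (s' # w)))"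

lemma word_mean_lists:
  "word_mean S Q n s G = (\<Sum>w\<in>{w. set w \<subseteq> S \<and> length w = n}. (\<Prod>k<n. Q ((s # w) ! k) ((s # w) ! Suc k)) * G w)"
proof (induction n arbitrary: s G)
  case 0
  have "{w. set w \<subseteq> S \<and> length w = 0} = {[]}" by auto
  then show ?case by simp
next
  case (Suc n)
  have "(\<Prod>k<Suc n. Q ((s # i # w) ! k) ((s # i # w) ! Suc k)) = Q s i * (\<Prod>k<n. Q ((i # w) ! k) ((i # w) ! Suc k))" for i w
    by (subst prod.lessThan_Suc_shift) simp
  then show ?case
    unfolding sum_lists_Suc word_mean.simps Suc.IH by (simp only: sum_distrib_left mult.assoc)
qed

lemma word_mean_const:
  assumes "\<And>s. s \<in> S \<Longrightarrow> (\<Sum>s'\<in>S. Q s s') = 1" "s \<in> S"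
  shows "word_mean S Q n s (\<lambda>_. c) = c"
  using assms(2) by (induction n arbitrary: s) (simp_all add: assms(1) flip: sum_distrib_right)

text \<open>\<open>path_mean\<close> multiplies by \<open>B s\<close> when leaving \<open>s\<close>; \<open>next_mean\<close> assumes that this has been done,
  which lets paths be cut into blocks of length \<open>d\<close>.\<close>

definition next_mean where
  "next_mean S Q B F k s M = (\<Sum>s'\<in>S. Q s s' * path_mean S Q B F k s' M)"

lemma next_mean_word_mean:
  "next_mean S Q B F (n + k) s M = word_mean S Q n s (\<lambda>w. next_mean S Q B F k (last (s # w)) (prodB B w ** M))"
proof (induction n arbitrary: s M)
  case (Suc n)
  have "next_mean S Q B F (Suc n + k) s M = (\<Sum>s'\<in>S. Q s s' * next_mean S Q B F (n + k) s' (B s' ** M))"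
    by (simp add: next_mean_def)
  then show ?case by (simp add: Suc.IH matrix_mul_assoc)
qed simp

lemma cyclic_classI:
  "r \<in> C \<Longrightarrow> (r0, r) \<in> E ^^ n \<Longrightarrow> n mod d = u \<Longrightarrow> r \<in> cyclic_class E C r0 d u"
  unfolding cyclic_class_def by blast

context multicone_chain begin

text \<open>Excludes an empty set of return times, whose \<open>Gcd\<close> would be 0. Row sums 1
  give an edge out of \<open>r0\<close>, and recurrence leads back.\<close>

lemma period_pos:
  assumes r0: "r0 \<in> C"
  shows "0 < period_at (Qedges C P) r0"
proof -
  have "\<exists>r'\<in>C. Qm P r0 r' \<noteq> 0"
  proof (rule ccontr)
    assume "\<not> (\<exists>r'\<in>C. Qm P r0 r' \<noteq> 0)"
    then have "(\<Sum>r'\<in>C. Qm P r0 r') = 0" by (intro sum.neutral) auto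
    then show False using Qm_row[OF r0] by simp
  qed
  then obtain r' where r': "r' \<in> C" "Qm P r0 r' \<noteq> 0" by auto
  then have "(r0, r') \<in> Qedges C P" using r0 Qm_nonneg[of r0 r'] by (auto simp: Qedges_def less_le)
  moreover have "(r', r0) \<in> (Qedges C P)\<^sup>*" using rec r' r0 by (auto simp: recurrent_class_def)
  ultimately have "(r0, r0) \<in> (Qedges C P)\<^sup>+" by simp
  then obtain n where n: "n > 0" "(r0, r0) \<in> Qedges C P ^^ n" using trancl_power by blast
  then have "Gcd {n. n > 0 \<and> (r0, r0) \<in> Qedges C P ^^ n} \<noteq> 0"
    unfolding Gcd_0_iff by blast
  then show ?thesis by (simp only: period_at_def neq0_conv)
qed

context
  fixes r0 :: "'x arc" and d :: nat
  assumes r0C: "r0 \<in> C" and d: "d = period_at (Qedges C P) r0"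
begin

lemma d_pos: "0 < d"
  using period_pos[OF r0C] by (simp add: d)

lemma red_states_subset: "red_states P C r0 d \<subseteq> {w. set w \<subseteq> C \<and> length w = d}"
proof
  fix w assume w: "w \<in> red_states P C r0 d"
  then have l: "length w = d" and nth: "\<And>u. u < d \<Longrightarrow> w ! u \<in> C"
    by (simp_all add: red_states_def cyclic_class_def)
  have "set w \<subseteq> C"
  proof
    fix r assume "r \<in> set w"
    then obtain u where "u < length w" "w ! u = r" unfolding in_set_conv_nth by blast
    then show "r \<in> C" using nth l by blast
  qed
  then show "w \<in> {w. set w \<subseteq> C \<and> length w = d}" using l by simp
qed

lemma red_states_last:
  assumes "c \<in> red_states P C r0 d"
  shows "last c = c ! (d - 1)" "last c \<in> C" "c \<noteq> []"
proof -
  have c: "length c = d" "set c \<subseteq> C" using assms red_states_subset by auto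
  then show "c \<noteq> []" using d_pos by auto
  then show "last c = c ! (d - 1)" "last c \<in> C" using c by (auto simp: last_conv_nth)
qed

lemma finite_red_states: "finite (red_states P C r0 d)"
  by (rule finite_subset[OF red_states_subset finite_lists_length_eq[OF finite_C]])

text \<open>A block transition is \<open>d\<close> steps of the chain of arcs. The cyclic classes
  impose nothing new on words of positive weight: every edge raises the residue of the path length
  modulo \<open>d\<close> by one.\<close>

lemma red_states_sum:
  assumes c: "c \<in> red_states P C r0 d"
  shows "(\<Sum>c'\<in>red_states P C r0 d. red_Q P d c c' * G c') = word_mean C (Qm P) d (last c) G"
proof -
  obtain d' where d': "d = Suc d'" using d_pos by (cases d) auto
  have Q: "red_Q P d c c' = (\<Prod>k<d. Qm P ((last c # c') ! k) ((last c # c') ! Suc k))" for c'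
    unfolding d' by (subst prod.lessThan_Suc_shift) (simp add: red_Q_def red_states_last(1)[OF c] d')
  have mem: "w \<in> red_states P C r0 d"
    if w: "set w \<subseteq> C" "length w = d" and nz: "(\<Prod>k<d. Qm P ((last c # w) ! k) ((last c # w) ! Suc k)) \<noteq> 0" for w
  proof -
    have wC: "w ! u \<in> C" if "u < d" for u using w that by (metis nth_mem subsetD)
    have step: "Qm P ((last c # w) ! k) (w ! k) > 0" if "k < d" for k
    proof -
      have "Qm P ((last c # w) ! k) ((last c # w) ! Suc k) \<noteq> 0" using nz that by simp
      then show ?thesis using Qm_nonneg[of "(last c # w) ! k" "w ! k"] by simp
    qed
    have cyc: "w ! u \<in> cyclic_class (Qedges C P) C r0 d u" if "u < d" for u
      using that
    proof (induction u)
      case 0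
      have "c ! (d - 1) \<in> cyclic_class (Qedges C P) C r0 d (d - 1)"
        using c d_pos by (simp add: red_states_def)
      then obtain n where n: "n mod d = d - 1" "(r0, last c) \<in> Qedges C P ^^ n"
        unfolding red_states_last(1)[OF c, symmetric] by (auto simp: cyclic_class_def)
      have "(last c, w ! 0) \<in> Qedges C P"
        using step[OF 0] red_states_last(2)[OF c] wC[OF 0] by (simp add: Qedges_def)
      then have "(r0, w ! 0) \<in> Qedges C P ^^ Suc n" using n(2) by auto
      \<comment> \<open>The old block ends in class \<open>d - 1\<close>; the residue wraps around
        and the new block starts in class 0.\<close>
      moreover have "Suc n mod d = 0" using n(1) d_pos by (simp add: mod_Suc)
      ultimately show ?case by (rule cyclic_classI[OF wC[OF 0]])
    next
      case (Suc u)
      then obtain n where n: "n mod d = u" "(r0, w ! u) \<in> Qedges C P ^^ n"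
        by (auto simp: cyclic_class_def)
      have "(w ! u, w ! Suc u) \<in> Qedges C P"
        using step[OF Suc.prems] wC[of u] wC[OF Suc.prems] Suc.prems by (simp add: Qedges_def)
      then have "(r0, w ! Suc u) \<in> Qedges C P ^^ Suc n" using n(2) by auto
      moreover have "Suc n mod d = Suc u" using n(1) Suc.prems by (simp add: mod_Suc)
      ultimately show ?case by (rule cyclic_classI[OF wC[OF Suc.prems]])
    qed
    have "Qm P (w ! u) (w ! Suc u) > 0" if "Suc u < d" for u
      using step[OF that] by simp
    then show ?thesis using cyc w by (simp add: red_states_def)
  qed
  have "word_mean C (Qm P) d (last c) G = (\<Sum>w\<in>red_states P C r0 d. (\<Prod>k<d. Qm P ((last c # w) ! k) ((last c # w) ! Suc k)) * G w)"
    unfolding word_mean_lists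
    by (rule sum.mono_neutral_right[OF finite_lists_length_eq[OF finite_C] red_states_subset]) (use mem in auto)
  then show ?thesis by (simp add: Q)
qed

lemma red_Q_row: "c \<in> red_states P C r0 d \<Longrightarrow> (\<Sum>c'\<in>red_states P C r0 d. red_Q P d c c') = 1"
  using red_states_sum[of c "\<lambda>_. 1"] word_mean_const[of C "Qm P" "last c" d 1] Qm_row red_states_last(2) by simp

lemma red_Q_nonneg: "0 \<le> red_Q P d c c'"
  by (simp add: red_Q_def Qm_nonneg prod_nonneg)

lemma red_path_mean:
  assumes c: "c \<in> red_states P C r0 d"
  shows "next_mean (red_states P C r0 d) (red_Q P d) (prodB B) F N c M = next_mean C (Qm P) B F (N * d) (last c) M"
  using c
proof (induction N arbitrary: c M)
  case 0
  have "next_mean (red_states P C r0 d) (red_Q P d) (prodB B) F 0 c M = F M"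
    using red_Q_row[OF 0] by (simp add: next_mean_def flip: sum_distrib_right)
  moreover have "next_mean C (Qm P) B F 0 (last c) M = F M"
    using Qm_row[OF red_states_last(2)[OF 0]] by (simp add: next_mean_def flip: sum_distrib_right)
  ultimately show ?case by simp
next
  case (Suc N)
  let ?S = "red_states P C r0 d"
  have "next_mean C (Qm P) B F (Suc N * d) (last c) M
    = word_mean C (Qm P) d (last c) (\<lambda>w. next_mean C (Qm P) B F (N * d) (last (last c # w)) (prodB B w ** M))"
    using next_mean_word_mean[of C "Qm P" B F d "N * d" "last c" M] by simp
  also have "\<dots> = (\<Sum>c'\<in>?S. red_Q P d c c' * next_mean C (Qm P) B F (N * d) (last (last c # c')) (prodB B c' ** M))"
    by (rule red_states_sum[OF Suc.prems, symmetric])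
  also have "\<dots> = (\<Sum>c'\<in>?S. red_Q P d c c' * next_mean ?S (red_Q P d) (prodB B) F N c' (prodB B c' ** M))"
    by (rule sum.cong) (simp_all add: Suc.IH red_states_last(3))
  also have "\<dots> = next_mean ?S (red_Q P d) (prodB B) F (Suc N) c M"
    by (simp add: next_mean_def)
  finally show ?case by simp
qed

lemma prodB_positive:
  assumes "w \<noteq> []" "\<And>r i j. r \<in> set w \<Longrightarrow> B r $ i $ j > 0"
  shows "prodB B w $ i $ j > 0"
  using assms
proof (induction w arbitrary: i j)
  case (Cons r w)
  show ?case
  proof (cases "w = []")
    case False
    then show ?thesis using Cons by (auto simp: mat2_nth intro!: add_pos_pos mult_pos_pos)
  qed (use Cons.prems in simp)
qed simp

text \<open>Stationarity replaces the starting block by a step out of a block; after that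
  \<open>next_mean\<close> identifies N block steps with N d arc steps. The factor \<open>d\<close>
  is the ratio of the two time scales.\<close>

lemma red_mean_tendsto:
  assumes lim: "\<And>r. r \<in> C \<Longrightarrow> (\<lambda>n. path_mean C (Qm P) B F n r M / real n) \<longlonglongrightarrow> lam"
    and stat: "stationary_on (red_states P C r0 d) (red_Q P d) \<pi>"
  shows "(\<lambda>N. (\<Sum>c\<in>red_states P C r0 d. \<pi> c * path_mean (red_states P C r0 d) (red_Q P d) (prodB B) F N c M) / real N)
    \<longlonglongrightarrow> real d * lam"
proof -
  let ?S = "red_states P C r0 d"
  let ?V = "path_mean ?S (red_Q P d) (prodB B) F"
  have st: "(\<Sum>c\<in>?S. \<pi> c) = 1" "\<And>c'. c' \<in> ?S \<Longrightarrow> (\<Sum>c\<in>?S. \<pi> c * red_Q P d c c') = \<pi> c'"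
    using stat by (auto simp: stationary_on_def)
  have eq: "(\<Sum>c\<in>?S. \<pi> c * ?V N c M) = (\<Sum>c\<in>?S. \<pi> c * next_mean C (Qm P) B F (N * d) (last c) M)" for N
  proof -
    have "(\<Sum>c'\<in>?S. \<pi> c' * ?V N c' M) = (\<Sum>c'\<in>?S. \<Sum>c\<in>?S. \<pi> c * red_Q P d c c' * ?V N c' M)"
      by (rule sum.cong) (simp_all add: st(2) flip: sum_distrib_right)
    also have "\<dots> = (\<Sum>c\<in>?S. \<Sum>c'\<in>?S. \<pi> c * red_Q P d c c' * ?V N c' M)" by (rule sum.swap)
    also have "\<dots> = (\<Sum>c\<in>?S. \<pi> c * next_mean ?S (red_Q P d) (prodB B) F N c M)"
      by (simp add: next_mean_def sum_distrib_left mult.assoc)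
    finally show ?thesis by (simp add: red_path_mean)
  qed
  have sub: "filterlim (\<lambda>N. N * d) sequentially sequentially"
    using d_pos by (intro filterlim_subseq) (simp add: strict_mono_def)
  have "(\<lambda>N. \<Sum>c\<in>?S. \<pi> c * (\<Sum>r\<in>C. Qm P (last c) r * (real d * (path_mean C (Qm P) B F (N * d) r M / real (N * d)))))
    \<longlonglongrightarrow> (\<Sum>c\<in>?S. \<pi> c * (\<Sum>r\<in>C. Qm P (last c) r * (real d * lam)))"
    by (intro tendsto_intros filterlim_compose[OF lim sub])
  also have "(\<Sum>c\<in>?S. \<pi> c * (\<Sum>r\<in>C. Qm P (last c) r * (real d * lam))) = (\<Sum>c\<in>?S. \<pi> c * (real d * lam))"
    by (rule sum.cong) (simp_all add: Qm_row red_states_last(2) flip: sum_distrib_right)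
  also have "\<dots> = real d * lam" using st(1) by (simp flip: sum_distrib_right)
  also have "(\<lambda>N. \<Sum>c\<in>?S. \<pi> c * (\<Sum>r\<in>C. Qm P (last c) r * (real d * (path_mean C (Qm P) B F (N * d) r M / real (N * d)))))
    = (\<lambda>N. (\<Sum>c\<in>?S. \<pi> c * ?V N c M) / real N)"
  proof
    fix N
    have "real d * (x / real (N * d)) = x / real N" for x using d_pos by simp
    then show "(\<Sum>c\<in>?S. \<pi> c * (\<Sum>r\<in>C. Qm P (last c) r * (real d * (path_mean C (Qm P) B F (N * d) r M / real (N * d)))))
      = (\<Sum>c\<in>?S. \<pi> c * ?V N c M) / real N"
      unfolding eq by (simp add: next_mean_def sum_divide_distrib sum_distrib_left)
  qed
  finally show ?thesis .
qed

end

lemma arc_path_mean_tendsto: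
  assumes lim: "\<And>j. (\<lambda>n. path_mean UNIV P A lnorm n j (mat 1) / real n) \<longlonglongrightarrow> lam" and r: "r \<in> C"
  shows "(\<lambda>n. path_mean C (Qm P) (Bmat A L) lsum n r (mat 1) / real n) \<longlonglongrightarrow> lam"
proof -
  let ?V = "\<lambda>n. path_mean C (Qm P) (Bmat A L) lsum n r (mat 1)"
  let ?U = "\<lambda>n. path_mean UNIV P A lnorm n (fst (snd r)) (mat 1)"
  obtain K where K: "\<And>n. \<bar>?V n - ?U n\<bar> \<le> K" using path_mean_compare[OF r] by blast
  have "(\<lambda>n. (?V n - ?U n) / real n) \<longlonglongrightarrow> 0"
  proof (rule Lim_null_comparison)
    show "\<forall>\<^sub>F n in sequentially. norm ((?V n - ?U n) / real n) \<le> K / real n"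
      using K by (auto simp: abs_divide intro!: always_eventually divide_right_mono)
    show "(\<lambda>n. K / real n) \<longlonglongrightarrow> 0" by (rule lim_const_over_n)
  qed
  from tendsto_add[OF this lim[of "fst (snd r)"]] show ?thesis
    by (simp add: diff_divide_distrib)
qed

end

section \<open>The error bound\<close>


text \<open>The row sums of \<open>M\<close> are the entries of M (1, 1). Each step adds to the
  logarithm of their sum the value of \<open>mob_ell\<close> at the current point, and averaging the
  \<open>k\<close>-th addition gives \<open>H k\<close>.\<close>

lemma (in mobius_chain) path_mean_H:
  assumes "r \<in> S" "0 < M $ 1 $ 1 + M $ 1 $ 2" "0 < M $ 2 $ 1 + M $ 2 $ 2"
  shows "path_mean S Q B lsum n r M = lsum M +
    (\<Sum>k<n. H k r ((M $ 1 $ 1 + M $ 1 $ 2 - (M $ 2 $ 1 + M $ 2 $ 2)) / (M $ 1 $ 1 + M $ 1 $ 2 + (M $ 2 $ 1 + M $ 2 $ 2))))"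
  using assms
proof (induction n arbitrary: r M)
  case (Suc n)
  define u v where "u = M $ 1 $ 1 + M $ 1 $ 2" and "v = M $ 2 $ 1 + M $ 2 $ 2"
  define u' v' where "u' = B r $ 1 $ 1 * u + B r $ 1 $ 2 * v" and "v' = B r $ 2 $ 1 * u + B r $ 2 $ 2 * v"
  define x where "x = (u - v) / (u + v)"
  have uv: "u > 0" "v > 0" using Suc.prems by (simp_all add: u_def v_def)
  note size = pos_matrix.mob_size[OF pos[OF Suc.prems(1)] uv, folded u'_def v'_def x_def]
  have BM: "(B r ** M) $ 1 $ 1 + (B r ** M) $ 1 $ 2 = u'" "(B r ** M) $ 2 $ 1 + (B r ** M) $ 2 $ 2 = v'"
    by (simp_all add: mat2_nth u'_def v'_def u_def v_def algebra_simps)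
  have IH: "path_mean S Q B lsum n s (B r ** M) = lsum (B r ** M) + (\<Sum>k<n. H k s (f r x))" if "s \<in> S" for s
    using Suc.IH[OF that, of "B r ** M"] size unfolding BM by simp
  have "path_mean S Q B lsum (Suc n) r M = (\<Sum>s\<in>S. Q r s * (lsum (B r ** M) + (\<Sum>k<n. H k s (f r x))))"
    by (simp add: IH)
  also have "\<dots> = (\<Sum>s\<in>S. Q r s) * lsum (B r ** M) + (\<Sum>s\<in>S. \<Sum>k<n. Q r s * H k s (f r x))"
    by (simp add: distrib_left sum.distrib sum_distrib_left sum_distrib_right)
  also have "\<dots> = lsum (B r ** M) + (\<Sum>k<n. H (Suc k) r x)"
    by (subst sum.swap) (simp add: Q_row[OF Suc.prems(1)] H_Suc)
  also have "lsum (B r ** M) = lsum M + H 0 r x"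
    using size(3) unfolding lsum_def BM by (simp add: H_def u_def v_def)
  finally have "path_mean S Q B lsum (Suc n) r M = lsum M + (\<Sum>k<Suc n. H k r x)"
    by (subst sum.lessThan_Suc_shift) simp
  then show ?case by (simp only: x_def u_def v_def)
qed simp

lemma (in mobius_chain) mean_e:
  "(\<Sum>c\<in>S. \<pi> c * path_mean S Q B lsum N c (mat 1)) = ln 2 + (\<Sum>k<N. e k)"
proof -
  \<comment> \<open>The identity leaves (1, 1) in place, which has size 2 and point 0; the Cesaro
    mean forgets the ln 2.\<close>
  have "path_mean S Q B lsum N c (mat 1) = ln 2 + (\<Sum>k<N. H k c 0)" if "c \<in> S" for c
    using path_mean_H[OF that, of "mat 1" N] by (simp add: mat_def lsum_def)
  then have "(\<Sum>c\<in>S. \<pi> c * path_mean S Q B lsum N c (mat 1)) = (\<Sum>c\<in>S. \<pi> c * ln 2 + (\<Sum>k<N. \<pi> c * H k c 0))"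
    by (intro sum.cong) (simp_all add: distrib_left sum_distrib_left)
  also have "\<dots> = (\<Sum>c\<in>S. \<pi> c) * ln 2 + (\<Sum>c\<in>S. \<Sum>k<N. \<pi> c * H k c 0)"
    by (simp add: sum.distrib sum_distrib_right)
  also have "\<dots> = ln 2 + (\<Sum>k<N. e k)"
    by (subst sum.swap) (simp add: pi_sum e_def)
  finally show ?thesis .
qed

lemma (in mobius_chain) e_average_tendsto:
  assumes "(\<lambda>N. (\<Sum>c\<in>S. \<pi> c * path_mean S Q B lsum N c (mat 1)) / real N) \<longlonglongrightarrow> l"
  shows "(\<lambda>N. (\<Sum>k<N. e k) / real N) \<longlonglongrightarrow> l"
  using tendsto_diff[OF assms[unfolded mean_e] lim_const_over_n[of "ln 2"]]
  by (simp add: add_divide_distrib)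

lemma Tmm_divide: "(Tmm S Q \<pi> B m ^^ l) (\<lambda>c n. u c n / a) = (\<lambda>c n. (Tmm S Q \<pi> B m ^^ l) u c n / a)"
proof (induction l)
  case (Suc l)
  have "(\<Sum>r\<in>S. w r * (\<Sum>n<m. b r n * (v r n / a))) = (\<Sum>r\<in>S. w r * (\<Sum>n<m. b r n * v r n)) / a" for w b v
    by (simp add: sum_divide_distrib sum_distrib_left)
  then have "Tmm S Q \<pi> B m (\<lambda>c n. v c n / a) = (\<lambda>c n. Tmm S Q \<pi> B m v c n / a)" for v
    unfolding Tmm_def by (simp only:) (simp add: fun_eq_iff)
  then show ?case using Suc by simp
qed simp

lemma bracket0_divide: "bracket0 S \<pi> (\<lambda>c n. u c n / a) = bracket0 S \<pi> u / a"
  by (simp add: bracket0_def sum_divide_distrib)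

theorem theorem4p12:
  fixes A :: "'x::finite \<Rightarrow> real^2^2"
    and P :: "'x \<Rightarrow> 'x \<Rightarrow> real"
    and p :: "'x \<Rightarrow> real"
    and \<mu> :: "'x stream measure"
    and lam :: real
    and comps :: "'x \<Rightarrow> nat set"
    and L :: "'x \<Rightarrow> nat \<Rightarrow> real^2^2"
    and C :: "'x arc set"
    and r0 :: "'x arc"
    and \<pi> :: "'x arc list \<Rightarrow> real"
    and \<rho> :: real
  assumes invA: "\<forall>i. invertible (A i)"
    and stoch: "row_stochastic P"
    and irr: "irreducible_mat P"
    and stat: "stationary_vec P p"
    and markov: "markov_measure P p \<mu>"
    and lyap: "lyapunov_value A \<mu> lam"
    and uh: "proj_uniformly_hyperbolic A P"
    and mc: "multicone_data A P comps L"
    and rec: "recurrent_class (Rset A P comps L) P C"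
    and r0C: "r0 \<in> C"
    and pi_stat: "stationary_on (red_states P C r0 (period_at (Qedges C P) r0))
                    (red_Q P (period_at (Qedges C P) r0)) \<pi>"
    and rho: "0 < \<rho>" "\<rho> < 1"
    and contr: "\<forall>c\<in>red_states P C r0 (period_at (Qedges C P) r0). \<forall>x\<in>{-1..1}.
                  \<bar>mob_f (prodB (Bmat A L) c) x\<bar> \<le> \<rho>"
  defines "d \<equiv> period_at (Qedges C P) r0"
    and "C' \<equiv> red_states P C r0 (period_at (Qedges C P) r0)"
    and "Q' \<equiv> red_Q P (period_at (Qedges C P) r0)"
    and "B' \<equiv> prodB (Bmat A L)"
  defines "E \<equiv> 1 / (1 - \<rho>) *
               Max ((\<lambda>c. \<bar>mob_fT (B' c) 0\<bar> / (1 + sqrt (1 - \<bar>mob_fT (B' c) 0\<bar>^2))) ` C') *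
               (\<Sum>c\<in>C'. \<pi> c * dhyp (mob_f (B' c) 0) 0)"
    and "D \<equiv> Max ((\<lambda>c. \<bar>mob_fT (B' c) 0\<bar>) ` C')"
    and "vhat \<equiv> (\<lambda>c n. seed C' Q' \<pi> B' c n / real d)"
  shows "0 \<le> D \<and> D < 1 \<and>
         0 < Kconst \<rho> \<and>
         Kconst \<rho> \<le> min (\<rho> / sqrt (1 - \<rho>^2))
                          (2 * \<rho> / (pi * (1 + \<rho>)) * (pi / 2 + ln ((1 + \<rho>) / (1 - \<rho>)))) \<and>
         (\<forall>n m::nat. 1 \<le> n \<longrightarrow> 2 \<le> m \<longrightarrow>
            (let \<rho>m = \<rho> ^ (m - 1) * Kconst \<rho> in
             \<bar>lam - (\<Sum>l<n. bracket0 C' \<pi> ((Tmm C' Q' \<pi> B' m ^^ l) vhat))\<bar>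
               \<le> E / real d * \<rho> ^ (n - 1)
                 + 2 / real d * ln (1 / (1 - \<rho> * D)) *
                     (((1 + \<rho>m) ^ (n - 1) - 1 - real (n - 1) * \<rho>m) / \<rho>m)
                 + 2 * real (n - 1) * \<rho> ^ m * D ^ m / (real m * real d * (1 - \<rho> * D))))"
proof -
  have C': "C' = red_states P C r0 d" and Q': "Q' = red_Q P d"
    by (simp_all add: C'_def Q'_def d_def)
  interpret mc: multicone_chain A P comps L C
    by unfold_locales (rule stoch mc rec)+
  have dd: "d = period_at (Qedges C P) r0" by (simp add: d_def)
  interpret ch: mobius_chain C' Q' \<pi> B' \<rho>
  proof (rule mobius_chain.intro)
    show "finite C'" unfolding C' by (rule mc.finite_red_states[OF r0C dd])
    show "0 \<le> Q' r s" for r s unfolding Q' by (rule mc.red_Q_nonneg[OF r0C dd])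
    show "(\<Sum>s\<in>C'. Q' r s) = 1" if "r \<in> C'" for r
      using that unfolding C' Q' by (rule mc.red_Q_row[OF r0C dd])
    show "stationary_on C' Q' \<pi>" using pi_stat by (simp add: C'_def Q'_def)
    fix c assume c: "c \<in> C'"
    show "contracting_matrix (B' c) \<rho>"
    proof unfold_locales
      fix i j
      have "set c \<subseteq> C" "c \<noteq> []"
        using c mc.red_states_subset[OF r0C dd] mc.red_states_last(3)[OF r0C dd] unfolding C' by blast+
      then show "B' c $ i $ j > 0"
        unfolding B'_def by (intro mc.prodB_positive[OF r0C dd] mc.Bmat_props(1)) auto
    next
      show "\<bar>mob_f (B' c) x\<bar> \<le> \<rho>" if "\<bar>x\<bar> \<le> 1" for x
        using contr c that by (auto simp: C'_def B'_def abs_le_iff)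
    qed (rule rho)+
  qed
  have D: "D = ch.D" by (simp add: D_def ch.D_def)
  have E: "E = ch.E" by (simp add: E_def ch.E_def ch.lip_def)
  have dpos: "0 < d" by (rule mc.d_pos[OF r0C dd])
  have "(\<lambda>n. path_mean UNIV P A lnorm n j (mat 1) / real n) \<longlonglongrightarrow> lam" for j
    by (rule path_mean_tendsto_lyapunov[OF invA stoch irr stat markov lyap])
  then have "(\<lambda>n. path_mean C (Qm P) (Bmat A L) lsum n r (mat 1) / real n) \<longlonglongrightarrow> lam" if "r \<in> C" for r
    using that by (rule mc.arc_path_mean_tendsto)
  then have "(\<lambda>N. (\<Sum>c\<in>C'. \<pi> c * path_mean C' Q' B' lsum N c (mat 1)) / real N) \<longlonglongrightarrow> real d * lam"
    unfolding C' Q' B'_def using ch.stationary[unfolded C' Q'] by (rule mc.red_mean_tendsto[OF r0C dd])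
  then have lim: "(\<lambda>N. (\<Sum>k<N. ch.e k) / real N) \<longlonglongrightarrow> real d * lam"
    by (rule ch.e_average_tendsto)
  have bound: "\<bar>lam - (\<Sum>l<n. bracket0 C' \<pi> ((Tmm C' Q' \<pi> B' m ^^ l) vhat))\<bar>
      \<le> E / real d * \<rho> ^ (n - 1)
        + 2 / real d * ln (1 / (1 - \<rho> * D)) *
            (((1 + \<rho> ^ (m - 1) * Kconst \<rho>) ^ (n - 1) - 1 - real (n - 1) * (\<rho> ^ (m - 1) * Kconst \<rho>)) / (\<rho> ^ (m - 1) * Kconst \<rho>))
        + 2 * real (n - 1) * \<rho> ^ m * D ^ m / (real m * real d * (1 - \<rho> * D))"
    if n: "1 \<le> n" and m: "2 \<le> m" for n m
  proof -
    \<comment> \<open>The sum for the unscaled seed, which approximates d times the exponent;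
      linearity of operator and bracket allows dividing by \<open>d\<close> at the end.\<close>
    define s where "s = (\<Sum>l<n. bracket0 C' \<pi> ((Tmm C' Q' \<pi> B' m ^^ l) (seed C' Q' \<pi> B')))"
    define W where "W = ((1 + \<rho> ^ (m - 1) * Kconst \<rho>) ^ (n - 1) - 1 - real (n - 1) * (\<rho> ^ (m - 1) * Kconst \<rho>)) / (\<rho> ^ (m - 1) * Kconst \<rho>)"
    have "\<bar>real d * lam - s\<bar> \<le> E * \<rho> ^ (n - 1) + 2 * ln (1 / (1 - \<rho> * D)) * W
        + 2 * real (n - 1) * \<rho> ^ m * D ^ m / (m * (1 - \<rho> * D))"
      using ch.truncated_sum_error[OF lim n, of m] m unfolding s_def W_def E D by simp
    then have "\<bar>real d * lam - s\<bar> / real d \<le> (E * \<rho> ^ (n - 1) + 2 * ln (1 / (1 - \<rho> * D)) * W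
        + 2 * real (n - 1) * \<rho> ^ m * D ^ m / (m * (1 - \<rho> * D))) / real d"
      by (rule divide_right_mono) simp
    moreover have "\<bar>real d * lam - s\<bar> / real d = \<bar>lam - s / real d\<bar>"
    proof -
      have "lam - s / real d = (real d * lam - s) / real d" using dpos by (simp add: field_simps)
      then show ?thesis by (simp add: abs_divide)
    qed
    moreover have "(\<Sum>l<n. bracket0 C' \<pi> ((Tmm C' Q' \<pi> B' m ^^ l) vhat)) = s / real d"
      unfolding vhat_def Tmm_divide bracket0_divide s_def by (simp add: sum_divide_distrib)
    ultimately show ?thesis
      unfolding W_def[symmetric] by (simp add: add_divide_distrib mult_ac)
  qed
  show ?thesis
    unfolding Let_def
    using ch.D_range Kconst_pos[OF rho] Kconst_le_L2[OF rho] Kconst_le_log[OF rho] bound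
    by (intro conjI allI impI) (auto simp: D)
qed

end
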